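(* Let $G$ be a Polish group and $L$ an affine $G$-flow with the following property: whenever $K,Q$ are affine $G$-flows and $\phi\colon K\to L$, $\psi\colon Q\to K$ are proximally irreducible extensions, the composition $\phi\circ\psi\colon Q\to L$ is also a proximally irreducible extension. Then there exist a $G$-flow $X$ such that the affine $G$-flow $P(X)$ is proximally irreducible, and a proximally irreducible extension $\phi\colon P(X)\to L$; that is, $L$ admits a maximal proximally irreducible extension.
   Context: A $G$-flow is a (nonempty) compact Hausdorff space with a continuous left action of $G$. For a compact space $X$, $P(X)$ is the space of regular Borel probability measures on $X$ with the weak$^*$ topology. An affine $G$-flow is a (nonempty) compact convex set (a compact convex subset of a Hausdorff locally convex topological vector space) with a continuous action of $G$ by affine homeomorphisms; if $X$ is a $G$-flow then $P(X)$ is an affine $G$-flow. An affine subflow is a nonempty closed convex $G$-invariant subset. An affine extension is a surjective continuous affine $G$-equivariant map. $\overline{\mathrm{ext}}(K)$ is the closure of the set of extreme points of $K$, and $\mathrm{conv}(A)$ the set of (finite) convex combinations of elements of $A$. An affine extension $\phi\colon L\to K$ of affine $G$-flows is a proximally irreducible extension if every affine subflow $C\subseteq L$ satisfying $C\cap\mathrm{conv}(\overline{\mathrm{ext}}(L)\cap\phi^{-1}(\{y\}))\neq\emptyset$ for all $y\in\overline{\mathrm{ext}}(K)$ equals $L$. An affine $G$-flow $K$ is proximally irreducible if every proximally irreducible extension $L\to K$ is an isomorphism. *)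

theory Defs
  imports "HOL-Probability.Probability"
begin

section \<open>Hausdorff locally convex topological vector spaces\<close>

class locally_convex_space = real_vector + t2_space + topological_group_add +
  assumes tendsto_scaleR_nhds:
    "((\<lambda>p. fst p *\<^sub>R snd p) \<longlongrightarrow> (r :: real) *\<^sub>R a) (nhds r \<times>\<^sub>F nhds a)"
  assumes convex_nhds_zero:
    "open U \<Longrightarrow> 0 \<in> U \<Longrightarrow> \<exists>V. open V \<and> 0 \<in> V \<and> V \<subseteq> U \<and>
      (\<forall>x\<in>V. \<forall>y\<in>V. \<forall>u\<ge>0. \<forall>v\<ge>0. (u :: real) + v = 1 \<longrightarrow> u *\<^sub>R x + v *\<^sub>R y \<in> V)"

instance real_normed_vector \<subseteq> locally_convex_space
proof
  fix r :: real and a :: 'a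
  show "((\<lambda>p. fst p *\<^sub>R snd p) \<longlongrightarrow> r *\<^sub>R a) (nhds r \<times>\<^sub>F nhds a)"
    by (intro tendsto_scaleR filterlim_fst filterlim_snd)
next
  fix U :: "'a set"
  assume "open U" "0 \<in> U"
  then obtain e where "e > 0" "ball 0 e \<subseteq> U"
    by (meson openE)
  then show "\<exists>V. open V \<and> 0 \<in> V \<and> V \<subseteq> U \<and>
      (\<forall>x\<in>V. \<forall>y\<in>V. \<forall>u\<ge>0. \<forall>v\<ge>0. (u :: real) + v = 1 \<longrightarrow> u *\<^sub>R x + v *\<^sub>R y \<in> V)"
    by (intro exI[of _ "ball 0 e"]) (use convex_ball[of "0::'a" e] in \<open>auto simp: convex_def\<close>)
qed

lemma locally_convex_nhds_zero:
  fixes U :: "'a::locally_convex_space set"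
  assumes "open U" "0 \<in> U"
  shows "\<exists>V. open V \<and> 0 \<in> V \<and> V \<subseteq> U \<and> convex V"
  using convex_nhds_zero[OF assms] unfolding convex_def .

text \<open>The space of functions \<open>I \<Rightarrow> real\<close> with the pointwise operations and the product topology. It is
  a separate type because the class instances of \<open>I \<Rightarrow> real\<close> that are present in the library
  (\<open>metric_space\<close> for countable \<open>I\<close>) exclude a \<open>t2_space\<close> instance for arbitrary \<open>I\<close>.\<close>

typedef 'i real_product = "UNIV :: ('i \<Rightarrow> real) set"
  morphisms coord of_coords by simp

lemma coord_of_coords [simp]: "coord (of_coords f) = f"
  by (simp add: of_coords_inverse)

lemma real_product_eq_iff: "x = y \<longleftrightarrow> (\<forall>i. coord x i = coord y i)"
  by (metis coord_inject ext)

instantiation real_product :: (type) real_vector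
begin

definition "0 = of_coords (\<lambda>i. 0)"
definition "x + y = of_coords (\<lambda>i. coord x i + coord y i)"
definition "x - y = of_coords (\<lambda>i. coord x i - coord y i)"
definition "- x = of_coords (\<lambda>i. - coord x i)"
definition "r *\<^sub>R x = of_coords (\<lambda>i. r * coord x i)"

instance
  by standard
    (simp_all add: real_product_eq_iff zero_real_product_def plus_real_product_def
      minus_real_product_def uminus_real_product_def scaleR_real_product_def algebra_simps)

end

lemma coord_simps [simp]:
  "coord 0 i = 0" "coord (x + y) i = coord x i + coord y i"
  "coord (x - y) i = coord x i - coord y i" "coord (- x) i = - coord x i"
  "coord (r *\<^sub>R x) i = r * coord x i"
  by (simp_all add: zero_real_product_def plus_real_product_def minus_real_product_def
      uminus_real_product_def scaleR_real_product_def)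

lemma bij_coord: "bij coord"
  by (metis bijI' coord_inject coord_of_coords)

instantiation real_product :: (type) topological_space
begin

definition open_real_product :: "'a real_product set \<Rightarrow> bool"
  where "open_real_product U \<longleftrightarrow> open (coord ` U)"

instance
proof
  show "open (UNIV :: 'a real_product set)"
    by (simp only: open_real_product_def bij_is_surj[OF bij_coord] open_UNIV)
next
  fix S T :: "'a real_product set"
  assume "open S" "open T"
  then show "open (S \<inter> T)"
    by (simp add: open_real_product_def image_Int bij_is_inj[OF bij_coord] open_Int)
next
  fix K :: "'a real_product set set"
  assume "\<forall>S\<in>K. open S"
  then show "open (\<Union>K)"
    by (simp add: open_real_product_def image_Union open_Union)
qed

end

lemma open_real_product_iff: "open U \<longleftrightarrow> open (of_coords -` U)"
proof -
  have "coord ` U = of_coords -` U"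
    by (force simp: coord_inverse image_iff)
  then show ?thesis by (simp add: open_real_product_def)
qed

lemma tendsto_real_product_iff:
  fixes f :: "'b \<Rightarrow> 'i real_product"
  shows "(f \<longlongrightarrow> l) F \<longleftrightarrow> (\<forall>i. ((\<lambda>x. coord (f x) i) \<longlongrightarrow> coord l i) F)"
proof -
  have "(f \<longlongrightarrow> l) F \<longleftrightarrow> ((\<lambda>x. coord (f x)) \<longlongrightarrow> coord l) F"
  proof
    assume *: "(f \<longlongrightarrow> l) F"
    show "((\<lambda>x. coord (f x)) \<longlongrightarrow> coord l) F"
    proof (rule topological_tendstoI)
      fix S :: "('i \<Rightarrow> real) set" assume S: "open S" "coord l \<in> S"
      have "open (coord -` S)"
        using S(1) by (simp add: open_real_product_iff vimage_def)
      from topological_tendstoD[OF * this] S(2)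
      show "eventually (\<lambda>x. coord (f x) \<in> S) F" by simp
    qed
  next
    assume *: "((\<lambda>x. coord (f x)) \<longlongrightarrow> coord l) F"
    show "(f \<longlongrightarrow> l) F"
    proof (rule topological_tendstoI)
      fix S :: "'i real_product set" assume S: "open S" "l \<in> S"
      from topological_tendstoD[OF *, of "of_coords -` S"] S
      show "eventually (\<lambda>x. f x \<in> S) F" by (simp add: open_real_product_iff coord_inverse)
    qed
  qed
  also have "\<dots> \<longleftrightarrow> limitin euclidean (\<lambda>x. coord (f x)) (coord l) F"
    by simp
  also have "\<dots> \<longleftrightarrow> limitin (product_topology (\<lambda>i. euclidean) UNIV) (\<lambda>x. coord (f x)) (coord l) F"
    by (simp add: euclidean_product_topology)
  also have "\<dots> \<longleftrightarrow> (\<forall>i. ((\<lambda>x. coord (f x) i) \<longlongrightarrow> coord l i) F)"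
    by (simp add: limitin_componentwise)
  finally show ?thesis .
qed

lemma tendsto_coord: "((\<lambda>x. coord x i) \<longlongrightarrow> coord l i) (nhds l)"
  using filterlim_ident[of "nhds l"] unfolding tendsto_real_product_iff by auto

lemma continuous_on_real_product_iff:
  "continuous_on S f \<longleftrightarrow> (\<forall>i. continuous_on S (\<lambda>x. coord (f x) i))"
  unfolding continuous_on_def tendsto_real_product_iff by blast

lemma open_coord_vimage: "open S \<Longrightarrow> open ((\<lambda>x. coord x i) -` S)"
  using continuous_on_real_product_iff[of UNIV "\<lambda>x. x"]
  by (auto intro!: open_vimage simp: continuous_on_id)

instance real_product :: (type) locally_convex_space
proof
  fix x y :: "'a real_product"
  assume "x \<noteq> y"
  then obtain i where "coord x i \<noteq> coord y i"
    by (auto simp: real_product_eq_iff)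
  then obtain U V where "open U" "open V" "coord x i \<in> U" "coord y i \<in> V" "U \<inter> V = {}"
    using hausdorff by metis
  then show "\<exists>U V. open U \<and> open V \<and> x \<in> U \<and> y \<in> V \<and> U \<inter> V = {}"
    using open_coord_vimage
    by (intro exI[of _ "(\<lambda>x. coord x i) -` U"] exI[of _ "(\<lambda>x. coord x i) -` V"]) auto
next
  fix a b :: "'a real_product"
  have "((\<lambda>p. coord (fst p) i) \<longlongrightarrow> coord a i) (nhds a \<times>\<^sub>F nhds b)"
       "((\<lambda>p. coord (snd p) i) \<longlongrightarrow> coord b i) (nhds a \<times>\<^sub>F nhds b)" for i
    by (rule filterlim_compose[OF tendsto_coord filterlim_fst],
        rule filterlim_compose[OF tendsto_coord filterlim_snd])
  then show "((\<lambda>p. fst p + snd p) \<longlongrightarrow> a + b) (nhds a \<times>\<^sub>F nhds b)"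
    unfolding tendsto_real_product_iff by (auto intro!: tendsto_add)
next
  fix a :: "'a real_product"
  show "(uminus \<longlongrightarrow> - a) (nhds a)"
    unfolding tendsto_real_product_iff by (auto intro!: tendsto_minus tendsto_coord)
next
  fix r :: real and a :: "'a real_product"
  have "((\<lambda>p. coord (snd p) i) \<longlongrightarrow> coord a i) (nhds r \<times>\<^sub>F nhds a)" for i
    by (rule filterlim_compose[OF tendsto_coord filterlim_snd])
  then show "((\<lambda>p. fst p *\<^sub>R snd p) \<longlongrightarrow> r *\<^sub>R a) (nhds r \<times>\<^sub>F nhds a)"
    unfolding tendsto_real_product_iff by (auto intro!: tendsto_mult filterlim_fst)
next
  fix U :: "'a real_product set"
  assume U: "open U" "0 \<in> U"
  then have "open (of_coords -` U)" "(\<lambda>_. 0) \<in> of_coords -` U"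
    by (auto simp: open_real_product_iff zero_real_product_def)
  then obtain X where X: "(\<lambda>_. 0) \<in> Pi\<^sub>E UNIV X" "\<And>i. open (X i)" "finite {i. X i \<noteq> UNIV}"
      "Pi\<^sub>E UNIV X \<subseteq> of_coords -` U"
    using product_topology_open_contains_basis[of "\<lambda>_. euclidean" UNIV "of_coords -` U" "\<lambda>_. 0"]
    by (auto simp: open_fun_def)
  have "\<exists>V. open V \<and> 0 \<in> V \<and> convex V \<and> V \<subseteq> X i \<and> (X i = UNIV \<longrightarrow> V = UNIV)" for i
  proof (cases "X i = UNIV")
    case False
    have "0 \<in> X i" using X(1) by (auto simp: PiE_iff)
    with locally_convex_nhds_zero[OF X(2)] False show ?thesis by blast
  qed auto
  then obtain V where V: "\<And>i. open (V i)" "\<And>i. 0 \<in> V i" "\<And>i. convex (V i)" "\<And>i. V i \<subseteq> X i"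
     "\<And>i. X i = UNIV \<Longrightarrow> V i = UNIV"
    by metis
  define W where "W = coord -` Pi\<^sub>E UNIV V"
  have "finite {i. V i \<noteq> UNIV}"
    by (rule finite_subset[OF _ X(3)]) (use V(5) in auto)
  then have "open (Pi\<^sub>E UNIV V)"
    using V(1) by (intro open_PiE) auto
  then have "open W"
    by (simp add: open_real_product_iff W_def vimage_def)
  moreover have "u *\<^sub>R x + v *\<^sub>R y \<in> W"
    if "x \<in> W" "y \<in> W" "u \<ge> 0" "v \<ge> 0" "u + v = 1" for x y :: "'a real_product" and u v :: real
    using that V(3) by (auto simp: W_def convex_def PiE_iff)
  moreover have "W \<subseteq> U"
  proof
    fix x assume "x \<in> W"
    then have "coord x \<in> Pi\<^sub>E UNIV X"
      using V(4) by (auto simp: W_def PiE_iff)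
    with X(4) show "x \<in> U" by (auto simp: coord_inverse)
  qed
  moreover have "0 \<in> W" using V(2) by (auto simp: W_def PiE_iff)
  ultimately show "\<exists>V. open V \<and> 0 \<in> V \<and> V \<subseteq> U \<and>
      (\<forall>x\<in>V. \<forall>y\<in>V. \<forall>u\<ge>0. \<forall>v\<ge>0. (u :: real) + v = 1 \<longrightarrow> u *\<^sub>R x + v *\<^sub>R y \<in> V)"
    by (intro exI[of _ W]) auto
qed

section \<open>Flows and affine flows\<close>

text \<open>The acting group is a type of class \<open>group_add\<close>, which is not assumed to be commutative:
  the group operation is written \<open>+\<close> and the neutral element \<open>0\<close>.\<close>

definition continuous_action ::
    "('g::{group_add, topological_space} \<Rightarrow> 'x \<Rightarrow> 'x) \<Rightarrow> 'x topology \<Rightarrow> bool"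
  where "continuous_action \<alpha> X \<longleftrightarrow>
    (\<forall>x\<in>topspace X. \<alpha> 0 x = x) \<and>
    (\<forall>g h. \<forall>x\<in>topspace X. \<alpha> (g + h) x = \<alpha> g (\<alpha> h x)) \<and>
    continuous_map (prod_topology euclidean X) X (\<lambda>(g, x). \<alpha> g x)"

definition flow :: "('g::{group_add, topological_space} \<Rightarrow> 'x \<Rightarrow> 'x) \<Rightarrow> 'x topology \<Rightarrow> bool"
  where "flow \<alpha> X \<longleftrightarrow>
    topspace X \<noteq> {} \<and> compact_space X \<and> Hausdorff_space X \<and> continuous_action \<alpha> X"

definition affine_map_on :: "'a::real_vector set \<Rightarrow> ('a \<Rightarrow> 'b::real_vector) \<Rightarrow> bool"
  where "affine_map_on K f \<longleftrightarrow>
    (\<forall>x\<in>K. \<forall>y\<in>K. \<forall>t\<in>{0..1}. f ((1 - t) *\<^sub>R x + t *\<^sub>R y) = (1 - t) *\<^sub>R f x + t *\<^sub>R f y)"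

definition affine_flow ::
    "('g::{group_add, topological_space} \<Rightarrow> 'a \<Rightarrow> 'a) \<Rightarrow> 'a::locally_convex_space set \<Rightarrow> bool"
  where "affine_flow \<alpha> K \<longleftrightarrow>
    K \<noteq> {} \<and> compact K \<and> convex K \<and>
    continuous_action \<alpha> (top_of_set K) \<and> (\<forall>g. affine_map_on K (\<alpha> g))"

definition affine_subflow ::
    "('g::{group_add, topological_space} \<Rightarrow> 'a \<Rightarrow> 'a) \<Rightarrow>
      'a::locally_convex_space set \<Rightarrow> 'a set \<Rightarrow> bool"
  where "affine_subflow \<alpha> K C \<longleftrightarrow>
    C \<subseteq> K \<and> C \<noteq> {} \<and> closed C \<and> convex C \<and> (\<forall>g. \<alpha> g ` C \<subseteq> C)"

text \<open>\<open>affine_extension \<beta> L \<alpha> K \<phi>\<close>: \<open>\<phi>\<close> is an affine extension from the flow \<open>(L, \<beta>)\<close> to the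
  flow \<open>(K, \<alpha>)\<close>. The order of the arguments is the same in the definitions below.\<close>

definition affine_extension ::
    "('g::{group_add, topological_space} \<Rightarrow> 'a \<Rightarrow> 'a) \<Rightarrow> 'a::locally_convex_space set \<Rightarrow>
     ('g \<Rightarrow> 'b \<Rightarrow> 'b) \<Rightarrow> 'b::locally_convex_space set \<Rightarrow> ('a \<Rightarrow> 'b) \<Rightarrow> bool"
  where "affine_extension \<beta> L \<alpha> K \<phi> \<longleftrightarrow>
    affine_flow \<beta> L \<and> affine_flow \<alpha> K \<and>
    continuous_on L \<phi> \<and> \<phi> ` L = K \<and> affine_map_on L \<phi> \<and>
    (\<forall>g. \<forall>x\<in>L. \<phi> (\<beta> g x) = \<alpha> g (\<phi> x))"

definition affine_isomorphism ::
    "('g::{group_add, topological_space} \<Rightarrow> 'a \<Rightarrow> 'a) \<Rightarrow> 'a::locally_convex_space set \<Rightarrow>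
     ('g \<Rightarrow> 'b \<Rightarrow> 'b) \<Rightarrow> 'b::locally_convex_space set \<Rightarrow> ('a \<Rightarrow> 'b) \<Rightarrow> bool"
  where "affine_isomorphism \<beta> L \<alpha> K \<phi> \<longleftrightarrow>
    affine_extension \<beta> L \<alpha> K \<phi> \<and> (\<exists>\<psi>. homeomorphism L K \<phi> \<psi>)"

definition ext_closure :: "'a::locally_convex_space set \<Rightarrow> 'a set"
  where "ext_closure K = closure {x. x extreme_point_of K}"

definition prox_irreducible_extension ::
    "('g::{group_add, topological_space} \<Rightarrow> 'a \<Rightarrow> 'a) \<Rightarrow> 'a::locally_convex_space set \<Rightarrow>
     ('g \<Rightarrow> 'b \<Rightarrow> 'b) \<Rightarrow> 'b::locally_convex_space set \<Rightarrow> ('a \<Rightarrow> 'b) \<Rightarrow> bool"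
  where "prox_irreducible_extension \<beta> L \<alpha> K \<phi> \<longleftrightarrow>
    affine_extension \<beta> L \<alpha> K \<phi> \<and>
    (\<forall>C. affine_subflow \<beta> L C \<and>
         (\<forall>y\<in>ext_closure K. C \<inter> convex hull (ext_closure L \<inter> \<phi> -` {y}) \<noteq> {}) \<longrightarrow> C = L)"

text \<open>HOL cannot quantify over all affine flows inside a formula, since their ambient spaces have
  different types. But if \<open>\<phi> : L \<rightarrow> K\<close> is a proximally irreducible extension, then \<open>L\<close> is the closed
  convex hull of the orbits of a family of points \<open>p y\<close>, where \<open>y\<close> ranges over \<open>K\<close>. Hence a continuous
  affine function on \<open>L\<close> is determined by its values at the points \<open>g \<cdot> p y\<close>, so it is determined by a
  function \<open>G \<times> K \<rightarrow> \<real>\<close>, and evaluation at these functions embeds \<open>L\<close> into the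
  space below. So all proximally irreducible extensions of \<open>K\<close> occur in this space, up to
  isomorphism: see \<open>prox_irreducible_extension_representation\<close>. In particular the definition of
  \<open>prox_irreducible\<close> implies the isomorphism property for extensions in every locally convex space:
  see \<open>prox_irreducible_imp_isomorphism\<close>. Likewise, if \<open>P(X)\<close> is a proximally irreducible extension
  of \<open>K\<close>, then \<open>X\<close>, which embeds into \<open>P(X)\<close> by point masses, also has a copy in this space.\<close>

type_synonym ('g, 'a) extension_space = "('g \<times> 'a \<Rightarrow> real) real_product"

definition prox_irreducible ::
    "('g::{group_add, topological_space} \<Rightarrow> 'a \<Rightarrow> 'a) \<Rightarrow> 'a::locally_convex_space set \<Rightarrow> bool"
  where "prox_irreducible \<alpha> K \<longleftrightarrow>
    affine_flow \<alpha> K \<and>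
    (\<forall>\<beta> (L :: ('g, 'a) extension_space set) \<phi>.
       prox_irreducible_extension \<beta> L \<alpha> K \<phi> \<longrightarrow> affine_isomorphism \<beta> L \<alpha> K \<phi>)"

section \<open>The affine flow of probability measures\<close>

definition borel_of :: "'x topology \<Rightarrow> 'x measure"
  where "borel_of X = sigma (topspace X) {U. openin X U}"

definition regular_borel_prob :: "'x topology \<Rightarrow> 'x measure \<Rightarrow> bool"
  where "regular_borel_prob X \<mu> \<longleftrightarrow>
    prob_space \<mu> \<and> space \<mu> = topspace X \<and> sets \<mu> = sets (borel_of X) \<and>
    (\<forall>A\<in>sets \<mu>. emeasure \<mu> A = (INF U\<in>{U. openin X U \<and> A \<subseteq> U}. emeasure \<mu> U)) \<and>
    (\<forall>A\<in>sets \<mu>. emeasure \<mu> A = (SUP C\<in>{C. compactin X C \<and> C \<subseteq> A}. emeasure \<mu> C))"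

text \<open>A regular Borel probability measure \<open>\<mu>\<close> on a compact Hausdorff space \<open>X\<close> is identified with the
  functional \<open>f \<mapsto> \<integral> f d\<mu>\<close> on \<open>C(X)\<close>, extended by \<open>0\<close> to the functions that are not continuous
  on \<open>X\<close>. The product topology then induces the weak* topology, the convex structure is the one
  of measures, and \<open>pushforward_action\<close> is the action by pushforward of measures
  (\<open>pushforward_action_integral_functional\<close>).\<close>

definition integral_functional :: "'x topology \<Rightarrow> 'x measure \<Rightarrow> ('x \<Rightarrow> real) real_product"
  where "integral_functional X \<mu> =
    of_coords (\<lambda>f. if continuous_map X euclideanreal f then \<integral>x. f x \<partial>\<mu> else 0)"

definition prob_measures :: "'x topology \<Rightarrow> ('x \<Rightarrow> real) real_product set"
  where "prob_measures X = integral_functional X ` {\<mu>. regular_borel_prob X \<mu>}"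

definition pushforward_action ::
    "('g \<Rightarrow> 'x \<Rightarrow> 'x) \<Rightarrow> 'g \<Rightarrow> ('x \<Rightarrow> real) real_product \<Rightarrow> ('x \<Rightarrow> real) real_product"
  where "pushforward_action \<alpha> g \<Lambda> = of_coords (\<lambda>f. coord \<Lambda> (\<lambda>x. f (\<alpha> g x)))"

lemma continuous_map_action:
  assumes "continuous_action \<alpha> X"
  shows "continuous_map X X (\<alpha> g)"
proof -
  have "continuous_map X (prod_topology euclidean X) (\<lambda>x. (g, x))"
    by (intro continuous_map_pairedI) auto
  then have "continuous_map X X ((\<lambda>(g, x). \<alpha> g x) \<circ> (\<lambda>x. (g, x)))"
    using assms unfolding continuous_action_def by (blast intro: continuous_map_compose)
  then show ?thesis by (simp add: o_def)
qed

lemma space_borel_of: "space (borel_of X) = topspace X"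
  and sets_borel_of: "sets (borel_of X) = sigma_sets (topspace X) {U. openin X U}"
  unfolding borel_of_def by (auto simp: space_measure_of_conv sets_measure_of_conv dest: openin_subset)

lemma continuous_map_measurable_borel_of:
  assumes "continuous_map X Y f"
  shows "f \<in> borel_of X \<rightarrow>\<^sub>M borel_of Y"
  unfolding borel_of_def[of Y]
proof (rule measurable_measure_of)
  show "{U. openin Y U} \<subseteq> Pow (topspace Y)" by (auto dest: openin_subset)
  show "f \<in> space (borel_of X) \<rightarrow> topspace Y"
    using assms by (auto simp: space_borel_of continuous_map_def)
  show "f -` U \<inter> space (borel_of X) \<in> sets (borel_of X)" if "U \<in> {U. openin Y U}" for U
  proof -
    have "openin X {x \<in> topspace X. f x \<in> U}" using assms that by (auto simp: continuous_map_def)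
    moreover have "{x \<in> topspace X. f x \<in> U} = f -` U \<inter> space (borel_of X)"
      by (auto simp: space_borel_of)
    ultimately show ?thesis by (auto simp: sets_borel_of)
  qed
qed

lemma pushforward_action_integral_functional:
  assumes X: "continuous_action \<alpha> X" and \<mu>: "sets \<mu> = sets (borel_of X)"
  shows "pushforward_action \<alpha> g (integral_functional X \<mu>) =
    integral_functional X (distr \<mu> (borel_of X) (\<alpha> g))"
proof -
  note cont = continuous_map_action[OF X]
  have meas: "\<alpha> g \<in> \<mu> \<rightarrow>\<^sub>M borel_of X"
    using continuous_map_measurable_borel_of[OF cont[of g]] measurable_cong_sets[OF \<mu> refl] by blast
  have iff: "continuous_map X euclideanreal (\<lambda>x. f (\<alpha> g x)) \<longleftrightarrow> continuous_map X euclideanreal f" for f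
  proof
    assume "continuous_map X euclideanreal f"
    then show "continuous_map X euclideanreal (\<lambda>x. f (\<alpha> g x))"
      using continuous_map_compose[OF cont] by (simp add: o_def)
  next
    assume "continuous_map X euclideanreal (\<lambda>x. f (\<alpha> g x))"
    from continuous_map_compose[OF cont[of "- g"] this]
    have *: "continuous_map X euclideanreal (\<lambda>x. f (\<alpha> g (\<alpha> (- g) x)))" by (simp add: o_def)
    have "\<alpha> g (\<alpha> (- g) x) = x" if "x \<in> topspace X" for x
    proof -
      have "\<alpha> (g + - g) x = \<alpha> g (\<alpha> (- g) x)" "\<alpha> 0 x = x"
        using X that unfolding continuous_action_def by blast+
      then show ?thesis by simp
    qed
    then show "continuous_map X euclideanreal f"
      by (intro continuous_map_eq[OF *]) simp
  qed
  have int: "(\<integral>x. f x \<partial>distr \<mu> (borel_of X) (\<alpha> g)) = (\<integral>x. f (\<alpha> g x) \<partial>\<mu>)"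
    if "continuous_map X euclideanreal f" for f
  proof (rule integral_distr[OF meas])
    have "f \<in> borel_of X \<rightarrow>\<^sub>M borel_of euclideanreal"
      by (rule continuous_map_measurable_borel_of[OF that])
    moreover have "borel_of euclideanreal = (borel :: real measure)"
      by (simp add: borel_of_def borel_def)
    ultimately show "f \<in> borel_measurable (borel_of X)" by simp
  qed
  show ?thesis
    using iff int
    by (auto simp: pushforward_action_def integral_functional_def fun_eq_iff intro!: arg_cong[of _ _ of_coords])
qed

section \<open>Separation of points and extreme points\<close>

definition sublinear :: "('a::real_vector \<Rightarrow> real) \<Rightarrow> bool"
  where "sublinear p \<longleftrightarrow> (\<forall>x y. p (x + y) \<le> p x + p y) \<and> (\<forall>r\<ge>0. \<forall>x. p (r *\<^sub>R x) = r * p x)"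

lemma sublinearD:
  assumes "sublinear p"
  shows "p (x + y) \<le> p x + p y" "r \<ge> 0 \<Longrightarrow> p (r *\<^sub>R x) = r * p x" "p 0 = 0" "- p (- x) \<le> p x"
proof -
  show 1: "p (x + y) \<le> p x + p y" for x y using assms by (simp add: sublinear_def)
  show 2: "r \<ge> 0 \<Longrightarrow> p (r *\<^sub>R x) = r * p x" for r x using assms by (simp add: sublinear_def)
  show "p 0 = 0" using 2[of 0 0] by simp
  with 1[of x "- x"] show "- p (- x) \<le> p x" by simp
qed

lemma sublinear_reduce:
  assumes p: "sublinear p"
  obtains q where "sublinear q" "\<And>x. q x \<le> p x" "q (- z) \<le> - p z"
proof -
  define q where "q = (\<lambda>x. INF t\<in>{0::real..}. p (x + t *\<^sub>R z) - t * p z)"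
  have low: "- p (- x) \<le> p (x + t *\<^sub>R z) - t * p z" if "t \<ge> 0" for x t
    using sublinearD(1)[OF p, of "x + t *\<^sub>R z" "- x"] sublinearD(2)[OF p that, of z] by simp
  have bdd: "bdd_below ((\<lambda>t. p (x + t *\<^sub>R z) - t * p z) ` {0::real..})" for x
    using low by (intro bdd_belowI2[where m = "- p (- x)"]) auto
  have le: "q x \<le> p (x + t *\<^sub>R z) - t * p z" if "t \<ge> 0" for x t
    unfolding q_def by (rule cINF_lower[OF bdd]) (use that in auto)
  have ge: "c \<le> q x" if "\<And>t. t \<ge> 0 \<Longrightarrow> c \<le> p (x + t *\<^sub>R z) - t * p z" for c x
    unfolding q_def by (rule cINF_greatest) (use that in auto)
  have add: "q (x + y) \<le> q x + q y" for x y
  proof -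
    have *: "q (x + y) - (p (y + t *\<^sub>R z) - t * p z) \<le> p (x + s *\<^sub>R z) - s * p z"
      if "s \<ge> 0" "t \<ge> 0" for s t
    proof -
      have "q (x + y) \<le> p ((x + s *\<^sub>R z) + (y + t *\<^sub>R z)) - (s + t) * p z"
        using le[of "s + t" "x + y"] that by (simp add: algebra_simps)
      also have "\<dots> \<le> p (x + s *\<^sub>R z) + p (y + t *\<^sub>R z) - (s + t) * p z"
        using sublinearD(1)[OF p] by simp
      finally show ?thesis by (simp add: algebra_simps)
    qed
    have "q (x + y) - q x \<le> p (y + t *\<^sub>R z) - t * p z" if "t \<ge> 0" for t
      using ge[of "q (x + y) - (p (y + t *\<^sub>R z) - t * p z)" x] *[OF _ that] by fastforce
    from ge[of "q (x + y) - q x" y, OF this] show ?thesis by simp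
  qed
  have q_le: "q x \<le> p x" for x using le[of 0 x] by simp
  have q0: "q 0 = 0"
    using q_le[of 0] ge[of 0 0] sublinearD(2,3)[OF p] by fastforce
  have hom_le: "r * q x \<le> q (r *\<^sub>R x)" if "r > 0" for r x
  proof (rule ge)
    fix t :: real assume t: "t \<ge> 0"
    have "r * q x \<le> r * (p (x + (t / r) *\<^sub>R z) - (t / r) * p z)"
      using le[of "t / r" x] t that by (intro mult_left_mono) auto
    also have "\<dots> = p (r *\<^sub>R (x + (t / r) *\<^sub>R z)) - t * p z"
      using that sublinearD(2)[OF p, of r "x + (t / r) *\<^sub>R z"] by (simp add: algebra_simps)
    also have "r *\<^sub>R (x + (t / r) *\<^sub>R z) = r *\<^sub>R x + t *\<^sub>R z"
      using that by (simp add: algebra_simps)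
    finally show "r * q x \<le> p (r *\<^sub>R x + t *\<^sub>R z) - t * p z" .
  qed
  have hom: "q (r *\<^sub>R x) = r * q x" if "r \<ge> 0" for r x
  proof (cases "r = 0")
    case False
    with that have r: "r > 0" by simp
    have "inverse r * q (r *\<^sub>R x) \<le> q x"
      using hom_le[of "inverse r" "r *\<^sub>R x"] r by simp
    then have "q (r *\<^sub>R x) \<le> r * q x"
      using r by (simp add: field_simps)
    with hom_le[OF r, of x] show ?thesis by simp
  qed (simp add: q0)
  show ?thesis
    using add hom q_le le[of 1 "- z"] sublinearD(3)[OF p]
    by (intro that[of q]) (auto simp: sublinear_def)
qed

lemma sublinear_minimal:
  assumes p: "sublinear (p :: 'a::real_vector \<Rightarrow> real)"
  obtains m where "sublinear m" "\<And>x. m x \<le> p x"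
    "\<And>q x. sublinear q \<Longrightarrow> (\<And>x. q x \<le> m x) \<Longrightarrow> q x = m x"
proof -
  define A where "A = {q. sublinear q \<and> (\<forall>x. q x \<le> p x)}"
  define P where "P = (\<lambda>q r :: 'a \<Rightarrow> real. \<forall>x. r x \<le> q x)"
  have po: "partial_order_on A (relation_of P A)"
    by (rule partial_order_on_relation_ofI) (auto simp: P_def fun_eq_iff intro: order_trans antisym)
  have "\<exists>m\<in>A. \<forall>q\<in>A. P m q \<longrightarrow> q = m"
  proof (rule predicate_Zorn[OF po])
    fix C assume C: "C \<in> Chains (relation_of P A)"
    then have CA: "q \<in> A" if "q \<in> C" for q
      using that by (auto simp: Chains_def relation_of_def)
    have tot: "P q r \<or> P r q" if "q \<in> C" "r \<in> C" for q r
      using C that by (auto simp: Chains_def relation_of_def)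
    show "\<exists>u\<in>A. \<forall>a\<in>C. P a u"
    proof (cases "C = {}")
      case True
      then show ?thesis using p by (auto simp: A_def)
    next
      case False
      define u where "u = (\<lambda>x. INF q\<in>C. q x)"
      have bdd: "bdd_below ((\<lambda>q. q x) ` C)" for x
      proof (rule bdd_belowI2[where m = "- p (- x)"])
        fix q assume "q \<in> C"
        then have q: "sublinear q" "q (- x) \<le> p (- x)" using CA by (auto simp: A_def)
        then show "- p (- x) \<le> q x" using sublinearD(4)[OF q(1), of x] by simp
      qed
      have le: "u x \<le> q x" if "q \<in> C" for q x
        unfolding u_def by (rule cINF_lower[OF bdd that])
      have ge: "c \<le> u x" if "\<And>q. q \<in> C \<Longrightarrow> c \<le> q x" for c x
        unfolding u_def by (rule cINF_greatest[OF False that])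
      have "u (x + y) \<le> u x + u y" for x y
      proof -
        have *: "u (x + y) - r y \<le> q x" if qr: "q \<in> C" "r \<in> C" for q r
        proof -
          obtain s where s: "s \<in> C" "s x \<le> q x" "s y \<le> r y"
            using tot[OF qr] qr unfolding P_def by blast
          have "u (x + y) \<le> s (x + y)" by (rule le[OF s(1)])
          also have "\<dots> \<le> s x + s y" using CA[OF s(1)] by (auto simp: A_def intro: sublinearD)
          finally show ?thesis using s by simp
        qed
        have "u (x + y) - u x \<le> r y" if "r \<in> C" for r
          using ge[of "u (x + y) - r y" x] *[OF _ that] by fastforce
        then have "u (x + y) - u x \<le> u y" by (rule ge)
        then show ?thesis by simp
      qed
      moreover have "u (r *\<^sub>R x) = r * u x" if "r \<ge> 0" for r x
      proof -
        have hom: "q (r *\<^sub>R x) = r * q x" if "q \<in> C" for q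
          using CA[OF that] \<open>r \<ge> 0\<close> by (auto simp: A_def intro: sublinearD)
        show ?thesis
        proof (cases "r = 0")
          case True
          have "q 0 = 0" if "q \<in> C" for q
            using CA[OF that] by (auto simp: A_def intro: sublinearD)
          then have "u 0 = (INF q\<in>C. 0)" unfolding u_def by (intro INF_cong) auto
          with True False show ?thesis by simp
        next
          case False
          with that have r: "r > 0" by simp
          have "u (r *\<^sub>R x) \<le> r * q x" if "q \<in> C" for q
            using le[OF that, of "r *\<^sub>R x"] hom[OF that] by simp
          then have "u (r *\<^sub>R x) / r \<le> u x"
            using r by (intro ge) (simp add: field_simps)
          moreover have "r * u x \<le> u (r *\<^sub>R x)"
            using le r by (intro ge) (simp add: hom)
          ultimately show ?thesis using r by (simp add: field_simps)
        qed
      qed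
      ultimately have "sublinear u" by (auto simp: sublinear_def)
      moreover have "u x \<le> p x" for x
        using False le CA by (fastforce simp: A_def intro: order_trans)
      ultimately have "u \<in> A" by (auto simp: A_def)
      then show ?thesis using le by (auto simp: P_def)
    qed
  qed
  then obtain m where m: "m \<in> A" "\<And>q. q \<in> A \<Longrightarrow> P m q \<Longrightarrow> q = m" by blast
  show ?thesis
  proof (rule that[of m])
    show "q x = m x" if "sublinear q" "\<And>x. q x \<le> m x" for q x
    proof -
      have "q \<in> A" using that m(1) by (auto simp: A_def intro: order_trans)
      with m(2)[of q] that show ?thesis by (simp add: P_def)
    qed
  qed (use m(1) in \<open>auto simp: A_def\<close>)
qed

lemma hahn_banach_dominated:
  assumes p: "sublinear (p :: 'a::real_vector \<Rightarrow> real)"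
  obtains f where "linear f" "\<And>x. f x \<le> p x" "f z \<ge> p z"
proof -
  obtain p0 where p0: "sublinear p0" "\<And>x. p0 x \<le> p x" "p0 (- z) \<le> - p z"
    using sublinear_reduce[OF p] by blast
  obtain m where m: "sublinear m" "\<And>x. m x \<le> p0 x"
    and min: "\<And>q x. sublinear q \<Longrightarrow> (\<And>x. q x \<le> m x) \<Longrightarrow> q x = m x"
    using sublinear_minimal[OF p0(1)] by blast
  have neg: "m (- a) = - m a" for a
  proof -
    obtain q where q: "sublinear q" "\<And>x. q x \<le> m x" "q (- a) \<le> - m a"
      using sublinear_reduce[OF m(1)] by blast
    with min[OF q(1,2), of "- a"] have "m (- a) \<le> - m a" by simp
    with sublinearD(4)[OF m(1), of a] show ?thesis by simp
  qed
  have add: "m (x + y) = m x + m y" for x y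
    using sublinearD(1)[OF m(1), of x y] sublinearD(1)[OF m(1), of "- x" "- y"]
      neg[of "x + y"] neg[of x] neg[of y] by simp
  have "m (r *\<^sub>R x) = r *\<^sub>R m x" for r x
  proof (cases "r \<ge> 0")
    case True
    then show ?thesis using sublinearD(2)[OF m(1)] by simp
  next
    case False
    then have "m ((- r) *\<^sub>R x) = (- r) * m x" using sublinearD(2)[OF m(1), of "- r" x] by simp
    then show ?thesis using neg[of "r *\<^sub>R x"] by simp
  qed
  with add have "linear m" by (intro linearI) auto
  moreover have "m x \<le> p x" for x using m(2)[of x] p0(2)[of x] by simp
  moreover have "m z \<ge> p z" using m(2)[of "- z"] p0(3) neg[of z] by simp
  ultimately show ?thesis by (rule that)
qed

lemma tendsto_scaleR_locally_convex:
  fixes f :: "'b \<Rightarrow> real" and g :: "'b \<Rightarrow> 'a::locally_convex_space"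
  assumes "(f \<longlongrightarrow> r) F" "(g \<longlongrightarrow> a) F"
  shows "((\<lambda>x. f x *\<^sub>R g x) \<longlongrightarrow> r *\<^sub>R a) F"
  using filterlim_compose[OF tendsto_scaleR_nhds filterlim_Pair[OF assms]] by simp

lemma separating_functional:
  fixes x y :: "'a::locally_convex_space"
  assumes "x \<noteq> y"
  obtains f :: "'a \<Rightarrow> real" where "linear f" "continuous_on UNIV f" "f x \<noteq> f y"
proof -
  define z where "z = x - y"
  have "z \<noteq> 0" using assms by (simp add: z_def)
  then obtain U where "open U" "0 \<in> U" "z \<notin> U" by (metis t1_space)
  then obtain V where V: "open V" "0 \<in> V" "convex V" "z \<notin> V"
    using locally_convex_nhds_zero by blast
  define T where "T = (\<lambda>x. {t. t > 0 \<and> inverse t *\<^sub>R x \<in> V})"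
  define p where "p = (\<lambda>x. Inf (T x))"
  have mono: "t \<in> T x" if "s \<in> T x" "s \<le> t" for s t x
  proof -
    have s: "s > 0" "inverse s *\<^sub>R x \<in> V" using that by (auto simp: T_def)
    have "(s / t) *\<^sub>R (inverse s *\<^sub>R x) + (1 - s / t) *\<^sub>R 0 \<in> V"
      using s that by (intro convexD[OF V(3)]) (use V in auto)
    moreover have "(s / t) *\<^sub>R (inverse s *\<^sub>R x) = inverse t *\<^sub>R x"
      using s(1) by (simp add: divide_inverse)
    ultimately have "inverse t *\<^sub>R x \<in> V" by (simp only: scaleR_zero_right add_0_right)
    then show ?thesis using s that by (simp add: T_def)
  qed
  have ne: "T x \<noteq> {}" for x
  proof -
    have "((\<lambda>r::real. r *\<^sub>R x) \<longlongrightarrow> 0 *\<^sub>R x) (at_right 0)"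
      by (intro tendsto_scaleR_locally_convex tendsto_ident_at tendsto_const)
    then have "eventually (\<lambda>r::real. r *\<^sub>R x \<in> V) (at_right 0)"
      using V by (auto dest: topological_tendstoD)
    moreover have "eventually (\<lambda>r::real. r > 0) (at_right 0)" by (rule eventually_at_right_less)
    ultimately have "eventually (\<lambda>r::real. r > 0 \<and> r *\<^sub>R x \<in> V) (at_right 0)"
      by (rule eventually_conj[OF _ _, THEN eventually_mono]) auto
    then obtain r :: real where "r > 0" "r *\<^sub>R x \<in> V"
      using eventually_happens[of _ "at_right (0::real)"] by (auto simp: trivial_limit_at_right_real)
    then have "inverse r \<in> T x" by (simp add: T_def)
    then show ?thesis by blast
  qed
  have bdd: "bdd_below (T x)" for x
    by (rule bdd_belowI[where m = 0]) (auto simp: T_def)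
  have le: "p x \<le> t" if "t \<in> T x" for x t
    unfolding p_def by (rule cInf_lower[OF that bdd])
  have ge: "c \<le> p x" if "\<And>t. t \<in> T x \<Longrightarrow> c \<le> t" for c x
    unfolding p_def by (rule cInf_greatest[OF ne that])
  have T_add: "s + t \<in> T (x + y)" if "s \<in> T x" "t \<in> T y" for s t x y
  proof -
    have st: "s > 0" "t > 0" "inverse s *\<^sub>R x \<in> V" "inverse t *\<^sub>R y \<in> V"
      using that by (auto simp: T_def)
    have "(s / (s + t)) *\<^sub>R (inverse s *\<^sub>R x) + (t / (s + t)) *\<^sub>R (inverse t *\<^sub>R y) \<in> V"
      using st by (intro convexD[OF V(3)]) (auto simp: add_divide_distrib[symmetric])
    moreover have "(s / (s + t)) *\<^sub>R (inverse s *\<^sub>R x) = inverse (s + t) *\<^sub>R x"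
      "(t / (s + t)) *\<^sub>R (inverse t *\<^sub>R y) = inverse (s + t) *\<^sub>R y"
      using st by (simp_all add: divide_inverse)
    ultimately have "inverse (s + t) *\<^sub>R (x + y) \<in> V" by (simp only: scaleR_add_right)
    then show ?thesis using st by (simp add: T_def)
  qed
  have T_hom: "r * t \<in> T (r *\<^sub>R x)" if "r > 0" "t \<in> T x" for r t x
  proof -
    have "inverse (r * t) * r = inverse t" using that by simp
    then show ?thesis using that by (simp add: T_def del: inverse_mult_distrib)
  qed
  have p0: "p 0 = 0"
  proof (rule antisym)
    show "p 0 \<le> 0"
    proof (rule field_le_epsilon)
      fix e :: real assume "e > 0"
      then have "e \<in> T 0" using V by (simp add: T_def)
      from le[OF this] show "p 0 \<le> 0 + e" by simp
    qed
    show "0 \<le> p 0" by (rule ge) (simp add: T_def)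
  qed
  have "sublinear p"
    unfolding sublinear_def
  proof safe
    fix x y
    have "p (x + y) - t \<le> p x" if "t \<in> T y" for t
    proof (rule ge)
      fix s assume "s \<in> T x"
      from le[OF T_add[OF this that]] show "p (x + y) - t \<le> s" by simp
    qed
    then have "p (x + y) - p x \<le> p y" by (intro ge) (simp add: algebra_simps)
    then show "p (x + y) \<le> p x + p y" by simp
  next
    have *: "p (r *\<^sub>R x) \<le> r * p x" if "r > 0" for r x
    proof -
      have "p (r *\<^sub>R x) / r \<le> p x"
        using le[OF T_hom[OF that]] that by (intro ge) (simp add: field_simps)
      then show ?thesis using that by (simp add: field_simps)
    qed
    fix r :: real and x assume "0 \<le> r"
    show "p (r *\<^sub>R x) = r * p x"
    proof (cases "r = 0")
      case False
      with \<open>0 \<le> r\<close> have r: "r > 0" by simp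
      have "p x \<le> inverse r * p (r *\<^sub>R x)" using *[of "inverse r" "r *\<^sub>R x"] r by simp
      then have "r * p x \<le> p (r *\<^sub>R x)" using r by (simp add: field_simps)
      with *[OF r, of x] show ?thesis by simp
    qed (simp add: p0)
  qed
  then obtain f where f: "linear f" "\<And>x. f x \<le> p x" "f z \<ge> p z"
    using hahn_banach_dominated by blast
  have "1 \<le> p z"
  proof (rule ge, rule ccontr)
    fix t assume "t \<in> T z" "\<not> 1 \<le> t"
    then have "1 \<in> T z" by (intro mono[of t z 1]) auto
    then show False using V by (simp add: T_def)
  qed
  with f have "f z \<noteq> 0" by (smt (verit))
  then have "f x \<noteq> f y" using f(1) by (simp add: z_def linear_diff)
  have f1: "f x \<le> 1" if "x \<in> V" for x
    using f(2)[of x] le[of 1 x] that by (simp add: T_def)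
  have "(f \<longlongrightarrow> f a) (nhds a)" for a
  proof (rule tendstoI)
    fix e :: real assume e: "e > 0"
    have ev: "eventually (\<lambda>x. c *\<^sub>R (x - a) \<in> V) (nhds a)" for c :: real
    proof -
      have "((\<lambda>x. c *\<^sub>R (x - a)) \<longlongrightarrow> c *\<^sub>R (a - a)) (nhds a)"
        by (intro tendsto_scaleR_locally_convex tendsto_const tendsto_diff filterlim_ident)
      then show ?thesis using V by (auto dest: topological_tendstoD)
    qed
    show "eventually (\<lambda>x. dist (f x) (f a) < e) (nhds a)"
      using ev[of "2 / e"] ev[of "- (2 / e)"]
    proof eventually_elim
      case (elim x)
      have "(2 / e) * (f x - f a) \<le> 1" "- (2 / e) * (f x - f a) \<le> 1"
        using f1[OF elim(1)] f1[OF elim(2)] f(1) by (simp_all add: linear_cmul linear_diff linear_neg diff_divide_distrib)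
      then have "f x - f a \<le> e / 2" "- (f x - f a) \<le> e / 2" using e by (simp_all add: field_simps)
      then show ?case using e by (simp add: dist_real_def abs_if)
    qed
  qed
  then have "continuous_on UNIV f"
    by (auto simp: continuous_on_def at_within_def intro: tendsto_mono[OF inf_le1])
  with f(1) \<open>f x \<noteq> f y\<close> that show ?thesis by blast
qed

lemma closed_face_has_extreme_point:
  fixes K :: "'a::locally_convex_space set"
  assumes F: "F face_of K" "compact F" "F \<noteq> {}"
  obtains x where "x \<in> F" "x extreme_point_of K"
proof -
  define A where "A = {E. E face_of K \<and> compact E \<and> E \<noteq> {} \<and> E \<subseteq> F}"
  have po: "partial_order_on A (relation_of (\<lambda>S T. T \<subseteq> S) A)"
    by (rule partial_order_on_relation_ofI) auto
  have "\<exists>m\<in>A. \<forall>a\<in>A. a \<subseteq> m \<longrightarrow> a = m"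
  proof (rule predicate_Zorn[OF po])
    fix C assume C: "C \<in> Chains (relation_of (\<lambda>S T. T \<subseteq> S) A)"
    then have CA: "C \<subseteq> A" by (rule Chains_relation_of)
    have tot: "S \<subseteq> T \<or> T \<subseteq> S" if "S \<in> C" "T \<in> C" for S T
      using C that by (auto simp: Chains_def relation_of_def)
    show "\<exists>u\<in>A. \<forall>a\<in>C. u \<subseteq> a"
    proof (cases "C = {}")
      case True
      then show ?thesis using F by (auto simp: A_def)
    next
      case False
      have fin: "\<exists>T\<in>C. T \<subseteq> \<Inter>B" if "finite B" "B \<noteq> {}" "B \<subseteq> C" for B
        using that
      proof (induction B rule: finite_ne_induct)
        case (insert S B)
        then obtain T where "T \<in> C" "T \<subseteq> \<Inter>B" by auto
        then show ?case using tot[of S T] insert.prems by (cases "S \<subseteq> T") auto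
      qed auto
      have "F \<inter> \<Inter>C \<noteq> {}"
      proof (rule compact_imp_fip[OF F(2)])
        show "closed T" if "T \<in> C" for T
          using that CA by (auto simp: A_def compact_imp_closed)
        show "F \<inter> \<Inter>B \<noteq> {}" if B: "finite B" "B \<subseteq> C" for B
        proof (cases "B = {}")
          case False
          obtain T where T: "T \<in> C" "T \<subseteq> \<Inter>B"
            using fin[OF B(1) False B(2)] by blast
          then have "T \<noteq> {}" "T \<subseteq> F" using CA by (auto simp: A_def)
          with T(2) show ?thesis by blast
        qed (use F in auto)
      qed
      moreover have "\<Inter>C face_of K"
        using False CA by (intro face_of_Inter) (auto simp: A_def)
      moreover have "\<Inter>C \<subseteq> F" using False CA by (auto simp: A_def)
      moreover have "compact (\<Inter>C)"
      proof -
        have "closed (\<Inter>C)"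
          by (rule closed_Inter) (use CA in \<open>auto simp: A_def compact_imp_closed\<close>)
        from compact_Int_closed[OF F(2) this] have "compact (F \<inter> \<Inter>C)" .
        also have "F \<inter> \<Inter>C = \<Inter>C" using \<open>\<Inter>C \<subseteq> F\<close> by (rule Int_absorb1)
        finally show ?thesis .
      qed
      ultimately have "\<Inter>C \<in> A" by (auto simp: A_def)
      then show ?thesis by auto
    qed
  qed
  then obtain E where E: "E \<in> A" and min: "\<And>D. D \<in> A \<Longrightarrow> D \<subseteq> E \<Longrightarrow> D = E" by blast
  from E have EK: "E face_of K" "compact E" "E \<noteq> {}" "E \<subseteq> F" by (auto simp: A_def)
  have "x = y" if xy: "x \<in> E" "y \<in> E" for x y
  proof (rule ccontr)
    assume "x \<noteq> y"
    then obtain f :: "'a \<Rightarrow> real" where f: "linear f" "continuous_on UNIV f" "f x \<noteq> f y"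
      by (rule separating_functional)
    have cf: "continuous_on E f" using f(2) continuous_on_subset by blast
    obtain s where s: "s \<in> E" "\<And>t. t \<in> E \<Longrightarrow> f t \<le> f s"
      using continuous_attains_sup[OF EK(2,3) cf] by blast
    define D where "D = E \<inter> f -` {f s}"
    have "compact D"
      unfolding D_def using f(2) EK(2) by (intro compact_Int_closed closed_vimage) auto
    moreover have "D face_of E"
      unfolding face_of_def
    proof (intro conjI ballI impI)
      show "D \<subseteq> E" by (auto simp: D_def)
      have "convex (f -` {f s})" by (rule convex_linear_vimage[OF f(1)]) simp
      then show "convex D"
        unfolding D_def using EK(1) by (intro convex_Int) (auto dest: face_of_imp_convex)
      fix a b z assume ab: "a \<in> E" "b \<in> E" and z: "z \<in> D" "z \<in> open_segment a b"
      then obtain u where u: "0 < u" "u < 1" "z = (1 - u) *\<^sub>R a + u *\<^sub>R b"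
        by (auto simp: in_segment)
      have "f s = (1 - u) * f a + u * f b"
        using z(1) u(3) f(1) by (simp add: D_def linear_add linear_cmul)
      then have "(1 - u) * (f s - f a) + u * (f s - f b) = 0" by (simp add: algebra_simps)
      moreover have "(1 - u) * (f s - f a) \<ge> 0" "u * (f s - f b) \<ge> 0"
        using s(2) ab u by auto
      ultimately have "(1 - u) * (f s - f a) = 0" "u * (f s - f b) = 0" by linarith+
      then show "a \<in> D" "b \<in> D" using u ab by (auto simp: D_def)
    qed
    ultimately have "D \<in> A"
      using face_of_trans[OF _ EK(1)] s(1) EK(4) by (auto simp: A_def D_def)
    then have "D = E" by (rule min) (auto simp: D_def)
    with xy have "x \<in> D" "y \<in> D" by simp_all
    with f(3) show False by (simp add: D_def)
  qed
  then obtain x where "E = {x}" using EK(3) by blast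
  with EK that[of x] show ?thesis by (auto simp: face_of_singleton)
qed

lemma convex_closure_locally_convex:
  fixes S :: "'a::locally_convex_space set"
  assumes "convex S"
  shows "convex (closure S)"
  unfolding convex_def
proof (intro ballI allI impI)
  fix x y and u v :: real
  assume xy: "x \<in> closure S" "y \<in> closure S" and uv: "0 \<le> u" "0 \<le> v" "u + v = 1"
  let ?f = "\<lambda>p::'a \<times> 'a. u *\<^sub>R fst p + v *\<^sub>R snd p"
  have "continuous_on (closure (S \<times> S)) ?f"
    unfolding continuous_on_def
    by (intro ballI tendsto_add tendsto_scaleR_locally_convex tendsto_const tendsto_fst tendsto_snd
        tendsto_ident_at)
  moreover have "?f ` (S \<times> S) \<subseteq> closure S"
    using uv by (auto intro!: subsetD[OF closure_subset] convexD[OF assms])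
  ultimately have "?f ` closure (S \<times> S) \<subseteq> closure S"
    by (intro image_closure_subset) auto
  moreover have "(x, y) \<in> closure (S \<times> S)"
    using xy by (simp add: closure_Times)
  ultimately have "?f (x, y) \<in> closure S" by blast
  then show "u *\<^sub>R x + v *\<^sub>R y \<in> closure S" by simp
qed

section \<open>Representation of proximally irreducible extensions\<close>

lemma affine_map_onD:
  assumes "affine_map_on K f" "x \<in> K" "y \<in> K" "u \<ge> 0" "v \<ge> 0" "u + v = 1"
  shows "f (u *\<^sub>R x + v *\<^sub>R y) = u *\<^sub>R f x + v *\<^sub>R f y"
proof -
  have "u = 1 - v" "v \<in> {0..1}" using assms by auto
  with assms(1-3) show ?thesis by (auto simp: affine_map_on_def)
qed

lemma affine_map_onI:
  assumes "\<And>x y u v. x \<in> K \<Longrightarrow> y \<in> K \<Longrightarrow> u \<ge> 0 \<Longrightarrow> v \<ge> 0 \<Longrightarrow> u + v = 1 \<Longrightarrow>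
    f (u *\<^sub>R x + v *\<^sub>R y) = u *\<^sub>R f x + v *\<^sub>R f y"
  shows "affine_map_on K f"
  using assms by (simp add: affine_map_on_def)

lemma affine_map_on_convex_hull:
  assumes "affine_map_on K f" "convex K" "S \<subseteq> K" "x \<in> convex hull S"
  shows "f x \<in> convex hull (f ` S)"
proof -
  have "convex {x \<in> K. f x \<in> convex hull (f ` S)}"
    using assms(2) convex_convex_hull[of "f ` S"]
    by (auto simp: convex_def affine_map_onD[OF assms(1)])
  moreover have "S \<subseteq> {x \<in> K. f x \<in> convex hull (f ` S)}"
    using assms(3) by (auto intro: hull_inc)
  ultimately have "convex hull S \<subseteq> {x \<in> K. f x \<in> convex hull (f ` S)}"
    by (rule hull_minimal[rotated])
  with assms(4) show ?thesis by blast
qed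

lemma affine_map_on_convex_image:
  assumes "affine_map_on K f" "convex C" "C \<subseteq> K"
  shows "convex (f ` C)"
  unfolding convex_def
proof (intro ballI allI impI)
  fix a b and u v :: real
  assume ab: "a \<in> f ` C" "b \<in> f ` C" and uv: "0 \<le> u" "0 \<le> v" "u + v = 1"
  then obtain x y where xy: "x \<in> C" "y \<in> C" "a = f x" "b = f y" by blast
  then have "u *\<^sub>R a + v *\<^sub>R b = f (u *\<^sub>R x + v *\<^sub>R y)"
    using affine_map_onD[OF assms(1), of x y u v] uv subsetD[OF assms(3)] by auto
  moreover have "u *\<^sub>R x + v *\<^sub>R y \<in> C" using xy uv assms(2) by (auto intro: convexD)
  ultimately show "u *\<^sub>R a + v *\<^sub>R b \<in> f ` C" by blast
qed

lemma affine_map_on_inverse: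
  assumes "affine_map_on K f" "convex K" "f ` K = K'" "\<And>x. x \<in> K \<Longrightarrow> g (f x) = x"
  shows "affine_map_on K' g"
proof (rule affine_map_onI)
  fix a b and u v :: real
  assume ab: "a \<in> K'" "b \<in> K'" and uv: "0 \<le> u" "0 \<le> v" "u + v = 1"
  then obtain x y where xy: "x \<in> K" "y \<in> K" "a = f x" "b = f y" using assms(3) by blast
  then have "u *\<^sub>R a + v *\<^sub>R b = f (u *\<^sub>R x + v *\<^sub>R y)"
    using affine_map_onD[OF assms(1) _ _ uv] by auto
  moreover have "u *\<^sub>R x + v *\<^sub>R y \<in> K" using xy uv assms(2) by (auto intro: convexD)
  ultimately show "g (u *\<^sub>R a + v *\<^sub>R b) = u *\<^sub>R g a + v *\<^sub>R g b"
    using xy assms(4) by simp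
qed

lemma affine_map_on_compose:
  assumes "affine_map_on K f" "affine_map_on K' g" "f ` K \<subseteq> K'"
  shows "affine_map_on K (\<lambda>x. g (f x))"
proof (rule affine_map_onI)
  fix x y and u v :: real
  assume xy: "x \<in> K" "y \<in> K" and uv: "0 \<le> u" "0 \<le> v" "u + v = 1"
  have "f x \<in> K'" "f y \<in> K'" using xy assms(3) by auto
  then show "g (f (u *\<^sub>R x + v *\<^sub>R y)) = u *\<^sub>R g (f x) + v *\<^sub>R g (f y)"
    by (simp add: affine_map_onD[OF assms(1) xy uv] affine_map_onD[OF assms(2) _ _ uv])
qed

lemma continuous_action_top_of_set:
  fixes \<alpha> :: "'g::{group_add, topological_space} \<Rightarrow> 'a::topological_space \<Rightarrow> 'a"
  shows "continuous_action \<alpha> (top_of_set K) \<longleftrightarrow>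
    (\<forall>x\<in>K. \<alpha> 0 x = x) \<and> (\<forall>g h. \<forall>x\<in>K. \<alpha> (g + h) x = \<alpha> g (\<alpha> h x)) \<and>
    (\<forall>g. \<forall>x\<in>K. \<alpha> g x \<in> K) \<and> continuous_on (UNIV \<times> K) (\<lambda>(g, x). \<alpha> g x)"
proof -
  have "prod_topology (euclidean :: 'g topology) (top_of_set K) = top_of_set (UNIV \<times> K)"
    using prod_topology_subtopology_eu[of "UNIV :: 'g set" K] by simp
  then show ?thesis
    by (auto simp: continuous_action_def continuous_map_subtopology_eu Pi_iff)
qed

lemma affine_flowD:
  assumes "affine_flow \<alpha> K"
  shows "K \<noteq> {}" "compact K" "convex K" "affine_map_on K (\<alpha> g)"
    "x \<in> K \<Longrightarrow> \<alpha> g x \<in> K" "x \<in> K \<Longrightarrow> \<alpha> 0 x = x"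
    "x \<in> K \<Longrightarrow> \<alpha> (g + h) x = \<alpha> g (\<alpha> h x)"
    "continuous_on (UNIV \<times> K) (\<lambda>(g, x). \<alpha> g x)"
  using assms unfolding affine_flow_def continuous_action_top_of_set by blast+

lemma affine_flow_continuous:
  assumes "affine_flow \<alpha> K"
  shows "continuous_on K (\<alpha> g)"
proof -
  have "continuous_on K (\<lambda>x. (\<lambda>(g, x). \<alpha> g x) (g, x))"
    by (rule continuous_on_compose2[OF affine_flowD(8)[OF assms]])
       (auto intro!: continuous_intros)
  then show ?thesis by simp
qed

lemma affine_isomorphism_inverse:
  assumes iso: "affine_isomorphism \<beta> L \<alpha> K \<phi>" and h: "homeomorphism L K \<phi> \<psi>"
  shows "affine_isomorphism \<alpha> K \<beta> L \<psi>"
proof -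
  have ext: "affine_extension \<beta> L \<alpha> K \<phi>" using iso by (simp add: affine_isomorphism_def)
  then have L: "affine_flow \<beta> L" and K: "affine_flow \<alpha> K"
    and aff: "affine_map_on L \<phi>" and im: "\<phi> ` L = K"
    and eq: "\<And>g x. x \<in> L \<Longrightarrow> \<phi> (\<beta> g x) = \<alpha> g (\<phi> x)"
    by (auto simp: affine_extension_def)
  have inv: "\<And>x. x \<in> L \<Longrightarrow> \<psi> (\<phi> x) = x" and "continuous_on K \<psi>" and im': "\<psi> ` K = L"
    and inv': "\<And>y. y \<in> K \<Longrightarrow> \<phi> (\<psi> y) = y"
    using h by (auto simp: homeomorphism_def)
  moreover have "affine_map_on K \<psi>"
    by (rule affine_map_on_inverse[OF aff affine_flowD(3)[OF L] im inv])
  moreover have "\<psi> (\<alpha> g y) = \<beta> g (\<psi> y)" if "y \<in> K" for g y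
  proof -
    have "\<psi> y \<in> L" using that im' by blast
    then show ?thesis using eq[of "\<psi> y" g] inv[of "\<beta> g (\<psi> y)"] inv'[OF that] affine_flowD(5)[OF L]
      by simp
  qed
  ultimately have "affine_extension \<alpha> K \<beta> L \<psi>"
    using L K by (auto simp: affine_extension_def)
  with h show ?thesis by (auto simp: affine_isomorphism_def intro: homeomorphism_symD)
qed

lemma affine_extension_compose:
  assumes "affine_extension \<gamma> M \<beta> L \<psi>" "affine_extension \<beta> L \<alpha> K \<phi>"
  shows "affine_extension \<gamma> M \<alpha> K (\<lambda>x. \<phi> (\<psi> x))"
  using assms unfolding affine_extension_def
  by (auto intro!: affine_map_on_compose[of M \<psi> L \<phi>] continuous_on_compose2[of L \<phi> M \<psi>])

lemma ext_closure_subset: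
  assumes "compact K"
  shows "ext_closure K \<subseteq> K"
  unfolding ext_closure_def
  using assms by (intro closure_minimal compact_imp_closed) (auto simp: extreme_point_of_def)

lemma affine_isomorphism_ext_closure:
  assumes iso: "affine_isomorphism \<beta> L \<alpha> K \<phi>"
  shows "\<phi> ` ext_closure L \<subseteq> ext_closure K"
proof -
  obtain \<psi> where "homeomorphism L K \<phi> \<psi>" using iso by (auto simp: affine_isomorphism_def)
  then have inj: "\<psi> (\<phi> x) = x" if "x \<in> L" for x using that by (auto simp: homeomorphism_def)
  have L: "affine_flow \<beta> L"
    and aff: "affine_map_on L \<phi>" and im: "\<phi> ` L = K" and cont: "continuous_on L \<phi>"
    using iso by (auto simp: affine_isomorphism_def affine_extension_def)
  have "\<phi> x extreme_point_of K" if x: "x extreme_point_of L" for x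
    unfolding extreme_point_of_def
  proof (intro conjI ballI notI)
    have xL: "x \<in> L" using x by (simp add: extreme_point_of_def)
    then show "\<phi> x \<in> K" using im by blast
    fix a' b' assume "a' \<in> K" "b' \<in> K" and seg: "\<phi> x \<in> open_segment a' b'"
    then obtain a b where ab: "a \<in> L" "b \<in> L" "a' = \<phi> a" "b' = \<phi> b" using im by blast
    obtain u where u: "a' \<noteq> b'" "0 < u" "u < 1" "\<phi> x = (1 - u) *\<^sub>R a' + u *\<^sub>R b'"
      using seg by (auto simp: in_segment)
    have "\<phi> ((1 - u) *\<^sub>R a + u *\<^sub>R b) = \<phi> x"
      using affine_map_onD[OF aff ab(1,2), of "1 - u" u] u ab by simp
    moreover have "(1 - u) *\<^sub>R a + u *\<^sub>R b \<in> L"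
      using u ab by (intro convexD[OF affine_flowD(3)[OF L]]) auto
    ultimately have "x = (1 - u) *\<^sub>R a + u *\<^sub>R b"
      using inj[OF xL] inj by metis
    then have "x \<in> open_segment a b" using u ab by (auto simp: in_segment)
    with x ab show False by (auto simp: extreme_point_of_def)
  qed
  then have sub: "\<phi> ` {x. x extreme_point_of L} \<subseteq> ext_closure K"
    unfolding ext_closure_def using closure_subset by fastforce
  have "continuous_on (ext_closure L) \<phi>"
    using cont ext_closure_subset[OF affine_flowD(2)[OF L]] by (rule continuous_on_subset)
  then show ?thesis
    using sub unfolding ext_closure_def[of L]
    by (intro image_closure_subset) (auto simp: ext_closure_def)
qed

lemma prox_irreducible_extension_transfer:
  assumes pe: "prox_irreducible_extension \<beta> L \<alpha> K \<phi>"
    and iso: "affine_isomorphism \<beta> L \<beta>' L' \<theta>" and h: "homeomorphism L L' \<theta> \<psi>"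
  shows "prox_irreducible_extension \<beta>' L' \<alpha> K (\<lambda>x. \<phi> (\<psi> x))"
proof -
  have iso': "affine_isomorphism \<beta>' L' \<beta> L \<psi>" by (rule affine_isomorphism_inverse[OF iso h])
  have ext: "affine_extension \<beta> L \<alpha> K \<phi>"
    and irr: "\<And>C. affine_subflow \<beta> L C \<Longrightarrow>
       (\<And>y. y \<in> ext_closure K \<Longrightarrow> C \<inter> convex hull (ext_closure L \<inter> \<phi> -` {y}) \<noteq> {}) \<Longrightarrow> C = L"
    using pe unfolding prox_irreducible_extension_def by blast+
  have L': "affine_flow \<beta>' L'" and aff: "affine_map_on L' \<psi>" and im: "\<psi> ` L' = L"
    and eq: "\<And>g x. x \<in> L' \<Longrightarrow> \<psi> (\<beta>' g x) = \<beta> g (\<psi> x)" and cont: "continuous_on L' \<psi>"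
    and ext': "affine_extension \<beta>' L' \<beta> L \<psi>"
    using iso' by (auto simp: affine_isomorphism_def affine_extension_def)
  have inv: "\<theta> (\<psi> x) = x" if "x \<in> L'" for x using h that by (auto simp: homeomorphism_def)
  have sub': "ext_closure L' \<subseteq> L'" by (rule ext_closure_subset[OF affine_flowD(2)[OF L']])
  have "C = L'" if C: "affine_subflow \<beta>' L' C"
    and meet: "\<forall>y\<in>ext_closure K. C \<inter> convex hull (ext_closure L' \<inter> (\<lambda>x. \<phi> (\<psi> x)) -` {y}) \<noteq> {}" for C
  proof -
    have C': "C \<subseteq> L'" "C \<noteq> {}" "closed C" "convex C" "\<And>g x. x \<in> C \<Longrightarrow> \<beta>' g x \<in> C"
      using C by (auto simp: affine_subflow_def)
    have "\<psi> ` C = L"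
    proof (rule irr)
      have "compact C"
        using compact_Int_closed[OF affine_flowD(2)[OF L'] C'(3)] C'(1) by (simp add: Int_absorb1)
      then have "closed (\<psi> ` C)"
        using continuous_on_subset[OF cont C'(1)]
        by (intro compact_imp_closed compact_continuous_image)
      moreover have "convex (\<psi> ` C)"
        by (rule affine_map_on_convex_image[OF aff C'(4,1)])
      moreover have "\<beta> g ` \<psi> ` C \<subseteq> \<psi> ` C" for g
      proof -
        have "\<beta> g (\<psi> x) \<in> \<psi> ` C" if "x \<in> C" for x
          using eq[of x g] C'(1) C'(5)[OF that, of g] that by (metis imageI subsetD)
        then show ?thesis by blast
      qed
      ultimately show "affine_subflow \<beta> L (\<psi> ` C)"
        using C' im by (auto simp: affine_subflow_def)
    next
      fix y assume "y \<in> ext_closure K"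
      with meet obtain z where z: "z \<in> C"
        "z \<in> convex hull (ext_closure L' \<inter> (\<lambda>x. \<phi> (\<psi> x)) -` {y})" by blast
      have "\<psi> z \<in> convex hull (\<psi> ` (ext_closure L' \<inter> (\<lambda>x. \<phi> (\<psi> x)) -` {y}))"
        by (rule affine_map_on_convex_hull[OF aff affine_flowD(3)[OF L'] _ z(2)]) (use sub' in auto)
      moreover have "\<psi> ` (ext_closure L' \<inter> (\<lambda>x. \<phi> (\<psi> x)) -` {y}) \<subseteq> ext_closure L \<inter> \<phi> -` {y}"
        using affine_isomorphism_ext_closure[OF iso'] by auto
      ultimately have "\<psi> z \<in> convex hull (ext_closure L \<inter> \<phi> -` {y})"
        using hull_mono by blast
      with z(1) show "\<psi> ` C \<inter> convex hull (ext_closure L \<inter> \<phi> -` {y}) \<noteq> {}" by blast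
    qed
    show "C = L'"
    proof
      show "L' \<subseteq> C"
      proof
        fix x assume x: "x \<in> L'"
        then obtain c where c: "c \<in> C" "\<psi> x = \<psi> c" using im \<open>\<psi> ` C = L\<close> by (metis imageE imageI)
        then show "x \<in> C" using inv[OF x] inv[of c] C'(1) by (metis subsetD)
      qed
    qed (rule C'(1))
  qed
  then show ?thesis
    using affine_extension_compose[OF ext' ext]
    unfolding prox_irreducible_extension_def by blast
qed

lemma affine_extension_lift_ext_closure:
  assumes ext: "affine_extension \<beta> L \<alpha> K \<phi>" and y: "y \<in> ext_closure K"
  shows "\<exists>x\<in>ext_closure L. \<phi> x = y"
proof -
  have L: "affine_flow \<beta> L" and aff: "affine_map_on L \<phi>" and im: "\<phi> ` L = K"
    and cont: "continuous_on L \<phi>"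
    using ext by (auto simp: affine_extension_def)
  note cmp = affine_flowD(2)[OF L] and cvx = affine_flowD(3)[OF L]
  have "{y. y extreme_point_of K} \<subseteq> \<phi> ` ext_closure L"
  proof safe
    fix y assume y: "y extreme_point_of K"
    define F where "F = L \<inter> \<phi> -` {y}"
    have "F \<noteq> {}" using y im by (auto simp: F_def extreme_point_of_def)
    moreover have "closed F"
      unfolding F_def using cont compact_imp_closed[OF cmp]
      by (intro continuous_closed_preimage) auto
    then have "compact F"
      using compact_Int_closed[OF cmp \<open>closed F\<close>] by (simp add: F_def)
    moreover have "F face_of L"
      unfolding face_of_def
    proof (intro conjI ballI impI)
      show "convex F"
        using cvx by (auto simp: F_def convex_def affine_map_onD[OF aff] scaleR_left_distrib[symmetric])
      show "F \<subseteq> L" by (simp add: F_def)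
      fix a b x assume ab: "a \<in> L" "b \<in> L" and x: "x \<in> F" "x \<in> open_segment a b"
      then obtain u where u: "0 < u" "u < 1" "x = (1 - u) *\<^sub>R a + u *\<^sub>R b"
        by (auto simp: in_segment)
      then have *: "y = (1 - u) *\<^sub>R \<phi> a + u *\<^sub>R \<phi> b"
        using x(1) affine_map_onD[OF aff ab, of "1 - u" u] by (simp add: F_def)
      have "\<phi> a \<in> K" "\<phi> b \<in> K" using ab im by auto
      with y have "y \<notin> open_segment (\<phi> a) (\<phi> b)" by (auto simp: extreme_point_of_def)
      with * u have "\<phi> a = \<phi> b" by (auto simp: in_segment)
      with * have "\<phi> a = y" "\<phi> b = y" by (simp_all add: scaleR_left_distrib[symmetric])
      with ab show "a \<in> F" "b \<in> F" by (auto simp: F_def)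
    qed
    ultimately obtain x where "x \<in> F" "x extreme_point_of L"
      by (metis closed_face_has_extreme_point)
    then show "y \<in> \<phi> ` ext_closure L"
      unfolding ext_closure_def F_def using closure_subset by fastforce
  qed
  moreover have "closed (\<phi> ` ext_closure L)"
  proof -
    have "compact (ext_closure L)"
      using compact_Int_closed[OF cmp, of "ext_closure L"] ext_closure_subset[OF cmp]
      by (simp add: Int_absorb1 ext_closure_def)
    then show ?thesis
      using continuous_on_subset[OF cont ext_closure_subset[OF cmp]]
      by (intro compact_imp_closed compact_continuous_image)
  qed
  ultimately have "ext_closure K \<subseteq> \<phi> ` ext_closure L"
    unfolding ext_closure_def[of K] by (rule closure_minimal)
  with y show ?thesis by blast
qed

theorem prox_irreducible_extension_representation:
  fixes \<beta> :: "'g::{group_add, topological_space} \<Rightarrow> 'b::locally_convex_space \<Rightarrow> 'b" and L :: "'b set"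
    and \<alpha> :: "'g \<Rightarrow> 'a::locally_convex_space \<Rightarrow> 'a" and K :: "'a set"
  assumes pe: "prox_irreducible_extension \<beta> L \<alpha> K \<phi>"
  obtains \<beta>' and L' :: "('g, 'a) extension_space set" and \<theta>
    where "affine_isomorphism \<beta> L \<beta>' L' \<theta>"
proof -
  have ext: "affine_extension \<beta> L \<alpha> K \<phi>"
    and irr: "\<And>C. affine_subflow \<beta> L C \<Longrightarrow>
       (\<And>y. y \<in> ext_closure K \<Longrightarrow> C \<inter> convex hull (ext_closure L \<inter> \<phi> -` {y}) \<noteq> {}) \<Longrightarrow> C = L"
    using pe unfolding prox_irreducible_extension_def by blast+
  have L: "affine_flow \<beta> L" using ext by (simp add: affine_extension_def)
  note ne = affine_flowD(1)[OF L] and cmp = affine_flowD(2)[OF L] and cvx = affine_flowD(3)[OF L]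
  have clL: "closed L" using cmp by (rule compact_imp_closed)
  have "\<exists>x. x \<in> L \<and> (y \<in> ext_closure K \<longrightarrow> x \<in> ext_closure L \<inter> \<phi> -` {y})" for y
    using affine_extension_lift_ext_closure[OF ext, of y] ne ext_closure_subset[OF cmp] by fastforce
  then obtain p where p: "\<And>y. p y \<in> L"
    "\<And>y. y \<in> ext_closure K \<Longrightarrow> p y \<in> ext_closure L \<inter> \<phi> -` {y}" by metis
  define D where "D = {\<beta> g (p y) | g y. True}"
  have DL: "D \<subseteq> L" using p(1) affine_flowD(5)[OF L] by (auto simp: D_def)
  have pD: "p y \<in> D" for y
  proof -
    have "p y = \<beta> 0 (p y)" using affine_flowD(6)[OF L p(1)] by simp
    then show ?thesis unfolding D_def by blast
  qed
  define C where "C = closure (convex hull D)"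
  have hull: "convex hull D \<subseteq> L" using DL cvx by (rule hull_minimal)
  have CL: "C \<subseteq> L" unfolding C_def by (rule closure_minimal[OF hull clL])
  have DC: "D \<subseteq> C" unfolding C_def using hull_subset closure_subset by (rule subset_trans)
  have "C = L"
  proof (rule irr)
    have "\<beta> g ` C \<subseteq> C" for g
    proof -
      have DD: "\<beta> g ` D \<subseteq> D"
      proof safe
        fix z assume "z \<in> D"
        then obtain h y where "z = \<beta> h (p y)" by (auto simp: D_def)
        then have "\<beta> g z = \<beta> (g + h) (p y)" using affine_flowD(7)[OF L p(1)] by simp
        then show "\<beta> g z \<in> D" unfolding D_def by blast
      qed
      have "\<beta> g ` (convex hull D) \<subseteq> convex hull D"
        using affine_map_on_convex_hull[OF affine_flowD(4)[OF L] cvx DL, of _ g] hull_mono[OF DD]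
        by blast
      then have "\<beta> g ` (convex hull D) \<subseteq> C" unfolding C_def using closure_subset by blast
      moreover have "continuous_on C (\<beta> g)"
        using affine_flow_continuous[OF L] CL by (rule continuous_on_subset)
      ultimately show ?thesis unfolding C_def by (intro image_closure_subset) auto
    qed
    then show "affine_subflow \<beta> L C"
      using CL DC pD by (auto simp: affine_subflow_def C_def
          intro!: convex_closure_locally_convex)
    show "C \<inter> convex hull (ext_closure L \<inter> \<phi> -` {y}) \<noteq> {}" if "y \<in> ext_closure K" for y
    proof -
      have "p y \<in> C" using pD DC by blast
      moreover have "p y \<in> convex hull (ext_closure L \<inter> \<phi> -` {y})"
        using p(2)[OF that] by (rule hull_inc)
      ultimately show ?thesis by blast
    qed
  qed
  define R where "R = (\<lambda>(f :: 'b \<Rightarrow> real) (g, y). f (\<beta> g (p y)))"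
  define admissible where
    "admissible = (\<lambda>f :: 'b \<Rightarrow> real. linear f \<and> continuous_on UNIV f)"
  have "\<exists>f. admissible f \<and> ((\<exists>f'. admissible f' \<and> R f' = h) \<longrightarrow> R f = h)" for h
  proof (cases "\<exists>f'. admissible f' \<and> R f' = h")
    case False
    moreover have "admissible (\<lambda>_. 0)" by (simp add: admissible_def linear_iff)
    ultimately show ?thesis by blast
  qed blast
  then have "\<exists>F. \<forall>h. admissible (F h) \<and> ((\<exists>f'. admissible f' \<and> R f' = h) \<longrightarrow> R (F h) = h)"
    by (intro choice) blast
  then obtain F where F0:
    "\<forall>h. admissible (F h) \<and> ((\<exists>f'. admissible f' \<and> R f' = h) \<longrightarrow> R (F h) = h)" ..
  have F: "admissible (F h)" "admissible f \<Longrightarrow> R (F (R f)) = R f" for h f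
    using F0 by blast+
  define \<theta> :: "'b \<Rightarrow> ('g, 'a) extension_space" where "\<theta> = (\<lambda>x. of_coords (\<lambda>h. F h x))"
  have lin: "linear \<theta>"
    using F(1) by (intro linearI)
      (auto simp: \<theta>_def real_product_eq_iff admissible_def linear_add linear_cmul)
  have cont: "continuous_on L \<theta>"
    unfolding continuous_on_real_product_iff
    using F(1) by (auto simp: \<theta>_def admissible_def intro: continuous_on_subset)
  have inj: "inj_on \<theta> L"
  proof (rule inj_onI, rule ccontr)
    fix x y assume xy: "x \<in> L" "y \<in> L" "\<theta> x = \<theta> y" "x \<noteq> y"
    obtain f where f: "admissible f" "f x \<noteq> f y"
      using xy(4) by (rule separating_functional) (simp add: admissible_def)
    define f' where "f' = F (R f)"
    have f': "admissible f'" "R f' = R f" using F f by (auto simp: f'_def)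
    have "closed {z. f' z = f z}"
      using f f' by (intro closed_Collect_eq) (auto simp: admissible_def)
    moreover have "convex {z. f' z = f z}"
      using f f' by (auto simp: convex_def admissible_def linear_add linear_cmul)
    moreover have "D \<subseteq> {z. f' z = f z}"
      using f'(2) by (auto simp: D_def R_def fun_eq_iff)
    ultimately have "C \<subseteq> {z. f' z = f z}"
      unfolding C_def by (intro closure_minimal hull_minimal)
    with xy \<open>C = L\<close> have "f' x = f x" "f' y = f y" by auto
    moreover have "f' x = f' y"
      using xy(3) by (simp add: \<theta>_def real_product_eq_iff f'_def)
    ultimately show False using f(2) by simp
  qed
  define L' where "L' = \<theta> ` L"
  obtain \<psi> where h: "homeomorphism L L' \<theta> \<psi>"
    using homeomorphism_compact[OF cmp cont _ inj] L'_def by metis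
  then have inv: "\<And>x. x \<in> L \<Longrightarrow> \<psi> (\<theta> x) = x" and contp: "continuous_on L' \<psi>"
    and im': "\<psi> ` L' = L" and inv': "\<And>y. y \<in> L' \<Longrightarrow> \<theta> (\<psi> y) = y"
    by (auto simp: homeomorphism_def)
  have aff: "affine_map_on L \<theta>"
    using lin by (auto simp: affine_map_on_def linear_add linear_cmul)
  have aff': "affine_map_on L' \<psi>"
    by (rule affine_map_on_inverse[OF aff cvx _ inv]) (simp add: L'_def)
  define \<beta>' where "\<beta>' = (\<lambda>g z. \<theta> (\<beta> g (\<psi> z)))"
  have psiL: "\<psi> z \<in> L" if "z \<in> L'" for z using that im' by blast
  have "affine_flow \<beta>' L'"
    unfolding affine_flow_def continuous_action_top_of_set
  proof (intro conjI allI ballI)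
    show "L' \<noteq> {}" "compact L'" "convex L'"
      unfolding L'_def using ne compact_continuous_image[OF cont cmp] convex_linear_image[OF lin cvx]
      by auto
    show "\<beta>' 0 z = z" if "z \<in> L'" for z
      using affine_flowD(6)[OF L psiL[OF that]] inv'[OF that] by (simp add: \<beta>'_def)
    show "\<beta>' (g + h) z = \<beta>' g (\<beta>' h z)" if "z \<in> L'" for g h z
      using affine_flowD(7)[OF L psiL[OF that]] inv[OF affine_flowD(5)[OF L psiL[OF that]]]
      by (simp add: \<beta>'_def)
    show "\<beta>' g z \<in> L'" if "z \<in> L'" for g z
      using affine_flowD(5)[OF L psiL[OF that]] by (simp add: \<beta>'_def L'_def)
    have "continuous_on (UNIV \<times> L') (\<lambda>q :: 'g \<times> _. \<psi> (snd q))"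
      by (rule continuous_on_compose2[OF contp]) (auto intro: continuous_on_snd continuous_on_id)
    then have *: "continuous_on (UNIV \<times> L') (\<lambda>q :: 'g \<times> _. (fst q, \<psi> (snd q)))"
      by (intro continuous_on_Pair continuous_on_fst continuous_on_id)
    have "continuous_on (UNIV \<times> L') (\<lambda>q. (\<lambda>(g, x). \<beta> g x) (fst q, \<psi> (snd q)))"
      by (rule continuous_on_compose2[OF affine_flowD(8)[OF L] *]) (use psiL in auto)
    then have "continuous_on (UNIV \<times> L') (\<lambda>q. \<beta> (fst q) (\<psi> (snd q)))" by simp
    then have "continuous_on (UNIV \<times> L') (\<lambda>q. \<theta> (\<beta> (fst q) (\<psi> (snd q))))"
      by (rule continuous_on_compose2[OF cont]) (use affine_flowD(5)[OF L] psiL in auto)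
    then show "continuous_on (UNIV \<times> L') (\<lambda>(g, z). \<beta>' g z)"
      by (simp add: \<beta>'_def case_prod_beta)
    show "affine_map_on L' (\<beta>' g)" for g
      unfolding \<beta>'_def
      by (rule affine_map_on_compose[OF affine_map_on_compose[OF aff' affine_flowD(4)[OF L]] aff])
         (use psiL affine_flowD(5)[OF L] in auto)
  qed
  then have "affine_extension \<beta> L \<beta>' L' \<theta>"
    using L cont aff inv by (auto simp: affine_extension_def \<beta>'_def L'_def)
  with h have "affine_isomorphism \<beta> L \<beta>' L' \<theta>" by (auto simp: affine_isomorphism_def)
  then show ?thesis by (rule that)
qed

theorem prox_irreducible_imp_isomorphism:
  fixes \<beta> :: "'g::{group_add, topological_space} \<Rightarrow> 'b::locally_convex_space \<Rightarrow> 'b" and L :: "'b set"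
    and \<alpha> :: "'g \<Rightarrow> 'a::locally_convex_space \<Rightarrow> 'a" and K :: "'a set"
  assumes K: "prox_irreducible \<alpha> K" and pe: "prox_irreducible_extension \<beta> L \<alpha> K \<phi>"
  shows "affine_isomorphism \<beta> L \<alpha> K \<phi>"
proof -
  obtain \<beta>' L' \<theta> where iso: "affine_isomorphism \<beta> L \<beta>' (L' :: ('g, 'a) extension_space set) \<theta>"
    using prox_irreducible_extension_representation[OF pe] by blast
  then obtain \<psi> where h: "homeomorphism L L' \<theta> \<psi>" by (auto simp: affine_isomorphism_def)
  have "affine_isomorphism \<beta>' L' \<alpha> K (\<lambda>x. \<phi> (\<psi> x))"
    using K prox_irreducible_extension_transfer[OF pe iso h] by (auto simp: prox_irreducible_def)
  then obtain \<xi> where "homeomorphism L' K (\<lambda>x. \<phi> (\<psi> x)) \<xi>"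
    by (auto simp: affine_isomorphism_def)
  then have *: "\<xi> (\<phi> (\<psi> z)) = z" if "z \<in> L'" for z
    using that by (auto simp: homeomorphism_def)
  have h': "\<theta> x \<in> L'" "\<psi> (\<theta> x) = x" if "x \<in> L" for x
    using h that by (auto simp: homeomorphism_def)
  have inj: "inj_on \<phi> L"
  proof (rule inj_on_inverseI)
    show "\<psi> (\<xi> (\<phi> x)) = x" if "x \<in> L" for x
      using *[OF h'(1)[OF that]] h'(2)[OF that] by simp
  qed
  have ext: "affine_extension \<beta> L \<alpha> K \<phi>"
    using pe by (simp add: prox_irreducible_extension_def)
  then have "compact L" "continuous_on L \<phi>" "\<phi> ` L = K"
    by (auto simp: affine_extension_def affine_flow_def)
  from homeomorphism_compact[OF this inj] ext show ?thesis
    by (auto simp: affine_isomorphism_def)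
qed

end

theory Submission
  imports Defs
begin

text \<open>A maximal proximally irreducible extension is found with Zorn's lemma. The extensions of \<open>L\<close>
  do not form a set, and between two of them there may be several factor maps or none, so a chain of
  extensions comes without a coherent system of factor maps. Both difficulties disappear if an extension
  \<open>\<phi> : Q \<rightarrow> L\<close> is considered together with a section, that is a choice of points
  \<open>q y \<in> ext_closure Q\<close> above the points \<open>y \<in> ext_closure L\<close>. Proximal irreducibility says that
  the points \<open>g \<cdot> q y\<close> generate \<open>Q\<close> as a compact convex set, so a continuous affine function on \<open>Q\<close>
  is determined by its table of values at these points, a real function of \<open>(g, y)\<close>. The set \<open>E\<close> of
  all these tables determines \<open>Q\<close>: it is the closed convex hull of the evaluations
  \<open>h \<mapsto> h (g, y)\<close> inside the product of lines indexed by \<open>E\<close>, with \<open>G\<close> acting by translation of the first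
  argument (\<open>observables_extension_model\<close>). Conversely an inclusion \<open>E \<subseteq> E'\<close> gives a canonical factor
  map, the restriction of coordinates. Thus pointed extensions become sets of functions ordered by
  inclusion, and inverse limits become unions.

  The union of a chain is again such a set (\<open>extension_model_Union\<close>). In the inverse limit \<open>M\<close> the
  evaluations have coordinates in the closures of the extreme points, and they generate \<open>M\<close>; so Milman's
  theorem shows that the projections of \<open>M\<close> preserve these closures. Hence a subflow that meets
  the required convex hulls in \<open>M\<close> projects onto every member of the chain, and being closed it is \<open>M\<close>.
  The chain argument starts because \<open>L\<close> is a proximally irreducible extension of itself, which is
  the Krein-Milman theorem.

  For a maximal \<open>E\<close>, let \<open>\<psi>\<close> be a proximally irreducible extension of the corresponding flow \<open>M\<close>. By the
  assumption on compositions it leads to a proximally irreducible extension of \<open>L\<close>; a section of it that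
  lifts the section of \<open>M\<close> yields a set of tables containing \<open>E\<close>, hence equal to \<open>E\<close>, and \<open>\<psi>\<close> is an
  isomorphism. So \<open>M\<close> is proximally irreducible (\<open>ex_prox_irreducible_above\<close>).

  Finally let \<open>X\<close> be the closure of the set of extreme points of \<open>M\<close>. The barycenter map from \<open>P(X)\<close> to \<open>M\<close> is always
  proximally irreducible: the extreme points of \<open>P(X)\<close> are point masses, and the only point mass above
  \<open>y \<in> X\<close> is the one at \<open>y\<close>, so a subflow that meets the required hulls contains all point masses
  (\<open>prox_irreducible_extension_barycenter\<close>). As \<open>M\<close> is proximally irreducible, this map is an
  isomorphism. That \<open>P(X)\<close> is an affine flow at all, and the closed convex hull of the point masses, is
  seen on the side of functionals: by the Riesz representation theorem (\<open>prob_measures_eq_states\<close>)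
  \<open>P(X)\<close> consists of all positive normalized functionals on \<open>C(X)\<close>, a condition that is
  visibly closed and convex.\<close>

section \<open>Compact convex sets in locally convex spaces\<close>

lemma compact_coordinatewise:
  assumes "\<And>i. compact (S i)"
  shows "compact {x. \<forall>i. coord x i \<in> S i}"
proof -
  have "compact (Pi\<^sub>E UNIV S)"
    using compactin_PiE[of "\<lambda>_. euclideanreal" UNIV S] assms by (simp add: euclidean_product_topology)
  moreover have "continuous_on UNIV of_coords"
    unfolding continuous_on_real_product_iff by simp
  ultimately have "compact (of_coords ` Pi\<^sub>E UNIV S)"
    by (metis compact_continuous_image continuous_on_subset top_greatest)
  moreover have "of_coords ` Pi\<^sub>E UNIV S = {x. \<forall>i. coord x i \<in> S i}"
    by (force simp: image_iff PiE_iff coord_inverse intro: exI[of _ "coord _"])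
  ultimately show ?thesis by simp
qed

lemma continuous_on_coord: "continuous_on A (\<lambda>x. coord x i)"
  using continuous_on_real_product_iff[of A "\<lambda>x. x"] by (simp add: continuous_on_id)

lemma linear_coord: "linear (\<lambda>x. coord x i)"
  by (simp add: linear_iff)

lemma continuous_on_scaleR_lcs:
  fixes g :: "'b::topological_space \<Rightarrow> 'a::locally_convex_space"
  assumes "continuous_on S f" "continuous_on S g"
  shows "continuous_on S (\<lambda>x. f x *\<^sub>R g x)"
  using assms unfolding continuous_on_def by (blast intro: tendsto_scaleR_locally_convex)

lemma compact_closed_subset: "compact S \<Longrightarrow> closed T \<Longrightarrow> T \<subseteq> S \<Longrightarrow> compact T"
  using compact_Int_closed[of S T] by (simp add: Int_absorb1)

text \<open>By compactness finitely many of the given functionals already distinguish \<open>z\<close> from every point of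
  \<open>C\<close>. They map \<open>C\<close> to a compact convex subset of a finite-dimensional space that misses the image of
  \<open>z\<close>, and the segment from that image to the nearest point gives the separating functional. Only functionals from
  the prescribed set \<open>F\<close> occur; this matters for spaces of functionals on \<open>C(X)\<close>, where the separating functional
  has to be the evaluation at a continuous function.\<close>

lemma separate_point_compact_convex:
  fixes C :: "'a::locally_convex_space set" and F :: "('a \<Rightarrow> real) set"
  assumes C: "compact C" "convex C" "C \<noteq> {}"
    and F: "\<And>f. f \<in> F \<Longrightarrow> linear f" "\<And>f. f \<in> F \<Longrightarrow> continuous_on UNIV f"
    and sep: "\<And>c. c \<in> C \<Longrightarrow> \<exists>f\<in>F. f c \<noteq> f z"
  obtains I a where "finite I" "I \<subseteq> F" "\<And>c. c \<in> C \<Longrightarrow> (\<Sum>f\<in>I. a f * f z) < (\<Sum>f\<in>I. a f * f c)"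
proof -
  have "open {c. f c \<noteq> f z}" if "f \<in> F" for f
    using F(2)[OF that] by (intro open_Collect_neq) auto
  moreover have "C \<subseteq> (\<Union>f\<in>F. {c. f c \<noteq> f z})" using sep by blast
  ultimately obtain I where I: "I \<subseteq> F" "finite I" "C \<subseteq> (\<Union>f\<in>I. {c. f c \<noteq> f z})"
    using compactE_image[OF C(1), of F "\<lambda>f. {c. f c \<noteq> f z}"] by blast
  define N where "N = (\<lambda>c. \<Sum>f\<in>I. (f c - f z)\<^sup>2)"
  have "continuous_on C N"
    unfolding N_def using I(1) F(2)
    by (intro continuous_on_sum continuous_on_power continuous_on_diff continuous_on_const)
       (metis continuous_on_subset subsetD top_greatest)
  then obtain c0 where c0: "c0 \<in> C" "\<And>c. c \<in> C \<Longrightarrow> N c0 \<le> N c"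
    using continuous_attains_inf[OF C(1,3)] by blast
  define a where "a = (\<lambda>f :: 'a \<Rightarrow> real. f c0 - f z)"
  have pos: "(\<Sum>f\<in>I. (a f)\<^sup>2) > 0"
  proof -
    obtain f where "f \<in> I" "a f \<noteq> 0" using I(3) c0(1) by (auto simp: a_def)
    then show ?thesis using I(2) by (intro sum_pos2[of I f]) auto
  qed
  \<comment> \<open>First-order optimality of the nearest point \<open>c0\<close> in the direction of \<open>c\<close>.\<close>
  have le: "(\<Sum>f\<in>I. a f * (f c - f c0)) \<ge> 0" if c: "c \<in> C" for c
  proof (rule ccontr)
    define p where "p = (\<Sum>f\<in>I. a f * (f c - f c0))"
    define q where "q = (\<Sum>f\<in>I. (f c - f c0)\<^sup>2)"
    assume "\<not> ?thesis"
    then have p: "p < 0" by (simp add: p_def)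
    have q: "q \<ge> 0" unfolding q_def by (simp add: sum_nonneg)
    have main: "0 \<le> 2 * t * p + t\<^sup>2 * q" if t: "0 \<le> t" "t \<le> 1" for t
    proof -
      have "(1 - t) *\<^sub>R c0 + t *\<^sub>R c \<in> C" using C(2) c0(1) c t by (auto simp: convex_def)
      then have "N c0 \<le> N ((1 - t) *\<^sub>R c0 + t *\<^sub>R c)" by (rule c0(2))
      also have "N ((1 - t) *\<^sub>R c0 + t *\<^sub>R c) =
          (\<Sum>f\<in>I. (a f)\<^sup>2 + (2 * t * (a f * (f c - f c0)) + t\<^sup>2 * (f c - f c0)\<^sup>2))"
        unfolding N_def
      proof (rule sum.cong[OF refl])
        fix f assume "f \<in> I"
        then have eq: "f ((1 - t) *\<^sub>R c0 + t *\<^sub>R c) = (1 - t) * f c0 + t * f c"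
          using I(1) F(1) by (simp add: linear_add linear_cmul subset_iff)
        show "(f ((1 - t) *\<^sub>R c0 + t *\<^sub>R c) - f z)\<^sup>2 =
            (a f)\<^sup>2 + (2 * t * (a f * (f c - f c0)) + t\<^sup>2 * (f c - f c0)\<^sup>2)"
          unfolding eq by (simp add: a_def power2_eq_square algebra_simps)
      qed
      also have "\<dots> = N c0 + (2 * t * p + t\<^sup>2 * q)"
        by (simp add: N_def a_def p_def q_def sum.distrib sum_distrib_left)
      finally show ?thesis by simp
    qed
    define t where "t = min 1 (- p / (q + 1))"
    have t: "0 < t" "t \<le> 1" using p q by (auto simp: t_def field_simps divide_neg_pos)
    have "t \<le> - p / (q + 1)" by (simp add: t_def)
    then have tp: "t * (q + 1) \<le> - p"
      using q pos_le_divide_eq[of "q + 1" t "- p"] by linarith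
    have "0 \<le> t * (2 * p + t * q)"
      using main[of t] t by (simp add: power2_eq_square algebra_simps)
    then have "0 \<le> 2 * p + t * q" using t(1) by (simp add: zero_le_mult_iff)
    with t tp p show False by (simp add: algebra_simps)
  qed
  show ?thesis
  proof (rule that[OF I(2,1), of a])
    fix c assume "c \<in> C"
    from le[OF this] have "(\<Sum>f\<in>I. a f * f c0) \<le> (\<Sum>f\<in>I. a f * f c)"
      by (simp add: right_diff_distrib sum_subtractf)
    moreover have "(\<Sum>f\<in>I. a f * f c0) - (\<Sum>f\<in>I. a f * f z) = (\<Sum>f\<in>I. (a f)\<^sup>2)"
      unfolding sum_subtractf[symmetric] by (simp add: a_def power2_eq_square algebra_simps)
    ultimately show "(\<Sum>f\<in>I. a f * f z) < (\<Sum>f\<in>I. a f * f c)" using pos by linarith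
  qed
qed

text \<open>A point of \<open>K\<close> outside the closed convex hull \<open>C\<close> of the extreme points is separated from \<open>C\<close> by a
  functional. The face where this functional is minimal on \<open>K\<close> misses \<open>C\<close>, but it contains an extreme point.\<close>

theorem Krein_Milman_locally_convex:
  fixes K :: "'a::locally_convex_space set"
  assumes K: "compact K" "convex K"
  shows "K = closure (convex hull {x. x extreme_point_of K})"
proof (rule antisym)
  define C where "C = closure (convex hull {x. x extreme_point_of K})"
  have CK: "C \<subseteq> K"
    unfolding C_def by (intro closure_minimal hull_minimal K compact_imp_closed)
      (auto simp: extreme_point_of_def)
  then show "closure (convex hull {x. x extreme_point_of K}) \<subseteq> K" by (simp add: C_def)
  have ext: "x \<in> C" if "x extreme_point_of K" for x
    unfolding C_def using that by (intro subsetD[OF closure_subset] hull_inc) simp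
  have C: "compact C" "convex C"
    using compact_closed_subset[OF K(1) _ CK]
    by (auto simp: C_def intro: convex_closure_locally_convex)
  show "K \<subseteq> closure (convex hull {x. x extreme_point_of K})"
  proof (rule ccontr)
    assume "\<not> ?thesis"
    then obtain z where z: "z \<in> K" "z \<notin> C" by (auto simp: C_def)
    have Kne: "K \<noteq> {}" using z by auto
    have "K face_of K" using K by (simp add: face_of_refl)
    then have Cne: "C \<noteq> {}" using closed_face_has_extreme_point[OF _ K(1) Kne] ext by blast
    have "\<exists>f\<in>{f :: 'a \<Rightarrow> real. linear f \<and> continuous_on UNIV f}. f c \<noteq> f z" if "c \<in> C" for c
    proof -
      have "c \<noteq> z" using that z by auto
      then show ?thesis using separating_functional by blast
    qed
    then obtain I a where I: "finite I" "I \<subseteq> {f :: 'a \<Rightarrow> real. linear f \<and> continuous_on UNIV f}"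
      and less: "\<And>c. c \<in> C \<Longrightarrow> (\<Sum>f\<in>I. a f * f z) < (\<Sum>f\<in>I. a f * f c)"
      using separate_point_compact_convex[OF C Cne, of "{f. linear f \<and> continuous_on UNIV f}" z]
      by blast
    define g where "g = (\<lambda>x. \<Sum>f\<in>I. a f * f x)"
    have "linear (\<lambda>x. a f * f x)" if "f \<in> I" for f
      using that I(2) by (auto simp: linear_iff algebra_simps)
    then have lin: "linear g" unfolding g_def by (intro linear_compose_sum) auto
    have cont: "continuous_on UNIV g"
      unfolding g_def using I(2) by (intro continuous_on_sum continuous_on_mult_left) auto
    obtain s where s: "s \<in> K" "\<And>t. t \<in> K \<Longrightarrow> g s \<le> g t"
      using continuous_attains_inf[OF K(1) Kne continuous_on_subset[OF cont subset_UNIV]] by blast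
    define D where "D = K \<inter> g -` {g s}"
    have "compact D"
      unfolding D_def using cont K(1) by (intro compact_Int_closed closed_vimage) auto
    moreover have "D face_of K"
      unfolding face_of_def
    proof (intro conjI ballI impI)
      show "D \<subseteq> K" by (auto simp: D_def)
      have "convex (g -` {g s})" by (rule convex_linear_vimage[OF lin]) simp
      then show "convex D" unfolding D_def using K(2) by (intro convex_Int)
      fix x y w assume xy: "x \<in> K" "y \<in> K" and w: "w \<in> D" "w \<in> open_segment x y"
      then obtain u where u: "0 < u" "u < 1" "w = (1 - u) *\<^sub>R x + u *\<^sub>R y"
        by (auto simp: in_segment)
      have "g s = (1 - u) * g x + u * g y"
        using w(1) u(3) lin by (simp add: D_def linear_add linear_cmul)
      then have "(1 - u) * (g x - g s) + u * (g y - g s) = 0" by (simp add: algebra_simps)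
      moreover have "(1 - u) * (g x - g s) \<ge> 0" "u * (g y - g s) \<ge> 0"
        using s(2) xy u by auto
      ultimately have "(1 - u) * (g x - g s) = 0" "u * (g y - g s) = 0" by linarith+
      then show "x \<in> D" "y \<in> D" using u xy by (auto simp: D_def)
    qed
    moreover have "D \<noteq> {}" using s by (auto simp: D_def)
    ultimately obtain e where "e \<in> D" "e extreme_point_of K"
      using closed_face_has_extreme_point by blast
    moreover from this have "g z < g e" unfolding g_def using less ext by blast
    ultimately show False using s(2)[OF z(1)] by (auto simp: D_def)
  qed
qed

text \<open>The usual description of the convex hull of the union of two convex sets, needed here since it exhibits this
  hull as a continuous image of a compact set when \<open>S\<close> and \<open>T\<close> are compact.\<close>

lemma convex_combinations_two:
  fixes S T :: "'a::real_vector set"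
  assumes "convex S" "convex T"
  shows "convex {u *\<^sub>R s + v *\<^sub>R t | u v s t. u \<ge> 0 \<and> v \<ge> 0 \<and> u + v = 1 \<and> s \<in> S \<and> t \<in> T}"
    (is "convex ?J")
  unfolding convex_def
proof (intro ballI allI impI)
  have comb: "\<exists>r\<in>R. \<alpha> *\<^sub>R x + \<beta> *\<^sub>R y = (\<alpha> + \<beta>) *\<^sub>R r"
    if R: "convex R" "x \<in> R" "y \<in> R" and ab: "\<alpha> \<ge> 0" "\<beta> \<ge> 0" for R :: "'a set" and x y and \<alpha> \<beta> :: real
  proof (cases "\<alpha> + \<beta> = 0")
    case True
    then have "\<alpha> = 0" "\<beta> = 0" using ab by auto
    then show ?thesis using R by auto
  next
    case False
    then have "(\<alpha> / (\<alpha> + \<beta>)) *\<^sub>R x + (\<beta> / (\<alpha> + \<beta>)) *\<^sub>R y \<in> R"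
      using ab by (intro convexD[OF R]) (auto simp: add_divide_distrib[symmetric])
    moreover have "\<alpha> *\<^sub>R x + \<beta> *\<^sub>R y = (\<alpha> + \<beta>) *\<^sub>R ((\<alpha> / (\<alpha> + \<beta>)) *\<^sub>R x + (\<beta> / (\<alpha> + \<beta>)) *\<^sub>R y)"
      using False by (simp add: scaleR_add_right)
    ultimately show ?thesis by blast
  qed
  fix p q and a b :: real
  assume "p \<in> ?J" "q \<in> ?J" and ab: "0 \<le> a" "0 \<le> b" "a + b = 1"
  then obtain u v s t u' v' s' t' where
    p: "p = u *\<^sub>R s + v *\<^sub>R t" "u \<ge> 0" "v \<ge> 0" "u + v = 1" "s \<in> S" "t \<in> T" and
    q: "q = u' *\<^sub>R s' + v' *\<^sub>R t'" "u' \<ge> 0" "v' \<ge> 0" "u' + v' = 1" "s' \<in> S" "t' \<in> T"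
    by blast
  obtain s'' where s'': "s'' \<in> S" "(a * u) *\<^sub>R s + (b * u') *\<^sub>R s' = (a * u + b * u') *\<^sub>R s''"
    using comb[OF assms(1) p(5) q(5), of "a * u" "b * u'"] ab p q by auto
  obtain t'' where t'': "t'' \<in> T" "(a * v) *\<^sub>R t + (b * v') *\<^sub>R t' = (a * v + b * v') *\<^sub>R t''"
    using comb[OF assms(2) p(6) q(6), of "a * v" "b * v'"] ab p q by auto
  have "a *\<^sub>R p + b *\<^sub>R q = ((a * u) *\<^sub>R s + (b * u') *\<^sub>R s') + ((a * v) *\<^sub>R t + (b * v') *\<^sub>R t')"
    by (simp add: p(1) q(1) algebra_simps)
  also have "\<dots> = (a * u + b * u') *\<^sub>R s'' + (a * v + b * v') *\<^sub>R t''" by (simp add: s'' t'')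
  finally have "a *\<^sub>R p + b *\<^sub>R q = (a * u + b * u') *\<^sub>R s'' + (a * v + b * v') *\<^sub>R t''" .
  moreover have "(a * u + b * u') + (a * v + b * v') = a * (u + v) + b * (u' + v')"
    by (simp add: algebra_simps)
  then have "(a * u + b * u') + (a * v + b * v') = 1" using ab p q by simp
  moreover have "0 \<le> a * u + b * u'" "0 \<le> a * v + b * v'" using ab p q by auto
  ultimately show "a *\<^sub>R p + b *\<^sub>R q \<in> ?J" using s''(1) t''(1) by blast
qed

text \<open>The convex combinations of two points from the two closed hulls form a compact convex set, so they exhaust
  \<open>K\<close>, and an extreme point is no proper combination.\<close>

lemma extreme_point_closed_hull_Un:
  fixes A B :: "'a::locally_convex_space set"
  assumes K: "compact K" "K = closure (convex hull (A \<union> B))" and x: "x extreme_point_of K"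
  shows "x \<in> closure (convex hull A) \<or> x \<in> closure (convex hull B)"
proof (cases "A = {} \<or> B = {}")
  case True
  then show ?thesis using K x by (auto simp: extreme_point_of_def)
next
  case False
  define S T where "S = closure (convex hull A)" and "T = closure (convex hull B)"
  have sub: "S \<subseteq> K" "T \<subseteq> K"
    unfolding S_def T_def K(2) by (intro closure_mono hull_mono Un_upper1 Un_upper2)+
  have cpt: "compact S" "compact T"
    using compact_closed_subset[OF K(1) _ sub(1)] compact_closed_subset[OF K(1) _ sub(2)]
    by (auto simp: S_def T_def)
  have cvx: "convex S" "convex T" by (simp_all add: S_def T_def convex_closure_locally_convex)
  have AS: "A \<subseteq> S" "B \<subseteq> T"
    unfolding S_def T_def by (meson closure_subset hull_subset order_trans)+
  obtain a0 b0 where ab0: "a0 \<in> S" "b0 \<in> T" using False AS by blast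
  define J where "J = {u *\<^sub>R s + v *\<^sub>R t | u v s t. u \<ge> 0 \<and> v \<ge> 0 \<and> u + v = 1 \<and> s \<in> S \<and> t \<in> T}"
  let ?m = "\<lambda>(u :: real, s, t). u *\<^sub>R s + (1 - u) *\<^sub>R t"
  have "J = ?m ` ({0..1} \<times> S \<times> T)"
  proof (rule antisym; rule subsetI)
    fix y assume "y \<in> J"
    then obtain u v s t where y: "y = u *\<^sub>R s + v *\<^sub>R t" "u \<ge> 0" "v \<ge> 0" "u + v = 1" "s \<in> S" "t \<in> T"
      by (auto simp: J_def)
    then have "y = ?m (u, s, t)" "(u, s, t) \<in> {0..1} \<times> S \<times> T"
      by (auto simp: eq_diff_eq[symmetric] add.commute[of u v])
    then show "y \<in> ?m ` ({0..1} \<times> S \<times> T)" by (rule image_eqI)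
  next
    fix y assume "y \<in> ?m ` ({0..1} \<times> S \<times> T)"
    then obtain u s t where "y = u *\<^sub>R s + (1 - u) *\<^sub>R t" "0 \<le> u" "0 \<le> 1 - u" "u + (1 - u) = 1" "s \<in> S" "t \<in> T"
      by auto
    then show "y \<in> J" unfolding J_def by blast
  qed
  moreover have "continuous_on ({0..1} \<times> S \<times> T) ?m"
    unfolding case_prod_beta
    by (intro continuous_on_add continuous_on_scaleR_lcs continuous_on_diff continuous_on_const
        continuous_on_fst continuous_on_snd continuous_on_id)
  ultimately have "closed J"
    using cpt by (auto intro!: compact_imp_closed compact_continuous_image compact_Times)
  moreover have "convex J" unfolding J_def by (rule convex_combinations_two[OF cvx])
  moreover have "A \<union> B \<subseteq> J"
  proof
    fix y assume "y \<in> A \<union> B"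
    then have "y = 1 *\<^sub>R y + 0 *\<^sub>R b0 \<and> y \<in> S \<or> y = 0 *\<^sub>R a0 + 1 *\<^sub>R y \<and> y \<in> T" using AS by auto
    moreover have "(1::real) \<ge> 0" "(1::real) + 0 = 1" "(0::real) + 1 = 1" by simp_all
    ultimately show "y \<in> J" unfolding J_def using ab0 by blast
  qed
  ultimately have "K \<subseteq> J" unfolding K(2) by (intro closure_minimal hull_minimal)
  moreover have xK: "x \<in> K" using x by (simp add: extreme_point_of_def)
  ultimately obtain u v s t where st: "x = u *\<^sub>R s + v *\<^sub>R t" "u \<ge> 0" "v \<ge> 0" "u + v = 1" "s \<in> S" "t \<in> T"
    by (auto simp: J_def)
  have "x = s \<or> x = t"
  proof (rule ccontr)
    assume *: "\<not> ?thesis"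
    then have "u \<noteq> 0" "v \<noteq> 0" "s \<noteq> t"
      using st by (auto simp: scaleR_left_distrib[symmetric])
    then have "x \<in> open_segment s t"
      using st by (auto simp: in_segment intro!: exI[of _ v])
    then show False using x sub st(5,6) by (auto simp: extreme_point_of_def)
  qed
  then show ?thesis using st(5,6) by (auto simp: S_def T_def)
qed

lemma extreme_point_closed_hull_UN:
  fixes D :: "'i \<Rightarrow> 'a::locally_convex_space set"
  assumes "finite I" "compact K" "K = closure (convex hull (\<Union>i\<in>I. D i))" "x extreme_point_of K"
  shows "\<exists>i\<in>I. x \<in> closure (convex hull (D i))"
  using assms
proof (induction I arbitrary: K)
  case empty
  then show ?case by (simp add: extreme_point_of_def)
next
  case (insert i I)
  define K' where "K' = closure (convex hull (\<Union>i\<in>I. D i))"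
  have K: "K = closure (convex hull (D i \<union> (\<Union>i\<in>I. D i)))" using insert.prems by simp
  have sub: "K' \<subseteq> K" unfolding K'_def K by (intro closure_mono hull_mono) auto
  from extreme_point_closed_hull_Un[OF insert.prems(1) K insert.prems(3)]
  consider "x \<in> closure (convex hull (D i))" | "x \<in> K'" by (auto simp: K'_def)
  then show ?case
  proof cases
    case 2
    have "compact K'"
      using compact_closed_subset[OF insert.prems(1) _ sub] by (simp add: K'_def)
    moreover have "x extreme_point_of K'"
      using 2 sub insert.prems(3) by (auto simp: extreme_point_of_def)
    ultimately show ?thesis using insert.IH[of K'] K'_def by blast
  qed auto
qed

text \<open>If \<open>x \<notin> D\<close>, then each \<open>d \<in> D\<close> lies in an open half-space whose closure misses \<open>x\<close>.
  Finitely many of these cover \<open>D\<close>, and \<open>x\<close> would belong to the closed convex hull of one of the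
  pieces, hence to the closed half-space.\<close>

theorem Milman_locally_convex:
  fixes D :: "'a::locally_convex_space set"
  assumes D: "compact D" and K: "compact K" "K = closure (convex hull D)"
    and x: "x extreme_point_of K"
  shows "x \<in> D"
proof (rule ccontr)
  assume xD: "x \<notin> D"
  have "\<exists>f :: 'a \<Rightarrow> real. linear f \<and> continuous_on UNIV f \<and> f x < f d" if "d \<in> D" for d
  proof -
    have "d \<noteq> x" using that xD by auto
    then obtain f :: "'a \<Rightarrow> real" where f: "linear f" "continuous_on UNIV f" "f d \<noteq> f x"
      by (rule separating_functional)
    show ?thesis
    proof (cases "f x < f d")
      case False
      then show ?thesis using f
        by (intro exI[of _ "\<lambda>z. - f z"]) (auto simp: linear_compose_neg intro: continuous_on_minus)
    qed (use f in blast)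
  qed
  then obtain f :: "'a \<Rightarrow> 'a \<Rightarrow> real" where f: "\<And>d. d \<in> D \<Longrightarrow> linear (f d)"
    "\<And>d. d \<in> D \<Longrightarrow> continuous_on UNIV (f d)" "\<And>d. d \<in> D \<Longrightarrow> f d x < f d d" by metis
  define m where "m = (\<lambda>d. (f d x + f d d) / 2)"
  have m: "f d x < m d" "m d < f d d" if "d \<in> D" for d using f(3)[OF that] by (auto simp: m_def)
  have "open {z. m d < f d z}" if "d \<in> D" for d
    using f(2)[OF that] by (intro open_Collect_less) auto
  moreover have "D \<subseteq> (\<Union>d\<in>D. {z. m d < f d z})" using m by auto
  ultimately obtain I where I: "I \<subseteq> D" "finite I" "D \<subseteq> (\<Union>d\<in>I. {z. m d < f d z})"
    using compactE_image[OF D, of D "\<lambda>d. {z. m d < f d z}"] by blast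
  define E where "E = (\<lambda>d. D \<inter> {z. m d < f d z})"
  have "D = (\<Union>d\<in>I. E d)" using I(3) by (auto simp: E_def)
  then obtain d where d: "d \<in> I" "x \<in> closure (convex hull (E d))"
    using extreme_point_closed_hull_UN[OF I(2) K(1) _ x, of E] K(2) by auto
  have dD: "d \<in> D" using d I by auto
  have "closed {z. m d \<le> f d z}" using f(2)[OF dD] by (intro closed_Collect_le) auto
  moreover have "convex {z. m d \<le> f d z}"
    using convex_linear_vimage[OF f(1)[OF dD], of "{m d..}"] by (simp add: vimage_def)
  moreover have "E d \<subseteq> {z. m d \<le> f d z}" by (auto simp: E_def)
  ultimately have "closure (convex hull (E d)) \<subseteq> {z. m d \<le> f d z}"
    by (intro closure_minimal hull_minimal)
  with d(2) m(1)[OF dD] show False by auto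
qed

lemma affine_image_closed_convex_hull:
  fixes f :: "'a::locally_convex_space \<Rightarrow> 'b::locally_convex_space"
  assumes K: "compact K" "K = closure (convex hull S)"
    and f: "continuous_on K f" "affine_map_on K f"
  shows "f ` K = closure (convex hull (f ` S))"
proof (rule antisym)
  have SK: "S \<subseteq> K" "convex hull S \<subseteq> K"
    unfolding K(2) by (meson closure_subset hull_subset order_trans)+
  have cvx: "convex K" unfolding K(2) by (simp add: convex_closure_locally_convex)
  have "f ` (convex hull S) \<subseteq> closure (convex hull (f ` S))"
    using affine_map_on_convex_hull[OF f(2) cvx SK(1)] closure_subset by blast
  then show "f ` K \<subseteq> closure (convex hull (f ` S))"
    unfolding K(2) by (intro image_closure_subset) (use f(1) K(2) in auto)
  show "closure (convex hull (f ` S)) \<subseteq> f ` K"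
    using SK(1) affine_map_on_convex_image[OF f(2) cvx order_refl] compact_continuous_image[OF f(1) K(1)]
    by (intro closure_minimal hull_minimal compact_imp_closed) auto
qed

text \<open>This is the uniqueness principle for all maps below: flows are closed convex hulls of explicit points, and
  maps are compared only there.\<close>

lemma affine_map_eq_on_closed_convex_hull:
  fixes f g :: "'a::locally_convex_space \<Rightarrow> 'b::locally_convex_space"
  assumes K: "K = closure (convex hull S)"
    and f: "continuous_on K f" "affine_map_on K f" and g: "continuous_on K g" "affine_map_on K g"
    and eq: "\<And>x. x \<in> S \<Longrightarrow> f x = g x" and x: "x \<in> K"
  shows "f x = g x"
proof -
  have cvx: "convex K" unfolding K by (simp add: convex_closure_locally_convex)
  have "closed {x \<in> K. f x - g x = 0}"
    using f g K by (intro continuous_closed_preimage_constant continuous_on_diff) auto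
  then have "closed {x \<in> K. f x = g x}" by simp
  moreover have "convex {x \<in> K. f x = g x}"
    using cvx by (auto simp: convex_def affine_map_onD[OF f(2)] affine_map_onD[OF g(2)])
  moreover have "S \<subseteq> {x \<in> K. f x = g x}"
    unfolding K using eq by (auto intro!: subsetD[OF closure_subset] hull_inc)
  ultimately have "K \<subseteq> {x \<in> K. f x = g x}"
    by (subst (1) K) (intro closure_minimal hull_minimal)
  with x show ?thesis by blast
qed

lemma linear_imp_affine_map_on: "linear f \<Longrightarrow> affine_map_on K f"
  by (simp add: affine_map_on_def linear_add linear_cmul)

section \<open>Proximally irreducible extensions\<close>

lemma affine_subflow_closed_convex_hull:
  assumes L: "affine_flow \<beta> L" and D: "D \<subseteq> L" "D \<noteq> {}" "\<And>g x. x \<in> D \<Longrightarrow> \<beta> g x \<in> D"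
  shows "affine_subflow \<beta> L (closure (convex hull D))"
proof -
  note cmp = affine_flowD(2)[OF L] and cvx = affine_flowD(3)[OF L]
  define C where "C = closure (convex hull D)"
  have CL: "C \<subseteq> L"
    unfolding C_def by (intro closure_minimal hull_minimal D cvx compact_imp_closed cmp)
  have "compact C" using compact_closed_subset[OF cmp _ CL] by (simp add: C_def)
  moreover have "affine_map_on C (\<beta> g)" for g
    using affine_flowD(4)[OF L] CL unfolding affine_map_on_def by blast
  ultimately have "\<beta> g ` C = closure (convex hull (\<beta> g ` D))" for g
    using continuous_on_subset[OF affine_flow_continuous[OF L] CL]
    by (intro affine_image_closed_convex_hull[OF _ C_def])
  also have "closure (convex hull (\<beta> g ` D)) \<subseteq> C" for g
    unfolding C_def by (intro closure_mono hull_mono) (use D in auto)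
  finally have "\<beta> g ` C \<subseteq> C" for g .
  moreover have "C \<noteq> {}" using D(2) hull_subset[of D convex] by (auto simp: C_def)
  ultimately show ?thesis
    using CL by (auto simp: affine_subflow_def C_def convex_closure_locally_convex)
qed

text \<open>Each element of the group acts by an affine homeomorphism, which is an isomorphism of affine
  flows if the action is replaced by the trivial one.\<close>

lemma affine_flow_ext_closure:
  fixes \<beta> :: "'g::{group_add, topological_space} \<Rightarrow> 'a::locally_convex_space \<Rightarrow> 'a"
  assumes L: "affine_flow \<beta> L" and x: "x \<in> ext_closure L"
  shows "\<beta> g x \<in> ext_closure L"
proof -
  let ?i = "\<lambda>(_ :: 'g) (x :: 'a). x"
  have inv': "\<beta> g (\<beta> (- g) x) = x" if "x \<in> L" for g x
    using affine_flowD(7)[OF L that, of g "- g"] affine_flowD(6)[OF L that] by simp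
  have inv: "\<beta> (- g) (\<beta> g x) = x" "\<beta> g (\<beta> (- g) x) = x" if "x \<in> L" for x
    using inv'[OF that, of g] inv'[OF that, of "- g"] by simp_all
  have im: "\<beta> g ` L = L" for g
  proof (intro subset_antisym subsetI)
    show "x \<in> \<beta> g ` L" if "x \<in> L" for x
      using inv'[OF that, of g] affine_flowD(5)[OF L that, of "- g"] by (metis imageI)
  qed (use affine_flowD(5)[OF L] in auto)
  have "affine_flow ?i L"
    using affine_flowD(1-3)[OF L]
    by (auto simp: affine_flow_def continuous_action_top_of_set affine_map_on_def case_prod_beta
        intro!: continuous_on_snd continuous_on_id)
  then have "affine_extension ?i L ?i L (\<beta> g)"
    using affine_flow_continuous[OF L, of g] affine_flowD(4)[OF L, of g] im[of g]
    by (simp add: affine_extension_def)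
  moreover have "homeomorphism L L (\<beta> g) (\<beta> (- g))"
    using affine_flow_continuous[OF L] im inv by (intro homeomorphismI) auto
  ultimately have "affine_isomorphism ?i L ?i L (\<beta> g)" by (auto simp: affine_isomorphism_def)
  from affine_isomorphism_ext_closure[OF this] x show ?thesis by blast
qed

lemma prox_irreducible_extensionD:
  assumes "prox_irreducible_extension \<beta> Q \<alpha> L \<phi>"
  shows "affine_extension \<beta> Q \<alpha> L \<phi>" "affine_flow \<beta> Q" "affine_flow \<alpha> L"
    "continuous_on Q \<phi>" "\<phi> ` Q = L" "affine_map_on Q \<phi>"
    "x \<in> Q \<Longrightarrow> \<phi> (\<beta> g x) = \<alpha> g (\<phi> x)"
    "affine_subflow \<beta> Q C \<Longrightarrow>
       (\<And>y. y \<in> ext_closure L \<Longrightarrow> C \<inter> convex hull (ext_closure Q \<inter> \<phi> -` {y}) \<noteq> {}) \<Longrightarrow> C = Q"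
proof -
  show ext: "affine_extension \<beta> Q \<alpha> L \<phi>"
    using assms by (simp add: prox_irreducible_extension_def)
  then show "affine_flow \<beta> Q" "affine_flow \<alpha> L" "continuous_on Q \<phi>" "\<phi> ` Q = L"
    "affine_map_on Q \<phi>" "x \<in> Q \<Longrightarrow> \<phi> (\<beta> g x) = \<alpha> g (\<phi> x)"
    by (simp_all add: affine_extension_def)
  show "affine_subflow \<beta> Q C \<Longrightarrow>
      (\<And>y. y \<in> ext_closure L \<Longrightarrow> C \<inter> convex hull (ext_closure Q \<inter> \<phi> -` {y}) \<noteq> {}) \<Longrightarrow> C = Q"
    using assms unfolding prox_irreducible_extension_def by blast
qed

lemma ext_closure_nonempty:
  assumes "affine_flow \<alpha> L"
  shows "ext_closure L \<noteq> {}"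
proof -
  have "L face_of L" using affine_flowD(3)[OF assms] by (simp add: face_of_refl)
  then obtain x where "x extreme_point_of L"
    using closed_face_has_extreme_point affine_flowD(1,2)[OF assms] by metis
  then show ?thesis using closure_subset by (force simp: ext_closure_def)
qed

text \<open>The form in which proximal irreducibility is used: an invariant set that contains, above each point of
  \<open>ext_closure L\<close>, a point of \<open>ext_closure Q\<close> has a closed convex hull that meets all the required sets.\<close>

lemma prox_irreducible_extension_generated:
  assumes pe: "prox_irreducible_extension \<beta> Q \<alpha> L \<phi>"
    and D: "D \<subseteq> Q" "\<And>g x. x \<in> D \<Longrightarrow> \<beta> g x \<in> D"
    and meet: "\<And>y. y \<in> ext_closure L \<Longrightarrow> \<exists>x\<in>D. x \<in> ext_closure Q \<and> \<phi> x = y"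
  shows "Q = closure (convex hull D)"
proof -
  have DC: "D \<subseteq> closure (convex hull D)" by (meson closure_subset hull_subset order_trans)
  have "D \<noteq> {}" using meet ext_closure_nonempty[OF prox_irreducible_extensionD(3)[OF pe]] by blast
  then have "closure (convex hull D) = Q"
  proof (intro prox_irreducible_extensionD(8)[OF pe] affine_subflow_closed_convex_hull)
    fix y assume "y \<in> ext_closure L"
    then obtain x where "x \<in> D" "x \<in> ext_closure Q \<inter> \<phi> -` {y}" using meet by auto
    then show "closure (convex hull D) \<inter> convex hull (ext_closure Q \<inter> \<phi> -` {y}) \<noteq> {}"
      using DC hull_inc by (metis disjoint_iff subsetD)
  qed (use D prox_irreducible_extensionD[OF pe] in auto)
  then show ?thesis by simp
qed

text \<open>For the identity the fibers are points, so \<open>C\<close> contains all extreme points and the claim is the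
  Krein-Milman theorem.\<close>

lemma prox_irreducible_extension_id:
  assumes L: "affine_flow \<alpha> L"
  shows "prox_irreducible_extension \<alpha> L \<alpha> L (\<lambda>x. x)"
  unfolding prox_irreducible_extension_def
proof (intro conjI allI impI)
  show "affine_extension \<alpha> L \<alpha> L (\<lambda>x. x)"
    using L by (simp add: affine_extension_def affine_map_on_def continuous_on_id)
  fix C assume C: "affine_subflow \<alpha> L C \<and>
    (\<forall>y\<in>ext_closure L. C \<inter> convex hull (ext_closure L \<inter> (\<lambda>x. x) -` {y}) \<noteq> {})"
  have "y \<in> C" if "y \<in> ext_closure L" for y
  proof -
    have "ext_closure L \<inter> (\<lambda>x. x) -` {y} = {y}" using that by auto
    then show ?thesis using C that by fastforce
  qed
  moreover have "{x. x extreme_point_of L} \<subseteq> ext_closure L"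
    unfolding ext_closure_def by (rule closure_subset)
  ultimately have "{x. x extreme_point_of L} \<subseteq> C" by blast
  then have "closure (convex hull {x. x extreme_point_of L}) \<subseteq> C"
    using C by (intro closure_minimal hull_minimal) (auto simp: affine_subflow_def)
  then show "C = L"
    using Krein_Milman_locally_convex[OF affine_flowD(2,3)[OF L]] C
    by (auto simp: affine_subflow_def)
qed

lemma prox_irreducible_extension_compose_iso:
  assumes pe: "prox_irreducible_extension \<beta> Q \<alpha> K \<phi>" and iso: "affine_isomorphism \<alpha> K \<alpha>' K' \<theta>"
  shows "prox_irreducible_extension \<beta> Q \<alpha>' K' (\<lambda>x. \<theta> (\<phi> x))"
  unfolding prox_irreducible_extension_def
proof (intro conjI allI impI)
  note Q = prox_irreducible_extensionD(2)[OF pe]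
  show "affine_extension \<beta> Q \<alpha>' K' (\<lambda>x. \<theta> (\<phi> x))"
    using affine_extension_compose[OF prox_irreducible_extensionD(1)[OF pe]] iso
    by (auto simp: affine_isomorphism_def)
  fix C assume C: "affine_subflow \<beta> Q C \<and>
    (\<forall>y\<in>ext_closure K'. C \<inter> convex hull (ext_closure Q \<inter> (\<lambda>x. \<theta> (\<phi> x)) -` {y}) \<noteq> {})"
  obtain \<psi> where h: "homeomorphism K K' \<theta> \<psi>" using iso by (auto simp: affine_isomorphism_def)
  show "C = Q"
  proof (rule prox_irreducible_extensionD(8)[OF pe])
    show "affine_subflow \<beta> Q C" using C by blast
    fix y assume y: "y \<in> ext_closure K"
    have sub: "ext_closure K \<subseteq> K" "ext_closure Q \<subseteq> Q"
      using ext_closure_subset affine_flowD(2) prox_irreducible_extensionD(2,3)[OF pe] by blast+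
    have "inj_on \<theta> K" using h by (metis homeomorphism_def inj_on_inverseI)
    moreover have "\<phi> x \<in> K" if "x \<in> ext_closure Q" for x
      using that sub prox_irreducible_extensionD(5)[OF pe] by auto
    ultimately have "ext_closure Q \<inter> (\<lambda>x. \<theta> (\<phi> x)) -` {\<theta> y} = ext_closure Q \<inter> \<phi> -` {y}"
      using y sub(1) by (auto dest: inj_onD)
    moreover have "\<theta> y \<in> ext_closure K'" using affine_isomorphism_ext_closure[OF iso] y by blast
    ultimately show "C \<inter> convex hull (ext_closure Q \<inter> \<phi> -` {y}) \<noteq> {}" using C by metis
  qed
qed

lemma prox_irreducible_isomorphic:
  fixes \<alpha> :: "'g::{group_add, topological_space} \<Rightarrow> 'a::locally_convex_space \<Rightarrow> 'a"
    and \<beta> :: "'g \<Rightarrow> 'b::locally_convex_space \<Rightarrow> 'b"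
  assumes K: "prox_irreducible \<alpha> K" and iso: "affine_isomorphism \<beta> P \<alpha> K \<theta>"
  shows "prox_irreducible \<beta> P"
  unfolding prox_irreducible_def
proof (intro conjI allI impI)
  show "affine_flow \<beta> P" using iso by (simp add: affine_isomorphism_def affine_extension_def)
  fix \<gamma> and Q :: "('g, 'b) extension_space set" and \<phi>
  assume pe: "prox_irreducible_extension \<gamma> Q \<beta> P \<phi>"
  have "affine_isomorphism \<gamma> Q \<alpha> K (\<lambda>x. \<theta> (\<phi> x))"
    by (rule prox_irreducible_imp_isomorphism[OF K prox_irreducible_extension_compose_iso[OF pe iso]])
  then have "inj_on (\<lambda>x. \<theta> (\<phi> x)) Q"
    by (auto simp: affine_isomorphism_def homeomorphism_def intro: inj_on_inverseI)
  then have "inj_on \<phi> Q" by (auto simp: inj_on_def)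
  note ext = prox_irreducible_extensionD[OF pe]
  obtain \<psi> where "homeomorphism Q P \<phi> \<psi>"
    using homeomorphism_compact[OF affine_flowD(2)[OF ext(2)] ext(4,5) \<open>inj_on \<phi> Q\<close>] by blast
  then show "affine_isomorphism \<gamma> Q \<beta> P \<phi>" using ext(1) by (auto simp: affine_isomorphism_def)
qed

section \<open>Riesz representation on compact Hausdorff spaces\<close>

text \<open>The domain of \<open>\<Lambda>\<close> is the type of all real functions, but only its values at continuous functions are
  constrained.\<close>

locale positive_functional =
  fixes X :: "'x topology" and \<Lambda> :: "('x \<Rightarrow> real) \<Rightarrow> real"
  assumes compact: "compact_space X" and Hausdorff: "Hausdorff_space X"
    and add: "\<And>f g. continuous_map X euclideanreal f \<Longrightarrow> continuous_map X euclideanreal g \<Longrightarrow>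
      \<Lambda> (\<lambda>x. f x + g x) = \<Lambda> f + \<Lambda> g"
    and scale: "\<And>c f. continuous_map X euclideanreal f \<Longrightarrow> \<Lambda> (\<lambda>x. c * f x) = c * \<Lambda> f"
    and nonneg: "\<And>f. continuous_map X euclideanreal f \<Longrightarrow> (\<And>x. x \<in> topspace X \<Longrightarrow> 0 \<le> f x) \<Longrightarrow> 0 \<le> \<Lambda> f"
    and one: "\<Lambda> (\<lambda>x. 1) = 1"
begin

lemma const: "\<Lambda> (\<lambda>x. c) = c"
  using scale[of "\<lambda>x. 1" c] one by simp

lemma diff:
  assumes "continuous_map X euclideanreal f" "continuous_map X euclideanreal g"
  shows "\<Lambda> (\<lambda>x. f x - g x) = \<Lambda> f - \<Lambda> g"
  using add[of "\<lambda>x. f x - g x" g] assms by (simp add: continuous_map_diff)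

lemma mono:
  assumes "continuous_map X euclideanreal f" "continuous_map X euclideanreal g"
    and "\<And>x. x \<in> topspace X \<Longrightarrow> f x \<le> g x"
  shows "\<Lambda> f \<le> \<Lambda> g"
  using nonneg[of "\<lambda>x. g x - f x"] diff[of g f] assms by (simp add: continuous_map_diff)

text \<open>The representing measure is the restriction of an outer measure to the Borel sets. An open set is measured from
  inside, by the functions between \<open>0\<close> and its indicator function, and every other set from outside, by open sets.\<close>

definition below :: "'x set \<Rightarrow> ('x \<Rightarrow> real) set"
  where "below U = {f. continuous_map X euclideanreal f \<and>
    (\<forall>x\<in>topspace X. 0 \<le> f x \<and> f x \<le> 1 \<and> (x \<notin> U \<longrightarrow> f x = 0))}"

definition weight :: "'x set \<Rightarrow> ennreal"
  where "weight U = (SUP f\<in>below U. ennreal (\<Lambda> f))"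

definition outer :: "'x set \<Rightarrow> ennreal"
  where "outer A = (INF U\<in>{U. openin X U \<and> A \<subseteq> U}. weight U)"

lemma weight_upper: "f \<in> below U \<Longrightarrow> ennreal (\<Lambda> f) \<le> weight U"
  unfolding weight_def by (rule SUP_upper)

lemma weight_least: "(\<And>f. f \<in> below U \<Longrightarrow> ennreal (\<Lambda> f) \<le> c) \<Longrightarrow> weight U \<le> c"
  unfolding weight_def by (rule SUP_least)

lemma zero_below: "(\<lambda>x. 0) \<in> below U"
  by (simp add: below_def)

lemma below_mono: "f \<in> below U \<Longrightarrow> U \<subseteq> V \<Longrightarrow> f \<in> below V"
  unfolding below_def by blast

lemma weight_mono: "U \<subseteq> V \<Longrightarrow> weight U \<le> weight V"
  by (meson weight_least weight_upper below_mono)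

lemma weight_empty: "weight {} = 0"
proof -
  have "\<Lambda> f \<le> 0" if "f \<in> below {}" for f
    using mono[of f "\<lambda>x. 0"] const[of 0] that by (auto simp: below_def)
  then have "weight {} \<le> 0"
    by (intro weight_least) (simp add: ennreal_neg)
  then show ?thesis by simp
qed

lemma weight_space: "weight (topspace X) = 1"
proof (rule antisym)
  have "\<Lambda> f \<le> 1" if "f \<in> below (topspace X)" for f
    using mono[of f "\<lambda>x. 1"] const[of 1] that by (auto simp: below_def)
  then show "weight (topspace X) \<le> 1"
    by (intro weight_least) (simp add: ennreal_le_1)
  show "1 \<le> weight (topspace X)"
    using weight_upper[of "\<lambda>x. 1" "topspace X"] by (simp add: below_def one)
qed

lemma normal: "normal_space X"
  using compact Hausdorff by (simp add: compact_Hausdorff_or_regular_imp_normal_space)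

lemma closedin_superlevel:
  assumes "continuous_map X euclideanreal f"
  shows "closedin X {x \<in> topspace X. e \<le> f x}"
  using closedin_continuous_map_preimage[OF assms, of "{e..}"] by simp

text \<open>A function in \<open>below U\<close> vanishes outside \<open>U\<close>, but its support need not be contained in \<open>U\<close>.
  Cutting it off at height \<open>e > 0\<close> changes \<open>\<Lambda>\<close> by at most \<open>e\<close> and moves the support into the closed
  subset \<open>{x. e \<le> f x}\<close> of \<open>U\<close>, to which compactness and Urysohn's lemma apply.\<close>

lemma cutoff:
  assumes f: "f \<in> below U" and e: "e \<ge> 0"
  shows "(\<lambda>x. max 0 (f x - e)) \<in> below {x \<in> topspace X. e < f x}"
    and "\<Lambda> f \<le> \<Lambda> (\<lambda>x. max 0 (f x - e)) + e"
proof -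
  have c: "continuous_map X euclideanreal f" using f by (simp add: below_def)
  have c': "continuous_map X euclideanreal (\<lambda>x. max 0 (f x - e))"
    using c by (intro continuous_intros)
  show "(\<lambda>x. max 0 (f x - e)) \<in> below {x \<in> topspace X. e < f x}"
    using f c' e by (auto simp: below_def)
  have "\<Lambda> f \<le> \<Lambda> (\<lambda>x. max 0 (f x - e) + e)"
    using c c' by (intro mono continuous_intros) auto
  also have "\<dots> = \<Lambda> (\<lambda>x. max 0 (f x - e)) + e"
    using add[OF c', of "\<lambda>x. e"] const[of e] by simp
  finally show "\<Lambda> f \<le> \<Lambda> (\<lambda>x. max 0 (f x - e)) + e" .
qed

text \<open>After the cutoff, a Urysohn function \<open>g\<close> that is \<open>1\<close> on the part of the support outside \<open>V\<close> and \<open>0\<close>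
  outside \<open>U\<close> splits the function as \<open>h * g + h * (1 - g)\<close>.\<close>

lemma weight_Un:
  assumes U: "openin X U" and V: "openin X V"
  shows "weight (U \<union> V) \<le> weight U + weight V"
proof (rule weight_least)
  fix f assume f: "f \<in> below (U \<union> V)"
  show "ennreal (\<Lambda> f) \<le> weight U + weight V"
  proof (rule ennreal_le_epsilon)
    fix e :: real assume e: "e > 0"
    define h where "h = (\<lambda>x. max 0 (f x - e))"
    define K where "K = {x \<in> topspace X. e \<le> f x}"
    have cf: "continuous_map X euclideanreal f" using f by (simp add: below_def)
    have h: "h \<in> below {x \<in> topspace X. e < f x}" and fh: "\<Lambda> f \<le> \<Lambda> h + e"
      unfolding h_def using cutoff[OF f, of e] e by auto
    have K: "closedin X K" unfolding K_def by (rule closedin_superlevel[OF cf])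
    have KUV: "K \<subseteq> U \<union> V" using f e by (auto simp: K_def below_def)
    have "closedin X (K - V)" "closedin X (topspace X - U)"
      using K U V by (auto intro: closedin_diff)
    moreover have "disjnt (K - V) (topspace X - U)" using KUV by (auto simp: disjnt_def)
    ultimately obtain g where g: "continuous_map X (top_of_set {0..1::real}) g"
      "g ` (topspace X - U) \<subseteq> {0}" "g ` (K - V) \<subseteq> {1}"
      using Urysohn_lemma[OF normal, of "topspace X - U" "K - V" 0 1]
      by (auto simp: disjnt_sym)
    then have cg: "continuous_map X euclideanreal g" and g01: "\<And>x. x \<in> topspace X \<Longrightarrow> 0 \<le> g x \<and> g x \<le> 1"
      by (auto simp: continuous_map_in_subtopology)
    have ch: "continuous_map X euclideanreal h" using h by (simp add: below_def)
    have h01: "0 \<le> h x \<and> h x \<le> 1" if "x \<in> topspace X" for x using h that by (simp add: below_def)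
    have h0: "h x = 0" if "x \<in> topspace X" "x \<notin> K" for x
      using h that by (auto simp: below_def K_def)
    have "(\<lambda>x. h x * g x) \<in> below U"
      using g h01 g01 continuous_map_real_mult[OF ch cg]
      by (auto simp: below_def image_subset_iff mult_le_one)
    moreover have "(\<lambda>x. h x * (1 - g x)) \<in> below V"
    proof -
      have "h x * (1 - g x) = 0" if "x \<in> topspace X" "x \<notin> V" for x
        using that g h0[of x] by (cases "x \<in> K") auto
      moreover have "continuous_map X euclideanreal (\<lambda>x. h x * (1 - g x))"
        using ch cg by (intro continuous_map_real_mult continuous_map_diff) auto
      ultimately show ?thesis
        using h01 g01 by (auto simp: below_def mult_le_one)
    qed
    moreover have "\<Lambda> h = \<Lambda> (\<lambda>x. h x * g x) + \<Lambda> (\<lambda>x. h x * (1 - g x))"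
    proof -
      have "\<Lambda> (\<lambda>x. h x * g x) + \<Lambda> (\<lambda>x. h x * (1 - g x)) = \<Lambda> (\<lambda>x. h x * g x + h x * (1 - g x))"
        using ch cg
        by (intro add[symmetric] continuous_map_real_mult continuous_map_diff) auto
      also have "(\<lambda>x. h x * g x + h x * (1 - g x)) = h" by (simp add: fun_eq_iff algebra_simps)
      finally show ?thesis by simp
    qed
    ultimately have "ennreal (\<Lambda> h) \<le> weight U + weight V"
      using weight_upper nonneg
      by (smt (verit, del_insts) add_mono ennreal_leI ennreal_plus below_def mem_Collect_eq dual_order.trans order_refl)
    then have "ennreal (\<Lambda> h) + ennreal e \<le> weight U + weight V + ennreal e"
      by (rule add_right_mono)
    moreover have "ennreal (\<Lambda> f) \<le> ennreal (\<Lambda> h) + ennreal e"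
      using fh e h01 nonneg[OF ch] by (simp add: ennreal_plus[symmetric] ennreal_leI del: ennreal_plus)
    ultimately show "ennreal (\<Lambda> f) \<le> weight U + weight V + ennreal e" by (rule order_trans[rotated])
  qed
qed

text \<open>The support of the cutoff is compact, so it is covered by finitely many of the sets.\<close>

lemma weight_UN:
  assumes U: "\<And>n :: nat. openin X (U n)"
  shows "weight (\<Union>n. U n) \<le> (\<Sum>n. weight (U n))"
proof (rule weight_least)
  fix f assume f: "f \<in> below (\<Union>n. U n)"
  have fin: "weight (\<Union>n\<in>N. U n) \<le> (\<Sum>n\<in>N. weight (U n))" if "finite N" for N
    using that
  proof (induction N)
    case (insert n N)
    have "weight (\<Union>n\<in>insert n N. U n) \<le> weight (U n) + weight (\<Union>n\<in>N. U n)"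
      using weight_Un[OF U, of "\<Union>n\<in>N. U n" n] U by (auto simp: openin_Union)
    with insert show ?case by (auto intro: order_trans add_left_mono)
  qed (simp add: weight_empty)
  show "ennreal (\<Lambda> f) \<le> (\<Sum>n. weight (U n))"
  proof (rule ennreal_le_epsilon)
    fix e :: real assume e: "e > 0"
    define h where "h = (\<lambda>x. max 0 (f x - e))"
    define K where "K = {x \<in> topspace X. e \<le> f x}"
    have cf: "continuous_map X euclideanreal f" using f by (simp add: below_def)
    have h: "h \<in> below {x \<in> topspace X. e < f x}" and fh: "\<Lambda> f \<le> \<Lambda> h + e"
      unfolding h_def using cutoff[OF f, of e] e by auto
    have "compactin X K"
      using closedin_compact_space[OF compact closedin_superlevel[OF cf]] by (simp add: K_def)
    moreover have "K \<subseteq> \<Union>(range U)" using f e by (auto simp: K_def below_def)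
    ultimately obtain F where F: "finite F" "F \<subseteq> range U" "K \<subseteq> \<Union>F"
      using U unfolding compactin_def by (metis (no_types, lifting) imageE)
    then obtain N where N: "finite N" "F = U ` N"
      using finite_subset_image by metis
    have "h \<in> below (\<Union>n\<in>N. U n)"
      by (rule below_mono[OF h]) (use F N in \<open>auto simp: K_def\<close>)
    then have "ennreal (\<Lambda> h) \<le> (\<Sum>n\<in>N. weight (U n))"
      using weight_upper fin[OF N(1)] by (blast intro: order_trans)
    also have "\<dots> \<le> (\<Sum>n. weight (U n))"
      using N by (intro sum_le_suminf) auto
    finally have "ennreal (\<Lambda> h) + ennreal e \<le> (\<Sum>n. weight (U n)) + ennreal e"
      by (rule add_right_mono)
    moreover have "ennreal (\<Lambda> f) \<le> ennreal (\<Lambda> h) + ennreal e"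
      using fh e h nonneg[of h] by (simp add: below_def ennreal_plus[symmetric] ennreal_leI del: ennreal_plus)
    ultimately show "ennreal (\<Lambda> f) \<le> (\<Sum>n. weight (U n)) + ennreal e" by (rule order_trans[rotated])
  qed
qed

lemma outer_le: "openin X U \<Longrightarrow> A \<subseteq> U \<Longrightarrow> outer A \<le> weight U"
  unfolding outer_def by (rule INF_lower) auto

lemma outer_open:
  assumes "openin X U"
  shows "outer U = weight U"
proof (rule antisym)
  show "outer U \<le> weight U" by (rule outer_le[OF assms order_refl])
  show "weight U \<le> outer U"
    unfolding outer_def by (rule INF_greatest) (simp add: weight_mono)
qed

lemma outer_mono: "A \<subseteq> B \<Longrightarrow> outer A \<le> outer B"
  unfolding outer_def by (rule INF_superset_mono) auto

lemma outer_approx: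
  assumes "A \<subseteq> topspace X" "e > 0"
  obtains U where "openin X U" "A \<subseteq> U" "weight U \<le> outer A + ennreal e"
proof -
  have "outer A \<le> weight (topspace X)" using assms by (intro outer_le) auto
  then have "outer A < \<infinity>" by (simp add: weight_space) (metis ennreal_one_less_top le_less_trans)
  then have "outer A < outer A + ennreal e"
    using assms(2) by (cases "outer A") (auto simp: ennreal_plus[symmetric] ennreal_less_iff simp del: ennreal_plus)
  then obtain U where "openin X U" "A \<subseteq> U" "weight U < outer A + ennreal e"
    unfolding outer_def INF_less_iff by auto
  then show ?thesis using that by (auto simp: less_imp_le)
qed

lemma outer_measure_space_outer: "outer_measure_space (Pow (topspace X)) outer"
  unfolding outer_measure_space_def
proof (intro conjI)
  show "positive (Pow (topspace X)) outer"
    using outer_open[of "{}"] by (simp add: positive_def weight_empty)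
  show "increasing (Pow (topspace X)) outer"
    by (auto simp: increasing_def intro: outer_mono)
  show "countably_subadditive (Pow (topspace X)) outer"
    unfolding countably_subadditive_def
  proof safe
    fix A :: "nat \<Rightarrow> 'x set"
    assume A: "range A \<subseteq> Pow (topspace X)"
    show "outer (\<Union>i. A i) \<le> (\<Sum>i. outer (A i))"
    proof (rule ennreal_le_epsilon)
      fix e :: real assume e: "e > 0"
      have "\<exists>U. openin X U \<and> A n \<subseteq> U \<and> weight U \<le> outer (A n) + ennreal (e * (1/2) ^ Suc n)" for n
      proof -
        have "A n \<subseteq> topspace X" "0 < e * (1/2) ^ Suc n" using A e by auto
        then show ?thesis using outer_approx by metis
      qed
      then obtain U where U: "\<And>n. openin X (U n)" "\<And>n. A n \<subseteq> U n"
        "\<And>n. weight (U n) \<le> outer (A n) + ennreal (e * (1/2) ^ Suc n)" by metis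
      have "outer (\<Union>i. A i) \<le> weight (\<Union>n. U n)"
        using U by (intro outer_le) auto
      also have "\<dots> \<le> (\<Sum>n. weight (U n))" by (rule weight_UN[OF U(1)])
      also have "\<dots> \<le> (\<Sum>n. outer (A n) + ennreal (e * (1/2) ^ Suc n))"
        by (intro suminf_le U(3)) auto
      also have "\<dots> = (\<Sum>n. outer (A n)) + (\<Sum>n. ennreal (e * (1/2) ^ Suc n))"
        by (intro suminf_add[symmetric]) auto
      also have "(\<Sum>n. ennreal (e * (1/2) ^ Suc n)) = ennreal e"
        using sums_mult[OF power_half_series, of e] e
        by (intro suminf_ennreal_eq) auto
      finally show "outer (\<Union>i. A i) \<le> (\<Sum>i. outer (A i)) + ennreal e" .
    qed
  qed
qed

text \<open>The Caratheodory condition for an open set \<open>U\<close>. It suffices to split an open \<open>V\<close>: a function below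
  \<open>V \<inter> U\<close>, cut off so that its support \<open>K\<close> is a closed subset of \<open>V \<inter> U\<close>, can be added to any function
  below the open set \<open>V - K\<close>, which still covers \<open>V - U\<close>, without leaving \<open>below V\<close>.\<close>

lemma open_outer_split:
  assumes U: "openin X U" and A: "A \<subseteq> topspace X"
  shows "outer (A \<inter> U) + outer (A - U) \<le> outer A"
proof (rule ennreal_le_epsilon)
  fix e :: real assume e: "e > 0"
  obtain V where V: "openin X V" "A \<subseteq> V" "weight V \<le> outer A + ennreal e"
    using outer_approx[OF A e] by blast
  have "weight (V \<inter> U) + outer (V - U) \<le> weight V"
    unfolding weight_def[of "V \<inter> U"]
  proof (subst ennreal_SUP_add_left[symmetric])
    show "below (V \<inter> U) \<noteq> {}" using zero_below by blast
    show "(SUP f\<in>below (V \<inter> U). ennreal (\<Lambda> f) + outer (V - U)) \<le> weight V"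
    proof (rule SUP_least, rule ennreal_le_epsilon)
      fix f and d :: real assume f: "f \<in> below (V \<inter> U)" and d: "d > 0"
      define h where "h = (\<lambda>x. max 0 (f x - d))"
      define K where "K = {x \<in> topspace X. d \<le> f x}"
      have cf: "continuous_map X euclideanreal f" using f by (simp add: below_def)
      have h: "h \<in> below {x \<in> topspace X. d < f x}" and fh: "\<Lambda> f \<le> \<Lambda> h + d"
        unfolding h_def using cutoff[OF f, of d] d by auto
      have ch: "continuous_map X euclideanreal h" using h by (simp add: below_def)
      have K: "closedin X K" unfolding K_def by (rule closedin_superlevel[OF cf])
      have KV: "K \<subseteq> V \<inter> U" using f d by (auto simp: K_def below_def)
      have "outer (V - U) \<le> weight (V - K)"
        using K KV V by (intro outer_le openin_diff) auto
      then have "ennreal (\<Lambda> h) + outer (V - U) \<le> ennreal (\<Lambda> h) + weight (V - K)"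
        by (rule add_left_mono)
      also have "\<dots> \<le> weight V"
        unfolding weight_def[of "V - K"]
      proof (subst ennreal_SUP_add_right)
        show "below (V - K) \<noteq> {}" using zero_below by blast
        show "(SUP g\<in>below (V - K). ennreal (\<Lambda> h) + ennreal (\<Lambda> g)) \<le> weight V"
        proof (rule SUP_least)
          fix g assume g: "g \<in> below (V - K)"
          then have cg: "continuous_map X euclideanreal g" by (simp add: below_def)
          have "h x + g x \<le> 1 \<and> (x \<notin> V \<longrightarrow> h x + g x = 0)" if "x \<in> topspace X" for x
            using h g KV that by (cases "x \<in> K") (auto simp: below_def K_def)
          then have "(\<lambda>x. h x + g x) \<in> below V"
            using h g continuous_map_add[OF ch cg] by (auto simp: below_def)
          then show "ennreal (\<Lambda> h) + ennreal (\<Lambda> g) \<le> weight V"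
            using weight_upper[of "\<lambda>x. h x + g x" V] add[OF ch cg] nonneg[OF ch] nonneg[OF cg] h g
            by (auto simp: below_def ennreal_plus[symmetric] simp del: ennreal_plus)
        qed
      qed
      finally have "ennreal (\<Lambda> h) + outer (V - U) + ennreal d \<le> weight V + ennreal d"
        by (rule add_right_mono)
      moreover have "ennreal (\<Lambda> f) \<le> ennreal (\<Lambda> h) + ennreal d"
        using fh d h nonneg[OF ch] by (simp add: below_def ennreal_plus[symmetric] ennreal_leI del: ennreal_plus)
      then have "ennreal (\<Lambda> f) + outer (V - U) \<le> ennreal (\<Lambda> h) + ennreal d + outer (V - U)"
        by (rule add_right_mono)
      ultimately show "ennreal (\<Lambda> f) + outer (V - U) \<le> weight V + ennreal d"
        by (metis (no_types, lifting) add.commute add.left_commute order_trans)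
    qed
  qed
  moreover have "outer (A \<inter> U) \<le> weight (V \<inter> U)" using U V by (intro outer_le) auto
  moreover have "outer (A - U) \<le> outer (V - U)" using V by (intro outer_mono) auto
  ultimately show "outer (A \<inter> U) + outer (A - U) \<le> outer A + ennreal e"
    using V(3) by (meson add_mono order_trans)
qed

lemma measure_space_outer: "measure_space (topspace X) (sets (borel_of X)) outer"
proof -
  interpret sigma_algebra "topspace X" "Pow (topspace X)" by (rule sigma_algebra_Pow)
  define L where "L = lambda_system (topspace X) (Pow (topspace X)) outer"
  have ms: "measure_space (topspace X) L outer"
    unfolding L_def by (rule caratheodory_lemma[OF outer_measure_space_outer])
  then interpret L: sigma_algebra "topspace X" L by (simp add: measure_space_def)
  have "subadditive (Pow (topspace X)) outer"
    using outer_measure_space_outer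
    by (auto simp: outer_measure_space_def intro: countably_subadditive_subadditive)
  then have sub: "outer A \<le> outer (A \<inter> U) + outer (A - U)" if "A \<subseteq> topspace X" for A U
    using that unfolding subadditive_def
    by (metis Diff_subset Int_Diff_Un Int_Diff_disjoint PowI inf_le1 subset_trans)
  have "{U. openin X U} \<subseteq> L"
    using open_outer_split sub
    by (auto simp: L_def lambda_system_eq dest: openin_subset intro!: antisym)
  then have "sets (borel_of X) \<subseteq> L"
    unfolding sets_borel_of by (rule L.sigma_sets_subset)
  then show ?thesis
    by (intro measure_down[OF ms]) (metis sets.sigma_algebra_axioms space_borel_of)
qed

definition riesz_measure :: "'x measure"
  where "riesz_measure = measure_of (topspace X) (sets (borel_of X)) outer"

lemma sets_riesz_measure: "sets riesz_measure = sets (borel_of X)"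
  and space_riesz_measure: "space riesz_measure = topspace X"
  unfolding riesz_measure_def
  using sets.space_closed[of "borel_of X"] sets.sigma_sets_eq[of "borel_of X"]
  by (simp_all add: space_borel_of)

lemma emeasure_riesz_measure: "A \<in> sets (borel_of X) \<Longrightarrow> emeasure riesz_measure A = outer A"
  using measure_space_outer sets.space_closed[of "borel_of X"] sets.sigma_sets_eq[of "borel_of X"]
  unfolding riesz_measure_def measure_space_def
  by (intro emeasure_measure_of_sigma) (auto simp: space_borel_of)

lemma openin_sets: "openin X U \<Longrightarrow> U \<in> sets (borel_of X)"
  by (auto simp: sets_borel_of)

lemma emeasure_open: "openin X U \<Longrightarrow> emeasure riesz_measure U = weight U"
  by (simp add: emeasure_riesz_measure openin_sets outer_open)

lemma prob_space_riesz_measure: "prob_space riesz_measure"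
  by (rule prob_spaceI) (simp add: space_riesz_measure emeasure_open weight_space)

text \<open>Outer regularity holds by construction. In a compact space complements of open sets are compact, so inner
  regularity is outer regularity of the complement.\<close>

lemma regular_riesz_measure: "regular_borel_prob X riesz_measure"
proof -
  interpret prob_space riesz_measure by (rule prob_space_riesz_measure)
  have outer_reg: "emeasure riesz_measure A = (INF U\<in>{U. openin X U \<and> A \<subseteq> U}. emeasure riesz_measure U)"
    if "A \<in> sets (borel_of X)" for A
    using that by (auto simp: emeasure_riesz_measure outer_def emeasure_open intro!: INF_cong)
  have inner_reg: "emeasure riesz_measure A = (SUP C\<in>{C. compactin X C \<and> C \<subseteq> A}. emeasure riesz_measure C)"
    if A: "A \<in> sets (borel_of X)" for A
  proof (rule antisym)
    show "(SUP C\<in>{C. compactin X C \<and> C \<subseteq> A}. emeasure riesz_measure C) \<le> emeasure riesz_measure A"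
      using A by (intro SUP_least emeasure_mono) (auto simp: sets_riesz_measure)
    show "emeasure riesz_measure A \<le> (SUP C\<in>{C. compactin X C \<and> C \<subseteq> A}. emeasure riesz_measure C)"
    proof (rule ennreal_le_epsilon)
      fix e :: real assume e: "e > 0"
      have AX: "A \<subseteq> topspace X" using sets.sets_into_space[OF A] by (simp add: space_borel_of)
      obtain U where U: "openin X U" "topspace X - A \<subseteq> U" "weight U \<le> outer (topspace X - A) + ennreal e"
        using outer_approx[of "topspace X - A" e] e by auto
      have A': "topspace X - A \<in> sets (borel_of X)"
        using sets.compl_sets[OF A] by (simp add: space_borel_of)
      define C where "C = topspace X - U"
      have cl: "closedin X C" using U by (auto simp: C_def)
      then have C: "compactin X C" "C \<subseteq> A"
        using closedin_compact_space[OF compact] U by (auto simp: C_def)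
      have "measure riesz_measure U \<le> measure riesz_measure (topspace X - A) + e"
        using U(3) e emeasure_open[OF U(1)] emeasure_riesz_measure[OF A']
        by (simp add: emeasure_eq_measure[symmetric] flip: ennreal_le_iff)
      moreover have "measure riesz_measure (topspace X - A) = 1 - measure riesz_measure A"
        using prob_compl[of A] A by (simp add: sets_riesz_measure space_riesz_measure)
      moreover have "measure riesz_measure C = 1 - measure riesz_measure U"
        unfolding C_def using prob_compl[of U] openin_sets[OF U(1)]
        by (simp add: sets_riesz_measure space_riesz_measure)
      ultimately have "measure riesz_measure A \<le> measure riesz_measure C + e" by simp
      then have "emeasure riesz_measure A \<le> emeasure riesz_measure C + ennreal e"
        using e by (simp add: emeasure_eq_measure ennreal_plus[symmetric] ennreal_leI del: ennreal_plus)
      also have "emeasure riesz_measure C \<le> (SUP C\<in>{C. compactin X C \<and> C \<subseteq> A}. emeasure riesz_measure C)"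
        using C by (intro SUP_upper) auto
      finally show "emeasure riesz_measure A \<le>
          (SUP C\<in>{C. compactin X C \<and> C \<subseteq> A}. emeasure riesz_measure C) + ennreal e"
        by (auto intro: add_right_mono order_trans)
    qed
  qed
  show ?thesis
    unfolding regular_borel_prob_def
    using prob_space_riesz_measure outer_reg inner_reg
    by (simp add: sets_riesz_measure space_riesz_measure)
qed

end

text \<open>The functional is compared with the integral by slicing a function horizontally into \<open>n\<close> layers of equal height.
  The next two lemmas are the pointwise facts, for the scaled value \<open>t\<close> of the function: the layers
  add up to \<open>t\<close>, and the number of layers that are met exceeds \<open>t\<close> by at most \<open>1\<close>.\<close>

lemma sum_unit_steps:
  fixes t :: real
  assumes "t \<ge> 0"
  shows "(\<Sum>k<n. min 1 (max 0 (t - real k))) = min t (real n)"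
proof (induction n)
  case (Suc n)
  have "min t (real n) + min 1 (max 0 (t - real n)) = min t (real n + 1)" by auto
  with Suc show ?case by (simp add: add.commute)
qed (use assms in auto)

lemma sum_steps_le:
  fixes t :: real
  assumes "t \<ge> 0"
  shows "(\<Sum>k<n. if real k < t then 1 else 0) \<le> min (real n) (t + 1)"
proof (induction n)
  case (Suc n)
  then show ?case by (cases "real n < t") auto
qed (use assms in auto)

lemma continuous_map_borel_measurable:
  assumes "sets M = sets (borel_of X)" "continuous_map X euclideanreal f"
  shows "f \<in> borel_measurable M"
proof -
  have "f \<in> borel_of X \<rightarrow>\<^sub>M borel_of euclideanreal"
    by (rule continuous_map_measurable_borel_of[OF assms(2)])
  moreover have "borel_of euclideanreal = (borel :: real measure)"
    by (simp add: borel_of_def borel_def)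
  ultimately show ?thesis using measurable_cong_sets[OF assms(1) refl, of "borel :: real measure"] by simp
qed

lemma continuous_map_bounded:
  assumes "compact_space X" "continuous_map X euclideanreal f"
  obtains B where "B > 0" "\<And>x. x \<in> topspace X \<Longrightarrow> \<bar>f x\<bar> \<le> B"
proof -
  have "compactin euclideanreal (f ` topspace X)"
    using image_compactin[OF _ assms(2)] assms(1) by (simp add: compact_space_def)
  then have "bounded (f ` topspace X)" by (simp add: compact_imp_bounded)
  then show ?thesis using that by (auto simp: bounded_pos)
qed

lemma continuous_map_integrable:
  assumes "compact_space X" "continuous_map X euclideanreal f"
    and "prob_space M" "space M = topspace X" "sets M = sets (borel_of X)"
  shows "integrable M f"
proof -
  interpret prob_space M by fact
  obtain B where "\<And>x. x \<in> topspace X \<Longrightarrow> \<bar>f x\<bar> \<le> B"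
    using continuous_map_bounded[OF assms(1,2)] by blast
  then show ?thesis
    using continuous_map_borel_measurable[OF assms(5,2)] assms(4)
    by (intro integrable_const_bound[where B = B] AE_I2) auto
qed

context positive_functional
begin

lemma integrable_riesz_measure:
  "continuous_map X euclideanreal f \<Longrightarrow> integrable riesz_measure f"
  using compact prob_space_riesz_measure
  by (intro continuous_map_integrable) (simp_all add: space_riesz_measure sets_riesz_measure)

lemma sum:
  assumes "finite I" "\<And>i. i \<in> I \<Longrightarrow> continuous_map X euclideanreal (f i)"
  shows "\<Lambda> (\<lambda>x. \<Sum>i\<in>I. f i x) = (\<Sum>i\<in>I. \<Lambda> (f i))"
  using assms
proof (induction I)
  case (insert i I)
  then show ?case by (simp add: add continuous_map_sum)
qed (simp add: const)

lemma cong: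
  assumes "continuous_map X euclideanreal f" "continuous_map X euclideanreal g"
    and "\<And>x. x \<in> topspace X \<Longrightarrow> f x = g x"
  shows "\<Lambda> f = \<Lambda> g"
  using mono[of f g] mono[of g f] assms by (simp add: antisym)

text \<open>The \<open>k\<close>-th layer lies below the open set where it is positive, so \<open>\<Lambda>\<close> of it is at most the measure of this set.
  Summation gives the inequality up to an error of \<open>1 / n\<close>.\<close>

lemma le_integral_riesz_measure:
  assumes f: "continuous_map X euclideanreal f" and f01: "\<And>x. x \<in> topspace X \<Longrightarrow> 0 \<le> f x \<and> f x \<le> 1"
  shows "\<Lambda> f \<le> (\<integral>x. f x \<partial>riesz_measure)"
proof -
  interpret prob_space riesz_measure by (rule prob_space_riesz_measure)
  have main: "real n * \<Lambda> f \<le> real n * (\<integral>x. f x \<partial>riesz_measure) + 1" for n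
  proof -
    define s where "s = (\<lambda>k x. min 1 (max 0 (real n * f x - real k)))"
    define U where "U = (\<lambda>k. {x \<in> topspace X. real k < real n * f x})"
    have nf: "continuous_map X euclideanreal (\<lambda>x. real n * f x)"
      using f by (intro continuous_map_real_mult) auto
    have s: "continuous_map X euclideanreal (s k)" for k
      unfolding s_def using nf
      by (intro continuous_map_real_min continuous_map_real_max continuous_map_diff) auto
    have U: "openin X (U k)" for k
      unfolding U_def using openin_continuous_map_preimage[OF nf, of "{real k<..}"] by simp
    have "\<Lambda> (s k) \<le> prob (U k)" for k
    proof -
      have "s k \<in> below (U k)" using s[of k] by (auto simp: below_def s_def U_def)
      then have "ennreal (\<Lambda> (s k)) \<le> ennreal (prob (U k))"
        using weight_upper[of "s k" "U k"] emeasure_open[OF U] by (simp add: emeasure_eq_measure)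
      then show ?thesis by (simp add: ennreal_le_iff)
    qed
    then have le: "(\<Sum>k<n. \<Lambda> (s k)) \<le> (\<Sum>k<n. prob (U k))" by (rule sum_mono)
    have "real n * f x = (\<Sum>k<n. s k x)" if "x \<in> topspace X" for x
      using sum_unit_steps[of "real n * f x" n] f01[OF that] by (simp add: s_def mult_left_le)
    then have "\<Lambda> (\<lambda>x. real n * f x) = \<Lambda> (\<lambda>x. \<Sum>k<n. s k x)"
      using s by (intro cong nf continuous_map_sum) auto
    then have "real n * \<Lambda> f = (\<Sum>k<n. \<Lambda> (s k))"
      using s by (simp add: scale[OF f] sum)
    also note le
    also have "(\<Sum>k<n. prob (U k)) = (\<integral>x. (\<Sum>k<n. indicator (U k) x) \<partial>riesz_measure)"
      using openin_sets[OF U] by (subst Bochner_Integration.integral_sum)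
        (auto simp: sets_riesz_measure emeasure_eq_measure)
    also have "\<dots> \<le> (\<integral>x. real n * f x + 1 \<partial>riesz_measure)"
    proof (rule integral_mono)
      show "integrable riesz_measure (\<lambda>x. \<Sum>k<n. indicator (U k) x :: real)"
        using openin_sets[OF U] by (intro Bochner_Integration.integrable_sum)
          (auto simp: sets_riesz_measure emeasure_eq_measure)
      show "integrable riesz_measure (\<lambda>x. real n * f x + 1)"
        using integrable_riesz_measure[OF f] by simp
      fix x assume "x \<in> space riesz_measure"
      then have x: "x \<in> topspace X" by (simp add: space_riesz_measure)
      have "(\<Sum>k<n. indicator (U k) x :: real) = (\<Sum>k<n. if real k < real n * f x then 1 else 0)"
        using x by (intro sum.cong) (auto simp: U_def)
      also have "\<dots> \<le> real n * f x + 1"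
        using sum_steps_le[of "real n * f x" n] f01[OF x] by simp
      finally show "(\<Sum>k<n. indicator (U k) x :: real) \<le> real n * f x + 1" .
    qed
    also have "\<dots> = real n * (\<integral>x. f x \<partial>riesz_measure) + 1"
      using integrable_riesz_measure[OF f] prob_space by (simp add: space_riesz_measure)
    finally show ?thesis .
  qed
  show ?thesis
  proof (rule ccontr)
    assume "\<not> ?thesis"
    then obtain n where "1 < real n * (\<Lambda> f - (\<integral>x. f x \<partial>riesz_measure))"
      using reals_Archimedean3[of "\<Lambda> f - (\<integral>x. f x \<partial>riesz_measure)"] by auto
    with main[of n] show False by (simp add: algebra_simps)
  qed
qed

text \<open>The inequality for \<open>1 - g\<close> in place of \<open>g\<close> is the reverse inequality for \<open>g\<close>.\<close>

lemma integral_riesz_measure: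
  assumes f: "continuous_map X euclideanreal f"
  shows "(\<integral>x. f x \<partial>riesz_measure) = \<Lambda> f"
proof -
  interpret prob_space riesz_measure by (rule prob_space_riesz_measure)
  have unit: "(\<integral>x. g x \<partial>riesz_measure) = \<Lambda> g"
    if g: "continuous_map X euclideanreal g" "\<And>x. x \<in> topspace X \<Longrightarrow> 0 \<le> g x \<and> g x \<le> 1" for g
  proof (rule antisym)
    have "continuous_map X euclideanreal (\<lambda>x. 1 - g x)" using g by (intro continuous_map_diff) auto
    then have "\<Lambda> (\<lambda>x. 1 - g x) \<le> (\<integral>x. 1 - g x \<partial>riesz_measure)"
      using g(2) by (intro le_integral_riesz_measure) auto
    moreover have "\<Lambda> (\<lambda>x. 1 - g x) = 1 - \<Lambda> g" using diff[of "\<lambda>x. 1" g] g(1) one by simp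
    moreover have "(\<integral>x. 1 - g x \<partial>riesz_measure) = 1 - (\<integral>x. g x \<partial>riesz_measure)"
      using integrable_riesz_measure[OF g(1)] prob_space by (simp add: space_riesz_measure)
    ultimately show "(\<integral>x. g x \<partial>riesz_measure) \<le> \<Lambda> g" by simp
  qed (rule le_integral_riesz_measure[OF g])
  obtain B where B: "B > 0" "\<And>x. x \<in> topspace X \<Longrightarrow> \<bar>f x\<bar> \<le> B"
    using continuous_map_bounded[OF compact f] by blast
  define g where "g = (\<lambda>x. inverse (2 * B) * (f x + B))"
  have fB: "continuous_map X euclideanreal (\<lambda>x. f x + B)" using f by (intro continuous_map_add) auto
  then have g: "continuous_map X euclideanreal g"
    unfolding g_def by (intro continuous_map_real_mult) auto
  have "0 \<le> g x \<and> g x \<le> 1" if "x \<in> topspace X" for x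
    using B(1) B(2)[OF that] by (auto simp: g_def field_simps)
  from unit[OF g this] have "(\<integral>x. g x \<partial>riesz_measure) = \<Lambda> g" .
  moreover have "\<Lambda> g = inverse (2 * B) * (\<Lambda> f + B)"
    unfolding g_def scale[OF fB] using add[OF f, of "\<lambda>x. B"] const[of B] by simp
  moreover have "(\<integral>x. g x \<partial>riesz_measure) = inverse (2 * B) * ((\<integral>x. f x \<partial>riesz_measure) + B)"
    unfolding g_def using integrable_riesz_measure[OF f] prob_space by (simp add: space_riesz_measure)
  ultimately show ?thesis using B(1) by simp
qed

end

section \<open>The affine flow of probability measures\<close>

text \<open>The convention that a state vanishes at the functions that are not continuous is the one of
  \<open>integral_functional\<close>.\<close>

definition states :: "'x topology \<Rightarrow> ('x \<Rightarrow> real) real_product set"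
  where "states X = {\<Lambda>. positive_functional X (coord \<Lambda>) \<and>
    (\<forall>f. \<not> continuous_map X euclideanreal f \<longrightarrow> coord \<Lambda> f = 0)}"

theorem prob_measures_eq_states:
  assumes X: "compact_space X" "Hausdorff_space X"
  shows "prob_measures X = states X"
proof (intro subset_antisym subsetI)
  fix \<Lambda> assume "\<Lambda> \<in> prob_measures X"
  then obtain \<mu> where \<mu>: "prob_space \<mu>" "space \<mu> = topspace X" "sets \<mu> = sets (borel_of X)"
    and \<Lambda>: "\<Lambda> = integral_functional X \<mu>"
    by (auto simp: prob_measures_def regular_borel_prob_def)
  interpret prob_space \<mu> by fact
  note int = continuous_map_integrable[OF X(1) _ \<mu>]
  have c: "coord \<Lambda> f = (\<integral>x. f x \<partial>\<mu>)" if "continuous_map X euclideanreal f" for f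
    using that by (simp add: \<Lambda> integral_functional_def)
  have "positive_functional X (coord \<Lambda>)"
  proof
    fix f g assume fg: "continuous_map X euclideanreal f" "continuous_map X euclideanreal g"
    then show "coord \<Lambda> (\<lambda>x. f x + g x) = coord \<Lambda> f + coord \<Lambda> g"
      using int[OF fg(1)] int[OF fg(2)] by (simp add: c continuous_map_add)
  next
    fix k :: real and f assume "continuous_map X euclideanreal f"
    then show "coord \<Lambda> (\<lambda>x. k * f x) = k * coord \<Lambda> f"
      using continuous_map_real_mult_left[of X f k] by (simp add: c)
  next
    fix f assume "continuous_map X euclideanreal f" "\<And>x. x \<in> topspace X \<Longrightarrow> 0 \<le> f x"
    then show "0 \<le> coord \<Lambda> f" by (auto simp: c \<mu>(2) intro!: integral_nonneg_AE AE_I2)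
  next
    show "coord \<Lambda> (\<lambda>x. 1) = 1" using prob_space by (simp add: c)
  qed (use X in auto)
  then show "\<Lambda> \<in> states X" by (simp add: states_def \<Lambda> integral_functional_def)
next
  fix \<Lambda> assume \<Lambda>: "\<Lambda> \<in> states X"
  then interpret positive_functional X "coord \<Lambda>" by (simp add: states_def)
  have "\<Lambda> = integral_functional X riesz_measure"
    using \<Lambda> integral_riesz_measure
    by (auto simp: real_product_eq_iff integral_functional_def states_def)
  then show "\<Lambda> \<in> prob_measures X"
    using regular_riesz_measure by (auto simp: prob_measures_def)
qed

definition dirac :: "'x topology \<Rightarrow> 'x \<Rightarrow> ('x \<Rightarrow> real) real_product"
  where "dirac X x = of_coords (\<lambda>f. if continuous_map X euclideanreal f then f x else 0)"

lemma coord_dirac [simp]: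
  "coord (dirac X x) f = (if continuous_map X euclideanreal f then f x else 0)"
  by (simp add: dirac_def)

lemma statesD:
  assumes "\<Lambda> \<in> states X"
  shows "positive_functional X (coord \<Lambda>)" "\<not> continuous_map X euclideanreal f \<Longrightarrow> coord \<Lambda> f = 0"
  using assms by (simp_all add: states_def)

lemma dirac_in_states:
  assumes "compact_space X" "Hausdorff_space X" "x \<in> topspace X"
  shows "dirac X x \<in> states X"
proof -
  have "positive_functional X (coord (dirac X x))"
    by standard (use assms in \<open>auto simp: continuous_map_add continuous_map_real_mult\<close>)
  then show ?thesis by (simp add: states_def)
qed

text \<open>States are defined on functions on the whole type, but they depend only on the values on the space.\<close>

lemma states_cong:
  assumes \<Lambda>: "\<Lambda> \<in> states X" and eq: "\<And>x. x \<in> topspace X \<Longrightarrow> f x = g x"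
  shows "coord \<Lambda> f = coord \<Lambda> g"
proof -
  interpret positive_functional X "coord \<Lambda>" by (rule statesD(1)[OF \<Lambda>])
  have iff: "continuous_map X euclideanreal f \<longleftrightarrow> continuous_map X euclideanreal g"
    using eq continuous_map_eq by metis
  show ?thesis
  proof (cases "continuous_map X euclideanreal f")
    case True
    then show ?thesis using iff eq by (intro cong) auto
  next
    case False
    then show ?thesis using iff statesD(2)[OF \<Lambda>] by metis
  qed
qed

lemma convex_states: "convex (states X)"
  unfolding convex_def
proof (intro ballI allI impI)
  fix \<Lambda> \<Lambda>' and u v :: real
  assume st: "\<Lambda> \<in> states X" "\<Lambda>' \<in> states X" and uv: "0 \<le> u" "0 \<le> v" "u + v = 1"
  interpret A: positive_functional X "coord \<Lambda>" by (rule statesD(1)[OF st(1)])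
  interpret B: positive_functional X "coord \<Lambda>'" by (rule statesD(1)[OF st(2)])
  have "positive_functional X (coord (u *\<^sub>R \<Lambda> + v *\<^sub>R \<Lambda>'))"
    by standard (auto simp: A.compact A.Hausdorff A.add B.add A.scale B.scale A.one B.one uv
        algebra_simps intro!: add_nonneg_nonneg mult_nonneg_nonneg A.nonneg B.nonneg)
  then show "u *\<^sub>R \<Lambda> + v *\<^sub>R \<Lambda>' \<in> states X"
    using statesD(2) st by (simp add: states_def)
qed

lemma closed_states:
  assumes X: "compact_space X" "Hausdorff_space X"
  shows "closed (states X)"
proof -
  have "states X = {\<Lambda>. (\<forall>f\<in>Collect (continuous_map X euclideanreal). \<forall>g\<in>Collect (continuous_map X euclideanreal).
        coord \<Lambda> (\<lambda>x. f x + g x) = coord \<Lambda> f + coord \<Lambda> g) \<and>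
      (\<forall>c. \<forall>f\<in>Collect (continuous_map X euclideanreal). coord \<Lambda> (\<lambda>x. c * f x) = c * coord \<Lambda> f) \<and>
      (\<forall>f\<in>{f. continuous_map X euclideanreal f \<and> (\<forall>x\<in>topspace X. 0 \<le> f x)}. 0 \<le> coord \<Lambda> f) \<and>
      coord \<Lambda> (\<lambda>x. 1) = 1 \<and>
      (\<forall>f\<in>{f. \<not> continuous_map X euclideanreal f}. coord \<Lambda> f = 0)}"
    using X by (auto simp: states_def positive_functional_def)
  also have "closed \<dots>"
    unfolding Ball_def
    by (intro closed_Collect_conj closed_Collect_all closed_Collect_imp closed_Collect_eq
        closed_Collect_le continuous_on_coord continuous_on_add continuous_on_mult continuous_on_const)
      simp_all
  finally show ?thesis .
qed

lemma compact_states: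
  assumes X: "compact_space X" "Hausdorff_space X"
  shows "compact (states X)"
proof -
  have "\<forall>f. \<exists>B. continuous_map X euclideanreal f \<longrightarrow> (\<forall>x\<in>topspace X. \<bar>f x\<bar> \<le> B)"
    using continuous_map_bounded[OF X(1)] by metis
  then obtain B where B: "\<And>f x. continuous_map X euclideanreal f \<Longrightarrow> x \<in> topspace X \<Longrightarrow> \<bar>f x\<bar> \<le> B f"
    by metis
  define S where "S = (\<lambda>f. if continuous_map X euclideanreal f then {- B f..B f} else {0})"
  have "compact (S f)" for f by (simp add: S_def)
  then have c: "compact {\<Lambda>. \<forall>f. coord \<Lambda> f \<in> S f}" by (rule compact_coordinatewise)
  have "coord \<Lambda> f \<in> S f" if "\<Lambda> \<in> states X" for \<Lambda> f
  proof (cases "continuous_map X euclideanreal f")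
    case True
    interpret positive_functional X "coord \<Lambda>" by (rule statesD(1)[OF that])
    have "coord \<Lambda> (\<lambda>x. - B f) \<le> coord \<Lambda> f" "coord \<Lambda> f \<le> coord \<Lambda> (\<lambda>x. B f)"
      using B[OF True] True by (force intro!: mono simp: abs_le_iff)+
    then show ?thesis using True by (simp add: S_def const)
  qed (use statesD(2)[OF that] in \<open>simp add: S_def\<close>)
  then show ?thesis by (intro compact_closed_subset[OF c closed_states[OF X]]) auto
qed

text \<open>A state outside the closed convex hull of the point evaluations is separated from them by a linear combination
  of coordinates. This combination is evaluation at one continuous function \<open>f\<close>, so the state has at \<open>f\<close> a value below
  the minimum of \<open>f\<close>, contrary to positivity.\<close>

theorem states_eq_closed_hull_dirac:
  assumes X: "compact_space X" "Hausdorff_space X" and ne: "topspace X \<noteq> {}"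
  shows "states X = closure (convex hull (dirac X ` topspace X))"
proof (rule antisym)
  define C where "C = closure (convex hull (dirac X ` topspace X))"
  have CS: "C \<subseteq> states X"
    unfolding C_def using dirac_in_states[OF X]
    by (intro closure_minimal hull_minimal closed_states X convex_states) auto
  then show "closure (convex hull (dirac X ` topspace X)) \<subseteq> states X" by (simp add: C_def)
  have DC: "dirac X x \<in> C" if "x \<in> topspace X" for x
    unfolding C_def using that by (intro subsetD[OF closure_subset] hull_inc) simp
  have "compact C" using compact_closed_subset[OF compact_states[OF X] _ CS] by (simp add: C_def)
  moreover have "convex C" by (simp add: C_def convex_closure_locally_convex)
  moreover have "C \<noteq> {}" using DC ne by blast
  ultimately have C: "compact C" "convex C" "C \<noteq> {}" .
  show "states X \<subseteq> closure (convex hull (dirac X ` topspace X))"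
  proof (rule ccontr)
    assume "\<not> ?thesis"
    then obtain z where z: "z \<in> states X" "z \<notin> C" by (auto simp: C_def)
    define F where "F = (\<lambda>f \<Lambda>. coord \<Lambda> f) ` Collect (continuous_map X euclideanreal)"
    have "\<exists>p\<in>F. p c \<noteq> p z" if "c \<in> C" for c
    proof -
      have "c \<noteq> z" using that z by auto
      then obtain f where f: "coord c f \<noteq> coord z f" by (auto simp: real_product_eq_iff)
      then have "continuous_map X euclideanreal f"
        using statesD(2)[OF z(1), of f] statesD(2)[OF subsetD[OF CS that], of f] by force
      then show ?thesis using f by (auto simp: F_def)
    qed
    moreover have "linear p" "continuous_on UNIV p" if "p \<in> F" for p
      using that by (auto simp: F_def linear_coord continuous_on_coord)
    ultimately obtain I a where I: "finite I" "I \<subseteq> F"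
      and less: "\<And>c. c \<in> C \<Longrightarrow> (\<Sum>p\<in>I. a p * p z) < (\<Sum>p\<in>I. a p * p c)"
      using separate_point_compact_convex[OF C, of F z] by blast
    have "\<forall>p\<in>I. \<exists>f. continuous_map X euclideanreal f \<and> p = (\<lambda>\<Lambda>. coord \<Lambda> f)"
      using I(2) by (auto simp: F_def)
    then obtain k where k: "\<And>p. p \<in> I \<Longrightarrow> continuous_map X euclideanreal (k p)"
      "\<And>p. p \<in> I \<Longrightarrow> p = (\<lambda>\<Lambda>. coord \<Lambda> (k p))" by metis
    define f where "f = (\<lambda>x. \<Sum>p\<in>I. a p * k p x)"
    have ak: "continuous_map X euclideanreal (\<lambda>x. a p * k p x)" if "p \<in> I" for p
      using k(1)[OF that] by (rule continuous_map_real_mult_left)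
    have cf: "continuous_map X euclideanreal f"
      unfolding f_def using I(1) ak by (rule continuous_map_sum)
    have f: "coord \<Lambda> f = (\<Sum>p\<in>I. a p * p \<Lambda>)" if "\<Lambda> \<in> states X" for \<Lambda>
    proof -
      interpret positive_functional X "coord \<Lambda>" by (rule statesD(1)[OF that])
      have "coord \<Lambda> f = (\<Sum>p\<in>I. a p * coord \<Lambda> (k p))"
        unfolding f_def using I(1) ak k(1) by (simp add: sum scale)
      also have "\<dots> = (\<Sum>p\<in>I. a p * p \<Lambda>)" by (intro sum.cong refl) (metis k(2))
      finally show ?thesis .
    qed
    have "compactin euclideanreal (f ` topspace X)"
      using image_compactin[OF _ cf] X(1) by (simp add: compact_space_def)
    then obtain x where x: "x \<in> topspace X" "\<And>y. y \<in> topspace X \<Longrightarrow> f x \<le> f y"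
      using compact_attains_inf[of "f ` topspace X"] ne by auto
    interpret positive_functional X "coord z" by (rule statesD(1)[OF z(1)])
    have "f x \<le> coord z f"
      using mono[of "\<lambda>_. f x" f] cf x(2) const[of "f x"] by simp
    moreover have "coord z f < coord (dirac X x) f"
      using less[OF DC[OF x(1)]] f[OF z(1)] f[OF dirac_in_states[OF X x(1)]] by simp
    ultimately show False using cf by simp
  qed
qed

lemma continuous_map_action_iff:
  assumes X: "continuous_action \<alpha> X"
  shows "continuous_map X euclideanreal (\<lambda>x. f (\<alpha> g x)) \<longleftrightarrow> continuous_map X euclideanreal f"
proof
  assume "continuous_map X euclideanreal f"
  then show "continuous_map X euclideanreal (\<lambda>x. f (\<alpha> g x))"
    using continuous_map_compose[OF continuous_map_action[OF X]] by (simp add: o_def)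
next
  assume "continuous_map X euclideanreal (\<lambda>x. f (\<alpha> g x))"
  from continuous_map_compose[OF continuous_map_action[OF X, of "- g"] this]
  have *: "continuous_map X euclideanreal (\<lambda>x. f (\<alpha> g (\<alpha> (- g) x)))" by (simp add: o_def)
  have "\<alpha> g (\<alpha> (- g) x) = x" if "x \<in> topspace X" for x
  proof -
    have "\<alpha> (g + - g) x = \<alpha> g (\<alpha> (- g) x)" "\<alpha> 0 x = x"
      using X that unfolding continuous_action_def by blast+
    then show ?thesis by simp
  qed
  then show "continuous_map X euclideanreal f"
    by (intro continuous_map_eq[OF *]) simp
qed

lemma coord_pushforward_action [simp]:
  "coord (pushforward_action \<alpha> g \<Lambda>) f = coord \<Lambda> (\<lambda>x. f (\<alpha> g x))"
  by (simp add: pushforward_action_def)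

lemma pushforward_dirac:
  assumes "continuous_action \<alpha> X"
  shows "pushforward_action \<alpha> g (dirac X x) = dirac X (\<alpha> g x)"
  by (simp add: real_product_eq_iff continuous_map_action_iff[OF assms])

text \<open>Joint continuity of the action and compactness of \<open>X\<close> (the tube lemma) give continuity in \<open>g\<close> that is uniform in
  the point. It is what makes the action on measures jointly continuous.\<close>

lemma action_equicontinuous:
  assumes X: "compact_space X" and act: "continuous_action \<alpha> X"
    and f: "continuous_map X euclideanreal f" and e: "e > (0::real)"
  obtains U where "open U" "g0 \<in> U"
    "\<And>g x. g \<in> U \<Longrightarrow> x \<in> topspace X \<Longrightarrow> \<bar>f (\<alpha> g x) - f (\<alpha> g0 x)\<bar> < e"
proof -
  let ?P = "prod_topology euclidean X"
  have "continuous_map ?P euclideanreal (f \<circ> (\<lambda>(g, x). \<alpha> g x))"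
    using act f unfolding continuous_action_def by (blast intro: continuous_map_compose)
  moreover have "continuous_map ?P euclideanreal ((\<lambda>x. f (\<alpha> g0 x)) \<circ> snd)"
    using f continuous_map_action_iff[OF act] by (intro continuous_map_compose[OF continuous_map_snd]) blast
  ultimately have c: "continuous_map ?P euclideanreal (\<lambda>q. f (\<alpha> (fst q) (snd q)) - f (\<alpha> g0 (snd q)))"
    using continuous_map_diff[of ?P "f \<circ> (\<lambda>(g, x). \<alpha> g x)" "(\<lambda>x. f (\<alpha> g0 x)) \<circ> snd"]
    by (simp add: o_def case_prod_beta)
  define W where "W = {q \<in> topspace ?P. f (\<alpha> (fst q) (snd q)) - f (\<alpha> g0 (snd q)) \<in> {- e<..<e}}"
  have W: "openin ?P W"
    unfolding W_def by (rule openin_continuous_map_preimage[OF c]) simp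
  have sub: "{g0} \<times> topspace X \<subseteq> W" using e by (auto simp: W_def)
  have cpt: "compactin euclidean {g0}" "compactin X (topspace X)"
    using X by (simp_all add: compact_space_def)
  obtain U V where U: "openin euclidean U" "{g0} \<subseteq> U" "topspace X \<subseteq> V" "U \<times> V \<subseteq> W"
    by (rule Wallace_theorem_prod_topology[OF cpt W sub])
  show ?thesis
  proof (rule that)
    show "open U" "g0 \<in> U" using U by auto
    show "\<bar>f (\<alpha> g x) - f (\<alpha> g0 x)\<bar> < e" if "g \<in> U" "x \<in> topspace X" for g x
      using subsetD[OF U(4), of "(g, x)"] subsetD[OF U(3)] that by (auto simp: abs_less_iff W_def)
  qed
qed

text \<open>For joint continuity at a coordinate \<open>f\<close>: replacing \<open>g\<close> by a nearby \<open>g0\<close> changes \<open>f (\<alpha> g x)\<close> uniformly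
  little, hence every state changes little at it, and for fixed \<open>g0\<close> the value is a coordinate.\<close>

theorem affine_flow_prob_measures:
  fixes \<alpha> :: "'g::{group_add, topological_space} \<Rightarrow> 'x \<Rightarrow> 'x"
  assumes fl: "flow \<alpha> X"
  shows "affine_flow (pushforward_action \<alpha>) (prob_measures X)"
proof -
  have X: "compact_space X" "Hausdorff_space X" and ne: "topspace X \<noteq> {}" and act: "continuous_action \<alpha> X"
    using fl by (auto simp: flow_def)
  have act': "\<alpha> 0 x = x" "\<alpha> (g + h) x = \<alpha> g (\<alpha> h x)" if "x \<in> topspace X" for g h x
    using act that by (auto simp: continuous_action_def)
  have maps: "\<alpha> g x \<in> topspace X" if "x \<in> topspace X" for g x
    using continuous_map_action[OF act, of g] that by (auto simp: continuous_map_def)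
  note iff = continuous_map_action_iff[OF act]
  have push: "pushforward_action \<alpha> g \<Lambda> \<in> states X" if \<Lambda>: "\<Lambda> \<in> states X" for g \<Lambda>
  proof -
    interpret positive_functional X "coord \<Lambda>" by (rule statesD(1)[OF \<Lambda>])
    have "positive_functional X (coord (pushforward_action \<alpha> g \<Lambda>))"
      by standard (auto simp: X iff add scale one maps intro!: nonneg)
    then show ?thesis using statesD(2)[OF \<Lambda>] by (simp add: states_def iff)
  qed
  have "continuous_on (UNIV \<times> states X) (\<lambda>q. coord (pushforward_action \<alpha> (fst q) (snd q)) f)" for f
  proof (cases "continuous_map X euclideanreal f")
    case False
    have "continuous_on (UNIV \<times> states X) (\<lambda>q :: 'g \<times> _. 0 :: real)" by (rule continuous_on_const)
    then show ?thesis
    proof (rule continuous_on_eq)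
      fix q :: "'g \<times> ('x \<Rightarrow> real) real_product" assume "q \<in> UNIV \<times> states X"
      moreover have "\<not> continuous_map X euclideanreal (\<lambda>x. f (\<alpha> (fst q) x))" using False iff by blast
      ultimately show "0 = coord (pushforward_action \<alpha> (fst q) (snd q)) f"
        using statesD(2)[of "snd q" X] by auto
    qed
  next
    case True
    show ?thesis
      unfolding continuous_on_def
    proof (safe, rule tendstoI)
      fix g0 :: 'g and \<Lambda>0 and e :: real assume \<Lambda>0: "\<Lambda>0 \<in> states X" and e: "e > 0"
      let ?F = "at (g0, \<Lambda>0) within UNIV \<times> states X"
      have e2: "e / 2 > 0" using e by simp
      obtain U where U: "open U" "g0 \<in> U"
        "\<And>g x. g \<in> U \<Longrightarrow> x \<in> topspace X \<Longrightarrow> \<bar>f (\<alpha> g x) - f (\<alpha> g0 x)\<bar> < e / 2"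
        using action_equicontinuous[where ?g0.0 = g0, OF X(1) act True e2] by blast
      have "(fst \<longlongrightarrow> g0) ?F" using tendsto_fst[OF tendsto_ident_at, of "(g0, \<Lambda>0)"] by simp
      then have ev1: "eventually (\<lambda>q. fst q \<in> U) ?F" using U(1,2) by (auto dest: topological_tendstoD)
      have "continuous_on UNIV (\<lambda>q :: 'g \<times> _. coord (snd q) (\<lambda>x. f (\<alpha> g0 x)))"
        by (rule continuous_on_compose2[OF continuous_on_coord[of UNIV] continuous_on_snd[OF continuous_on_id]]) auto
      then have "((\<lambda>q. coord (snd q) (\<lambda>x. f (\<alpha> g0 x))) \<longlongrightarrow> coord \<Lambda>0 (\<lambda>x. f (\<alpha> g0 x))) ?F"
        unfolding continuous_on_def by (metis UNIV_I snd_conv tendsto_within_subset top_greatest)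
      then have ev2: "eventually (\<lambda>q. dist (coord (snd q) (\<lambda>x. f (\<alpha> g0 x))) (coord \<Lambda>0 (\<lambda>x. f (\<alpha> g0 x))) < e / 2) ?F"
        using e by (intro tendstoD) auto
      have ev3: "eventually (\<lambda>q. q \<in> UNIV \<times> states X) ?F"
        by (simp add: eventually_at_filter)
      show "eventually (\<lambda>q. dist (coord (pushforward_action \<alpha> (fst q) (snd q)) f)
          (coord (pushforward_action \<alpha> (fst (g0, \<Lambda>0)) (snd (g0, \<Lambda>0))) f) < e) ?F"
        using ev1 ev2 ev3
      proof eventually_elim
        case (elim q)
        define g \<Lambda> where "g = fst q" and "\<Lambda> = snd q"
        have g: "g \<in> U" and \<Lambda>: "\<Lambda> \<in> states X"
          and d: "dist (coord \<Lambda> (\<lambda>x. f (\<alpha> g0 x))) (coord \<Lambda>0 (\<lambda>x. f (\<alpha> g0 x))) < e / 2"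
          using elim by (auto simp: g_def \<Lambda>_def)
        interpret positive_functional X "coord \<Lambda>" by (rule statesD(1)[OF \<Lambda>])
        have c: "continuous_map X euclideanreal (\<lambda>x. f (\<alpha> g x))" for g using True iff by blast
        have cc: "continuous_map X euclideanreal (\<lambda>x. f (\<alpha> g x) - f (\<alpha> g0 x))"
          by (intro continuous_map_diff c)
        have small: "f (\<alpha> g x) - f (\<alpha> g0 x) \<le> e / 2" "- (e / 2) \<le> f (\<alpha> g x) - f (\<alpha> g0 x)"
          if "x \<in> topspace X" for x
          using U(3)[OF g that] by linarith+
        have "coord \<Lambda> (\<lambda>x. f (\<alpha> g x) - f (\<alpha> g0 x)) \<le> coord \<Lambda> (\<lambda>x. e / 2)"
          by (rule mono[OF cc _ small(1)]) simp_all
        moreover have "coord \<Lambda> (\<lambda>x. - (e / 2)) \<le> coord \<Lambda> (\<lambda>x. f (\<alpha> g x) - f (\<alpha> g0 x))"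
          by (rule mono[OF _ cc small(2)]) simp_all
        ultimately have "\<bar>coord \<Lambda> (\<lambda>x. f (\<alpha> g x)) - coord \<Lambda> (\<lambda>x. f (\<alpha> g0 x))\<bar> \<le> e / 2"
          by (simp only: const diff[OF c c] abs_le_iff) simp
        with d have "dist (coord \<Lambda> (\<lambda>x. f (\<alpha> g x))) (coord \<Lambda>0 (\<lambda>x. f (\<alpha> g0 x))) < e"
          unfolding dist_real_def by linarith
        then show ?case by (simp add: g_def \<Lambda>_def)
      qed
    qed
  qed
  then have cont: "continuous_on (UNIV \<times> states X) (\<lambda>(g, \<Lambda>). pushforward_action \<alpha> g \<Lambda>)"
    unfolding continuous_on_real_product_iff case_prod_beta by blast
  have ne': "states X \<noteq> {}" using dirac_in_states[OF X] ne by blast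
  have "pushforward_action \<alpha> 0 \<Lambda> = \<Lambda>" if "\<Lambda> \<in> states X" for \<Lambda>
    unfolding real_product_eq_iff coord_pushforward_action
    by (intro allI states_cong[OF that]) (simp add: act')
  moreover have "pushforward_action \<alpha> (g + h) \<Lambda> = pushforward_action \<alpha> g (pushforward_action \<alpha> h \<Lambda>)"
    if "\<Lambda> \<in> states X" for g h \<Lambda>
    unfolding real_product_eq_iff coord_pushforward_action
    by (intro allI states_cong[OF that]) (simp add: act')
  ultimately have "affine_flow (pushforward_action \<alpha>) (states X)"
    unfolding affine_flow_def continuous_action_top_of_set
    using ne' compact_states[OF X] convex_states[of X] push cont
    by (auto simp: affine_map_on_def real_product_eq_iff)
  then show ?thesis by (simp add: prob_measures_eq_states[OF X])
qed

section \<open>The barycenter map\<close>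

text \<open>In a product of lines the barycenter of a measure is computed coordinate by coordinate.\<close>

definition barycenter :: "('i real_product \<Rightarrow> real) real_product \<Rightarrow> 'i real_product"
  where "barycenter \<Lambda> = of_coords (\<lambda>i. coord \<Lambda> (\<lambda>x. coord x i))"

lemma coord_barycenter [simp]: "coord (barycenter \<Lambda>) i = coord \<Lambda> (\<lambda>x. coord x i)"
  by (simp add: barycenter_def)

lemma linear_barycenter: "linear barycenter"
  by (simp add: linear_iff real_product_eq_iff)

lemma continuous_barycenter: "continuous_on A barycenter"
  unfolding continuous_on_real_product_iff by (simp add: continuous_on_coord)

lemma barycenter_dirac: "barycenter (dirac (top_of_set S) x) = x"
  by (simp add: real_product_eq_iff continuous_on_coord)

lemma flow_ext_closure:
  assumes M: "affine_flow \<alpha> M"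
  shows "flow \<alpha> (top_of_set (ext_closure M))"
proof -
  have sub: "ext_closure M \<subseteq> M" by (rule ext_closure_subset[OF affine_flowD(2)[OF M]])
  have "compact (ext_closure M)"
    using compact_closed_subset[OF affine_flowD(2)[OF M] _ sub] by (simp add: ext_closure_def)
  moreover have "continuous_on (UNIV \<times> ext_closure M) (\<lambda>(g, x). \<alpha> g x)"
    by (rule continuous_on_subset[OF affine_flowD(8)[OF M] Sigma_mono[OF order_refl sub]])
  moreover have "Hausdorff_space (top_of_set (ext_closure M))"
    by (intro Hausdorff_space_subtopology) (auto simp: Hausdorff_space_def disjnt_def dest!: hausdorff)
  ultimately show ?thesis
    unfolding flow_def continuous_action_top_of_set
    using ext_closure_nonempty[OF M] affine_flow_ext_closure[OF M] affine_flowD(6,7)[OF M] sub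
    by (auto simp: compact_space_subtopology)
qed

text \<open>By Milman's theorem the extreme points of \<open>P(X)\<close> are among the point masses, which form a compact set, and the
  barycenter map sends the point mass at \<open>y\<close> to \<open>y\<close>. So the sets that \<open>C\<close> has to meet are single point masses, and
  these generate \<open>P(X)\<close>.\<close>

theorem prox_irreducible_extension_barycenter:
  fixes \<alpha> :: "'g::{group_add, topological_space} \<Rightarrow> 'i real_product \<Rightarrow> 'i real_product"
  assumes M: "affine_flow \<alpha> M"
  defines "X \<equiv> top_of_set (ext_closure M)"
  shows "prox_irreducible_extension (pushforward_action \<alpha>) (prob_measures X) \<alpha> M barycenter"
proof -
  let ?P = "prob_measures X"
  have fl: "flow \<alpha> X" unfolding X_def by (rule flow_ext_closure[OF M])
  then have X: "compact_space X" "Hausdorff_space X" "topspace X \<noteq> {}" and act: "continuous_action \<alpha> X"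
    by (auto simp: flow_def)
  have top: "topspace X = ext_closure M" by (simp add: X_def)
  have P: "affine_flow (pushforward_action \<alpha>) ?P" by (rule affine_flow_prob_measures[OF fl])
  note cP = affine_flowD(2)[OF P]
  have gen: "?P = closure (convex hull (dirac X ` ext_closure M))"
    using states_eq_closed_hull_dirac[OF X] prob_measures_eq_states[OF X(1,2)] top by simp
  have b: "barycenter (dirac X x) = x" for x by (simp add: X_def barycenter_dirac)
  have bc: "continuous_on A barycenter" "affine_map_on A barycenter" for A :: "('i real_product \<Rightarrow> real) real_product set"
    by (simp_all add: continuous_barycenter linear_imp_affine_map_on linear_barycenter)
  have sub: "ext_closure M \<subseteq> M" by (rule ext_closure_subset[OF affine_flowD(2)[OF M]])
  have "M \<subseteq> closure (convex hull (ext_closure M))"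
    by (subst (1) Krein_Milman_locally_convex[OF affine_flowD(2,3)[OF M]])
       (intro closure_mono hull_mono, simp add: ext_closure_def closure_subset)
  moreover have "closure (convex hull (ext_closure M)) \<subseteq> M"
    using sub affine_flowD(2,3)[OF M] by (intro closure_minimal hull_minimal compact_imp_closed)
  moreover have "barycenter ` ?P = closure (convex hull (ext_closure M))"
    using affine_image_closed_convex_hull[OF cP gen bc] by (simp add: image_image b)
  ultimately have im: "barycenter ` ?P = M" by simp
  have DP: "dirac X x \<in> ?P" if "x \<in> ext_closure M" for x
    unfolding gen using that by (intro subsetD[OF closure_subset] hull_inc) simp
  have "barycenter (pushforward_action \<alpha> g \<Lambda>) = \<alpha> g (barycenter \<Lambda>)" if "\<Lambda> \<in> ?P" for g \<Lambda>
  proof (rule affine_map_eq_on_closed_convex_hull[OF gen _ _ _ _ _ that])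
    show "continuous_on ?P (\<lambda>\<Lambda>. barycenter (pushforward_action \<alpha> g \<Lambda>))"
      by (rule continuous_on_compose2[OF bc(1)[of UNIV] affine_flow_continuous[OF P]]) simp
    show "affine_map_on ?P (\<lambda>\<Lambda>. barycenter (pushforward_action \<alpha> g \<Lambda>))"
      by (rule affine_map_on_compose[OF affine_flowD(4)[OF P] bc(2)[of UNIV]]) simp
    show "continuous_on ?P (\<lambda>\<Lambda>. \<alpha> g (barycenter \<Lambda>))"
      by (rule continuous_on_compose2[OF affine_flow_continuous[OF M] bc(1)]) (simp add: im)
    show "affine_map_on ?P (\<lambda>\<Lambda>. \<alpha> g (barycenter \<Lambda>))"
      by (rule affine_map_on_compose[OF bc(2) affine_flowD(4)[OF M]]) (simp add: im)
  qed (auto simp: pushforward_dirac[OF act] b)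
  then have ext: "affine_extension (pushforward_action \<alpha>) ?P \<alpha> M barycenter"
    using P M bc im by (simp add: affine_extension_def)
  have "continuous_on (ext_closure M) (dirac X)"
    unfolding continuous_on_real_product_iff
  proof
    show "continuous_on (ext_closure M) (\<lambda>x. coord (dirac X x) f)" for f
      by (cases "continuous_map X euclideanreal f") (simp_all add: X_def continuous_on_const)
  qed
  moreover have "compact (ext_closure M)"
    using compact_closed_subset[OF affine_flowD(2)[OF M] _ sub] by (simp add: ext_closure_def)
  ultimately have cD: "compact (dirac X ` ext_closure M)" by (rule compact_continuous_image)
  have "{\<Lambda>. \<Lambda> extreme_point_of ?P} \<subseteq> dirac X ` ext_closure M"
    using Milman_locally_convex[OF cD cP gen] by blast
  then have extP: "ext_closure ?P \<subseteq> dirac X ` ext_closure M"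
    unfolding ext_closure_def[of ?P] by (rule closure_minimal[OF _ compact_imp_closed[OF cD]])
  show ?thesis
    unfolding prox_irreducible_extension_def
  proof (intro conjI allI impI ext)
    fix C assume "affine_subflow (pushforward_action \<alpha>) ?P C \<and>
      (\<forall>y\<in>ext_closure M. C \<inter> convex hull (ext_closure ?P \<inter> barycenter -` {y}) \<noteq> {})"
    then have C: "C \<subseteq> ?P" "closed C" "convex C"
      and meet: "\<And>y. y \<in> ext_closure M \<Longrightarrow> C \<inter> convex hull (ext_closure ?P \<inter> barycenter -` {y}) \<noteq> {}"
      by (auto simp: affine_subflow_def)
    have "dirac X y \<in> C" if "y \<in> ext_closure M" for y
    proof -
      have "ext_closure ?P \<inter> barycenter -` {y} \<subseteq> {dirac X y}" using extP b by auto
      then have "convex hull (ext_closure ?P \<inter> barycenter -` {y}) \<subseteq> {dirac X y}"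
        by (rule hull_minimal) simp
      then show ?thesis using meet[OF that] by blast
    qed
    then have "?P \<subseteq> C" unfolding gen using C by (intro closure_minimal hull_minimal) auto
    with C(1) show "C = ?P" by blast
  qed
qed

section \<open>Extensions as sets of functions\<close>

definition shift :: "'g::group_add \<Rightarrow> ('g \<times> 'l \<Rightarrow> real) \<Rightarrow> 'g \<times> 'l \<Rightarrow> real"
  where "shift g h = (\<lambda>(k, y). h (g + k, y))"

text \<open>All extensions live in one space and carry the same action. Likewise the factor maps between them are instances
  of one family of maps, \<open>restrict_coords E\<close>.\<close>

definition translate :: "'g::group_add \<Rightarrow> ('g, 'l) extension_space \<Rightarrow> ('g, 'l) extension_space"
  where "translate g x = of_coords (\<lambda>h. coord x (shift g h))"

definition restrict_coords :: "'i set \<Rightarrow> 'i real_product \<Rightarrow> 'i real_product"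
  where "restrict_coords E x = of_coords (\<lambda>h. if h \<in> E then coord x h else 0)"

text \<open>Coordinates outside \<open>E\<close> are set to \<open>0\<close>, so that the product of lines indexed by \<open>E\<close> becomes a subset of
  \<open>extension_space\<close>.\<close>

definition evaluation :: "('g \<times> 'l \<Rightarrow> real) set \<Rightarrow> 'g \<times> 'l \<Rightarrow> ('g, 'l) extension_space"
  where "evaluation E p = of_coords (\<lambda>h. if h \<in> E then h p else 0)"

definition evaluation_hull :: "('g \<times> 'l \<Rightarrow> real) set \<Rightarrow> ('g, 'l) extension_space set"
  where "evaluation_hull E = closure (convex hull (range (evaluation E)))"

definition shift_invariant :: "('g::group_add \<times> 'l \<Rightarrow> real) set \<Rightarrow> bool"
  where "shift_invariant E \<longleftrightarrow> (\<forall>g h. shift g h \<in> E \<longleftrightarrow> h \<in> E)"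

text \<open>The set \<open>E\<close> represents a proximally irreducible extension of \<open>L\<close> whose section is given by the evaluations at
  \<open>(0, y)\<close>. To have a total section, the index \<open>y\<close> ranges over the whole type; \<open>r\<close> is a
  retraction of the type onto \<open>ext_closure L\<close>, and \<open>y\<close> stands for the point \<open>r y\<close>.\<close>

definition extension_model ::
    "('g::{group_add, topological_space} \<Rightarrow> 'l::locally_convex_space \<Rightarrow> 'l) \<Rightarrow> 'l set \<Rightarrow> ('l \<Rightarrow> 'l) \<Rightarrow>
     ('g \<times> 'l \<Rightarrow> real) set \<Rightarrow> (('g, 'l) extension_space \<Rightarrow> 'l) \<Rightarrow> bool"
  where "extension_model \<gamma> L r E \<phi> \<longleftrightarrow> shift_invariant E \<and>
    prox_irreducible_extension translate (evaluation_hull E) \<gamma> L \<phi> \<and>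
    (\<forall>y. evaluation E (0, y) \<in> ext_closure (evaluation_hull E) \<and> \<phi> (evaluation E (0, y)) = r y)"

lemma shift_add: "shift g (shift k h) = shift (k + g) h"
  by (auto simp: shift_def add.assoc)

lemma shift_0: "shift 0 h = h"
  by (auto simp: shift_def)

lemma shift_invariantI:
  assumes "\<And>g h. h \<in> E \<Longrightarrow> shift g h \<in> E"
  shows "shift_invariant E"
  unfolding shift_invariant_def
proof (intro allI iffI assms)
  fix g h assume "shift g h \<in> E"
  from assms[OF this, of "- g"] show "h \<in> E" by (simp add: shift_add shift_0)
qed

lemma coord_translate [simp]: "coord (translate g x) h = coord x (shift g h)"
  by (simp add: translate_def)

lemma coord_restrict_coords [simp]: "coord (restrict_coords E x) h = (if h \<in> E then coord x h else 0)"
  by (simp add: restrict_coords_def)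

lemma coord_evaluation [simp]: "coord (evaluation E p) h = (if h \<in> E then h p else 0)"
  by (simp add: evaluation_def)

lemma linear_restrict_coords: "linear (restrict_coords E)"
  by (auto simp: linear_iff real_product_eq_iff)

lemma continuous_restrict_coords: "continuous_on A (restrict_coords E)"
  unfolding continuous_on_real_product_iff
proof
  show "continuous_on A (\<lambda>x. coord (restrict_coords E x) h)" for h
    by (cases "h \<in> E") (simp_all add: continuous_on_coord)
qed

lemma translate_evaluation:
  assumes "shift_invariant E"
  shows "translate g (evaluation E (k, y)) = evaluation E (g + k, y)"
  using assms by (auto simp: real_product_eq_iff shift_invariant_def) (simp add: shift_def)

lemma restrict_evaluation: "E \<subseteq> E' \<Longrightarrow> restrict_coords E (evaluation E' p) = evaluation E p"
  by (auto simp: real_product_eq_iff)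

lemma restrict_translate:
  "shift_invariant E \<Longrightarrow> restrict_coords E (translate g x) = translate g (restrict_coords E x)"
  by (auto simp: real_product_eq_iff shift_invariant_def)

lemma evaluation_in_hull: "evaluation E p \<in> evaluation_hull E"
  unfolding evaluation_hull_def by (intro subsetD[OF closure_subset] hull_inc) simp

lemma convex_evaluation_hull: "convex (evaluation_hull E)"
  by (simp add: evaluation_hull_def convex_closure_locally_convex)

lemma closed_evaluation_hull: "closed (evaluation_hull E)"
  by (simp add: evaluation_hull_def)

lemma coord_evaluation_hull_outside:
  assumes "x \<in> evaluation_hull E" "h \<notin> E"
  shows "coord x h = 0"
proof -
  have "closed {x :: ('a, 'b) extension_space. coord x h = 0}"
    by (intro closed_Collect_eq continuous_on_coord continuous_on_const)
  moreover have "convex {x :: ('a, 'b) extension_space. coord x h = 0}"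
    by (simp add: convex_def)
  ultimately have "evaluation_hull E \<subseteq> {x. coord x h = 0}"
    unfolding evaluation_hull_def using assms(2) by (intro closure_minimal hull_minimal) auto
  with assms(1) show ?thesis by blast
qed

lemma restrict_evaluation_hull:
  assumes "E \<subseteq> E'" "compact (evaluation_hull E')"
  shows "restrict_coords E ` evaluation_hull E' = evaluation_hull E"
proof -
  have "restrict_coords E ` range (evaluation E') = range (evaluation E)"
    using restrict_evaluation[OF assms(1)] by (auto simp: image_image)
  then show ?thesis
    using affine_image_closed_convex_hull[OF assms(2) evaluation_hull_def continuous_restrict_coords
        linear_imp_affine_map_on[OF linear_restrict_coords]]
    by (simp add: evaluation_hull_def)
qed

lemma affine_isomorphism_image:
  fixes \<theta> :: "'a::locally_convex_space \<Rightarrow> 'b::locally_convex_space"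
  assumes Q: "affine_flow \<beta> Q" and cont: "continuous_on Q \<theta>" and aff: "affine_map_on Q \<theta>"
    and inj: "inj_on \<theta> Q" and eq: "\<And>g x. x \<in> Q \<Longrightarrow> \<theta> (\<beta> g x) = \<alpha> g (\<theta> x)"
  shows "affine_isomorphism \<beta> Q \<alpha> (\<theta> ` Q) \<theta>"
proof -
  note Q' = affine_flowD[OF Q]
  obtain \<psi> where h: "homeomorphism Q (\<theta> ` Q) \<theta> \<psi>"
    using homeomorphism_compact[OF Q'(2) cont refl inj] by blast
  then have inv: "\<psi> (\<theta> x) = x" if "x \<in> Q" for x using that by (auto simp: homeomorphism_def)
  have contp: "continuous_on (\<theta> ` Q) \<psi>" using h by (auto simp: homeomorphism_def)
  have "affine_map_on (\<theta> ` Q) (\<alpha> g)" for g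
  proof (rule affine_map_onI)
    fix a b and u v :: real
    assume ab: "a \<in> \<theta> ` Q" "b \<in> \<theta> ` Q" and uv: "0 \<le> u" "0 \<le> v" "u + v = 1"
    then obtain x y where xy: "x \<in> Q" "y \<in> Q" "a = \<theta> x" "b = \<theta> y" by blast
    have "u *\<^sub>R x + v *\<^sub>R y \<in> Q" using convexD[OF Q'(3) xy(1,2) uv] .
    then show "\<alpha> g (u *\<^sub>R a + v *\<^sub>R b) = u *\<^sub>R \<alpha> g a + v *\<^sub>R \<alpha> g b"
      using xy Q'(5) by (simp add: eq[symmetric] affine_map_onD[OF aff _ _ uv, symmetric]
          affine_map_onD[OF Q'(4) _ _ uv])
  qed
  moreover have "continuous_on (UNIV \<times> \<theta> ` Q) (\<lambda>(g, z). \<alpha> g z)"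
  proof -
    have "continuous_on (UNIV \<times> \<theta> ` Q) (\<lambda>q :: _ \<times> _. \<psi> (snd q))"
      by (rule continuous_on_compose2[OF contp]) (auto intro: continuous_on_snd continuous_on_id)
    then have *: "continuous_on (UNIV \<times> \<theta> ` Q) (\<lambda>q :: _ \<times> _. (fst q, \<psi> (snd q)))"
      by (intro continuous_on_Pair continuous_on_fst continuous_on_id)
    have "continuous_on (UNIV \<times> \<theta> ` Q) (\<lambda>q. (\<lambda>(g, x). \<beta> g x) (fst q, \<psi> (snd q)))"
      by (rule continuous_on_compose2[OF Q'(8) *]) (auto simp: inv)
    then have "continuous_on (UNIV \<times> \<theta> ` Q) (\<lambda>q. \<theta> (\<beta> (fst q) (\<psi> (snd q))))"
      by (intro continuous_on_compose2[OF cont]) (auto simp: inv Q'(5))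
    then show ?thesis by (rule continuous_on_eq) (auto simp: inv eq)
  qed
  moreover have "convex (\<theta> ` Q)" by (rule affine_map_on_convex_image[OF aff Q'(3) order_refl])
  moreover have "compact (\<theta> ` Q)" by (rule compact_continuous_image[OF cont Q'(2)])
  ultimately have "affine_flow \<alpha> (\<theta> ` Q)"
    unfolding affine_flow_def continuous_action_top_of_set
    using Q'(1) by (auto simp: eq[symmetric] Q'(5,6,7))
  then have "affine_extension \<beta> Q \<alpha> (\<theta> ` Q) \<theta>"
    using Q cont aff eq by (simp add: affine_extension_def)
  with h show ?thesis by (auto simp: affine_isomorphism_def)
qed

text \<open>The tables of values of all continuous affine functions along the orbits of the section. Affine functions on
  \<open>Q\<close> are taken rather than linear functionals of the ambient space, as only the former are permuted by the action.\<close>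

definition observables ::
    "('g \<Rightarrow> 'q \<Rightarrow> 'q) \<Rightarrow> 'q::locally_convex_space set \<Rightarrow> ('l \<Rightarrow> 'q) \<Rightarrow> ('g \<times> 'l \<Rightarrow> real) set"
  where "observables \<beta> Q q =
    (\<lambda>f (g, y). f (\<beta> g (q y))) ` {f. continuous_on Q f \<and> affine_map_on Q f}"

text \<open>The orbits of the section generate \<open>Q\<close>, so a table has only one continuous affine function. Sending a point of
  \<open>Q\<close> to the values at it of the functions with given tables is therefore well defined and affine; it is injective
  since continuous linear functionals separate points, and it maps the orbits of the section to the evaluations.\<close>

lemma observables_extension_model:
  fixes \<beta> :: "'g::{group_add, topological_space} \<Rightarrow> 'q::locally_convex_space \<Rightarrow> 'q"
    and \<gamma> :: "'g \<Rightarrow> 'l::locally_convex_space \<Rightarrow> 'l"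
  assumes pe: "prox_irreducible_extension \<beta> Q \<gamma> L \<phi>"
    and q: "\<And>y. q y \<in> ext_closure Q" "\<And>y. \<phi> (q y) = r y"
    and r: "\<And>y. y \<in> ext_closure L \<Longrightarrow> r y = y"
  obtains \<theta> \<phi>' where "affine_isomorphism \<beta> Q translate (evaluation_hull (observables \<beta> Q q)) \<theta>"
    "\<And>g y. \<theta> (\<beta> g (q y)) = evaluation (observables \<beta> Q q) (g, y)"
    "extension_model \<gamma> L r (observables \<beta> Q q) \<phi>'"
proof -
  define E where "E = observables \<beta> Q q"
  define A where "A = {f. continuous_on Q f \<and> affine_map_on Q (f :: 'q \<Rightarrow> real)}"
  define R where "R = (\<lambda>(f :: 'q \<Rightarrow> real) (g, y). f (\<beta> g (q y)))"
  have ER: "E = R ` A" by (simp add: E_def observables_def A_def R_def)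
  note Q = prox_irreducible_extensionD(2)[OF pe]
  note Q' = affine_flowD[OF Q]
  have sub: "ext_closure Q \<subseteq> Q" by (rule ext_closure_subset[OF Q'(2)])
  have qQ: "q y \<in> Q" for y using q(1) sub by blast
  define D where "D = range (\<lambda>(g, y). \<beta> g (q y))"
  have bD: "\<beta> g (q y) \<in> D" for g y unfolding D_def by (rule range_eqI[of _ _ "(g, y)"]) simp
  have DQ: "D \<subseteq> Q" using qQ Q'(5) by (auto simp: D_def)
  have gen: "Q = closure (convex hull D)"
  proof (rule prox_irreducible_extension_generated[OF pe DQ])
    show "\<beta> g x \<in> D" if "x \<in> D" for g x
    proof -
      obtain k y where "x = \<beta> k (q y)" using \<open>x \<in> D\<close> by (auto simp: D_def)
      then have "\<beta> g x = \<beta> (g + k) (q y)" using Q'(7)[OF qQ] by simp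
      then show ?thesis using bD by simp
    qed
    show "\<exists>x\<in>D. x \<in> ext_closure Q \<and> \<phi> x = y" if "y \<in> ext_closure L" for y
      using bD[of 0 y] Q'(6)[OF qQ] q r[OF that] by metis
  qed
  define F where "F = (\<lambda>h. SOME f. f \<in> A \<and> R f = h)"
  have F: "F h \<in> A" "R (F h) = h" if "h \<in> E" for h
  proof -
    have "\<exists>f. f \<in> A \<and> R f = h" using that by (auto simp: ER)
    from someI_ex[OF this] show "F h \<in> A" "R (F h) = h" by (simp_all add: F_def)
  qed
  have R_eq: "f x = f' x" if "f \<in> A" "f' \<in> A" "R f = R f'" "x \<in> Q" for f f' x
  proof (rule affine_map_eq_on_closed_convex_hull[OF gen _ _ _ _ _ \<open>x \<in> Q\<close>])
    show "f z = f' z" if "z \<in> D" for z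
      using that \<open>R f = R f'\<close> by (auto simp: D_def R_def fun_eq_iff)
  qed (use that in \<open>auto simp: A_def\<close>)
  have FR: "F (R f) x = f x" if "f \<in> A" "x \<in> Q" for f x
    using R_eq[OF F(1)[of "R f"] \<open>f \<in> A\<close> F(2)[of "R f"] \<open>x \<in> Q\<close>] that by (simp add: ER)
  have shiftR: "shift g (R f) = R (\<lambda>x. f (\<beta> g x))" for g f
    using Q'(7)[OF qQ] by (auto simp: shift_def R_def)
  have Ab: "(\<lambda>x. f (\<beta> g x)) \<in> A" if "f \<in> A" for f g
    using that affine_flow_continuous[OF Q, of g] Q'(4,5)
    by (auto simp: A_def intro!: affine_map_on_compose[of Q "\<beta> g" Q f] continuous_on_compose2[of Q f Q "\<beta> g"])
  have inv: "shift_invariant E"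
    by (rule shift_invariantI) (auto simp: ER shiftR intro: Ab)
  define \<theta> :: "'q \<Rightarrow> ('g, 'l) extension_space"
    where "\<theta> = (\<lambda>x. of_coords (\<lambda>h. if h \<in> E then F h x else 0))"
  have cont: "continuous_on Q \<theta>"
    unfolding continuous_on_real_product_iff
  proof
    show "continuous_on Q (\<lambda>x. coord (\<theta> x) h)" for h
      using F(1) by (cases "h \<in> E") (auto simp: \<theta>_def A_def)
  qed
  have aff: "affine_map_on Q \<theta>"
    using F(1) by (auto simp: affine_map_on_def \<theta>_def real_product_eq_iff A_def)
  have inj: "inj_on \<theta> Q"
  proof (rule inj_onI, rule ccontr)
    fix x y assume xy: "x \<in> Q" "y \<in> Q" "\<theta> x = \<theta> y" "x \<noteq> y"
    obtain f :: "'q \<Rightarrow> real" where f: "linear f" "continuous_on UNIV f" "f x \<noteq> f y"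
      by (rule separating_functional[OF xy(4)])
    then have "f \<in> A" by (auto simp: A_def linear_imp_affine_map_on intro: continuous_on_subset)
    moreover from this have "R f \<in> E" by (simp add: ER)
    then have "F (R f) x = F (R f) y"
      using arg_cong[OF xy(3), of "\<lambda>z. coord z (R f)"] by (simp add: \<theta>_def)
    ultimately show False using FR xy f(3) by metis
  qed
  have eq: "\<theta> (\<beta> g x) = translate g (\<theta> x)" if "x \<in> Q" for g x
  proof -
    have "F h (\<beta> g x) = F (shift g h) x" if "h \<in> E" for h
    proof -
      obtain f where f: "f \<in> A" "h = R f" using \<open>h \<in> E\<close> by (auto simp: ER)
      then show ?thesis using FR[OF f(1) Q'(5)[OF \<open>x \<in> Q\<close>]] FR[OF Ab[OF f(1)] \<open>x \<in> Q\<close>] by (simp add: shiftR)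
    qed
    then show ?thesis using inv by (auto simp: \<theta>_def real_product_eq_iff shift_invariant_def)
  qed
  have ev: "\<theta> (\<beta> g (q y)) = evaluation E (g, y)" for g y
  proof -
    have "F h (\<beta> g (q y)) = h (g, y)" if "h \<in> E" for h
      using fun_cong[OF F(2)[OF that], of "(g, y)"] by (simp add: R_def)
    then show ?thesis by (auto simp: \<theta>_def real_product_eq_iff)
  qed
  have "(\<lambda>p. \<theta> ((\<lambda>(g, y). \<beta> g (q y)) p)) = evaluation E" by (auto simp: ev)
  then have "\<theta> ` D = range (evaluation E)" by (simp only: D_def image_image)
  then have im: "\<theta> ` Q = evaluation_hull E"
    using affine_image_closed_convex_hull[OF Q'(2) gen cont aff] by (simp add: evaluation_hull_def)
  have iso: "affine_isomorphism \<beta> Q translate (evaluation_hull E) \<theta>"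
    using affine_isomorphism_image[where \<alpha> = translate, OF Q cont aff inj] eq im by metis
  then obtain \<psi> where h: "homeomorphism Q (evaluation_hull E) \<theta> \<psi>"
    by (auto simp: affine_isomorphism_def)
  have ev0: "\<theta> (q y) = evaluation E (0, y)" for y using ev[of 0 y] Q'(6)[OF qQ] by simp
  have "extension_model \<gamma> L r E (\<lambda>x. \<phi> (\<psi> x))"
    unfolding extension_model_def
  proof (intro conjI allI)
    show "prox_irreducible_extension translate (evaluation_hull E) \<gamma> L (\<lambda>x. \<phi> (\<psi> x))"
      by (rule prox_irreducible_extension_transfer[OF pe iso h])
    fix y
    show "evaluation E (0, y) \<in> ext_closure (evaluation_hull E)"
      using affine_isomorphism_ext_closure[OF iso] q(1)[of y] ev0[of y] by (metis image_subset_iff)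
    have "\<psi> (\<theta> (q y)) = q y" using h qQ by (simp add: homeomorphism_def)
    then show "\<phi> (\<psi> (evaluation E (0, y))) = r y" by (simp add: ev0 q(2))
  qed (rule inv)
  then show ?thesis using that iso ev E_def by blast
qed

section \<open>Unions of chains\<close>

text \<open>Each coordinate occurs in a member \<open>E\<close> of the family, and there it takes values in a compact interval.\<close>

lemma compact_evaluation_hull_Union:
  fixes \<C> :: "('g \<times> 'l \<Rightarrow> real) set set"
  assumes cpt: "\<And>E. E \<in> \<C> \<Longrightarrow> compact (evaluation_hull E)"
  shows "compact (evaluation_hull (\<Union>\<C>))"
proof -
  have "\<forall>h\<in>\<Union>\<C>. \<exists>E. E \<in> \<C> \<and> h \<in> E" by blast
  then obtain E where E: "\<And>h. h \<in> \<Union>\<C> \<Longrightarrow> E h \<in> \<C>" "\<And>h. h \<in> \<Union>\<C> \<Longrightarrow> h \<in> E h"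
    by metis
  define S where "S = (\<lambda>h. if h \<in> \<Union>\<C> then (\<lambda>x. coord x h) ` evaluation_hull (E h) else {0})"
  define B where "B = {x. \<forall>h. coord x h \<in> S h}"
  have "compact (S h)" for h
    using cpt E(1)[of h] by (auto simp: S_def intro: compact_continuous_image continuous_on_coord)
  then have cB: "compact B" unfolding B_def by (rule compact_coordinatewise)
  have "convex (S h)" for h
    by (auto simp: S_def intro: convex_linear_image[OF linear_coord] convex_evaluation_hull)
  then have "convex B" by (auto simp: B_def convex_def)
  moreover have "range (evaluation (\<Union>\<C>)) \<subseteq> B"
  proof -
    have "coord (evaluation (\<Union>\<C>) p) h \<in> S h" for p h
    proof (cases "h \<in> \<Union>\<C>")
      case True
      then have "coord (evaluation (\<Union>\<C>) p) h = coord (evaluation (E h) p) h" using E by simp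
      also have "\<dots> \<in> (\<lambda>x. coord x h) ` evaluation_hull (E h)"
        by (rule imageI[OF evaluation_in_hull])
      finally show ?thesis using True by (simp add: S_def)
    next
      case False
      then show ?thesis by (simp add: S_def)
    qed
    then show ?thesis by (auto simp: B_def)
  qed
  ultimately have "evaluation_hull (\<Union>\<C>) \<subseteq> B"
    unfolding evaluation_hull_def by (intro closure_minimal hull_minimal compact_imp_closed cB)
  then show ?thesis by (rule compact_closed_subset[OF cB closed_evaluation_hull])
qed

text \<open>A basic neighbourhood restricts finitely many coordinates, and these lie in a single member of the chain.\<close>

lemma mem_closed_if_restrictions:
  fixes A :: "'i real_product set"
  assumes ch: "subset.chain \<A> \<C>" "\<C> \<noteq> {}" and A: "closed A"
    and out: "\<And>a h. a \<in> A \<Longrightarrow> h \<notin> \<Union>\<C> \<Longrightarrow> coord a h = 0" "\<And>h. h \<notin> \<Union>\<C> \<Longrightarrow> coord x h = 0"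
    and mem: "\<And>E. E \<in> \<C> \<Longrightarrow> restrict_coords E x \<in> restrict_coords E ` A"
  shows "x \<in> A"
proof (rule ccontr)
  assume "x \<notin> A"
  have "open (of_coords -` (- A))"
    using A open_real_product_iff[of "- A"] by (simp add: open_Compl)
  moreover have "coord x \<in> of_coords -` (- A)" using \<open>x \<notin> A\<close> by (simp add: coord_inverse)
  ultimately obtain X where X: "coord x \<in> Pi\<^sub>E UNIV X" "finite {i. X i \<noteq> UNIV}"
      "Pi\<^sub>E UNIV X \<subseteq> of_coords -` (- A)"
    using product_topology_open_contains_basis[of "\<lambda>_. euclidean" UNIV "of_coords -` (- A)" "coord x"]
    by (auto simp: open_fun_def)
  have "finite ({i. X i \<noteq> UNIV} \<inter> \<Union>\<C>)" using X(2) by blast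
  then obtain E where E: "E \<in> \<C>" "{i. X i \<noteq> UNIV} \<inter> \<Union>\<C> \<subseteq> E"
    using finite_subset_Union_chain[OF _ _ ch(2,1)] by (metis inf_le2)
  obtain a where a: "a \<in> A" "restrict_coords E x = restrict_coords E a" using mem[OF E(1)] by blast
  have "coord a i \<in> X i" for i
  proof (cases "i \<in> E \<or> i \<notin> \<Union>\<C>")
    case True
    have "coord a i = coord x i"
    proof (cases "i \<in> E")
      case True
      have "coord (restrict_coords E x) i = coord (restrict_coords E a) i" using a(2) by simp
      with True show ?thesis by simp
    next
      case False
      then show ?thesis using True out a(1) by simp
    qed
    then show ?thesis using X(1) by (auto simp: PiE_iff)
  next
    case False
    then have "X i = UNIV" using E(2) by blast
    then show ?thesis by simp
  qed
  then have "coord a \<in> Pi\<^sub>E UNIV X" by (auto simp: PiE_iff)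
  then have "a \<notin> A" using X(3) by (auto simp: coord_inverse)
  with a(1) show False by simp
qed

lemma linear_translate: "linear (translate g)"
  by (auto simp: linear_iff real_product_eq_iff)

lemma continuous_translate: "continuous_on A (translate g)"
  unfolding continuous_on_real_product_iff by (simp add: continuous_on_coord)

text \<open>Continuity of the action can be checked in one coordinate at a time, and a single coordinate factors through the
  flow of a member of the family.\<close>

lemma affine_flow_evaluation_hull_Union:
  fixes \<C> :: "('g::{group_add, topological_space} \<times> 'l \<Rightarrow> real) set set"
  assumes ne: "\<C> \<noteq> {}" and inv: "\<And>E. E \<in> \<C> \<Longrightarrow> shift_invariant E"
    and fl: "\<And>E. E \<in> \<C> \<Longrightarrow> affine_flow translate (evaluation_hull E)"
  shows "affine_flow translate (evaluation_hull (\<Union>\<C>))"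
proof -
  let ?M = "evaluation_hull (\<Union>\<C>)"
  have invU: "shift_invariant (\<Union>\<C>)"
    using inv unfolding shift_invariant_def by blast
  have cpt: "compact ?M"
    using affine_flowD(2)[OF fl] by (rule compact_evaluation_hull_Union)
  have tr: "translate g x \<in> ?M" if "x \<in> ?M" for g x
  proof -
    have "translate g ` range (evaluation (\<Union>\<C>)) \<subseteq> range (evaluation (\<Union>\<C>))"
      using translate_evaluation[OF invU] by auto
    then have "closure (convex hull (translate g ` range (evaluation (\<Union>\<C>)))) \<subseteq> ?M"
      unfolding evaluation_hull_def by (intro closure_mono hull_mono)
    then show ?thesis
      using that affine_image_closed_convex_hull[OF cpt evaluation_hull_def continuous_translate
          linear_imp_affine_map_on[OF linear_translate]] by blast
  qed
  have "continuous_on (UNIV \<times> ?M) (\<lambda>(g, x). translate g x)"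
    unfolding continuous_on_real_product_iff
  proof
    fix h :: "'g \<times> 'l \<Rightarrow> real"
    show "continuous_on (UNIV \<times> ?M) (\<lambda>q. coord (case q of (g, x) \<Rightarrow> translate g x) h)"
    proof (cases "h \<in> \<Union>\<C>")
      case True
      then obtain E where E: "E \<in> \<C>" "h \<in> E" by blast
      have "restrict_coords E ` ?M = evaluation_hull E"
        using E(1) by (intro restrict_evaluation_hull cpt) auto
      then have "continuous_on (UNIV \<times> ?M)
          (\<lambda>q. (\<lambda>(g, x). translate g x) (fst q, restrict_coords E (snd q)))"
        by (intro continuous_on_compose2[OF affine_flowD(8)[OF fl[OF E(1)]]]
            continuous_on_Pair continuous_on_fst continuous_on_id
            continuous_on_compose2[OF continuous_restrict_coords[of UNIV E] continuous_on_snd]) auto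
      then have "continuous_on (UNIV \<times> ?M)
          (\<lambda>q. coord ((\<lambda>(g, x). translate g x) (fst q, restrict_coords E (snd q))) h)"
        by (rule continuous_on_compose2[OF continuous_on_coord[of UNIV]]) simp
      then show ?thesis
        by (rule continuous_on_eq) (use inv[OF E(1)] E(2) in \<open>auto simp: shift_invariant_def\<close>)
    next
      case False
      have "continuous_on (UNIV \<times> ?M) (\<lambda>q :: 'g \<times> ('g, 'l) extension_space. 0 :: real)"
        by (rule continuous_on_const)
      then show ?thesis
        by (rule continuous_on_eq)
           (use False invU in \<open>auto simp: shift_invariant_def coord_evaluation_hull_outside\<close>)
    qed
  qed
  moreover have "?M \<noteq> {}" using evaluation_in_hull by blast
  ultimately show ?thesis
    unfolding affine_flow_def continuous_action_top_of_set
    using cpt convex_evaluation_hull tr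
    by (auto simp: linear_imp_affine_map_on linear_translate real_product_eq_iff shift_0 shift_add)
qed

text \<open>The inverse limit step. That the section consists of points of \<open>ext_closure M\<close> follows since its
  restrictions lift to \<open>ext_closure M\<close>; that \<open>M\<close> is proximally irreducible over \<open>L\<close> follows from the same property of
  the members, once the restriction maps are known to send \<open>ext_closure M\<close> to the corresponding closures.\<close>

lemma extension_model_Union:
  fixes \<gamma> :: "'g::{group_add, topological_space} \<Rightarrow> 'l::locally_convex_space \<Rightarrow> 'l"
  assumes ch: "subset.chain {E. \<exists>\<phi>. extension_model \<gamma> L r E \<phi>} \<C>" and ne: "\<C> \<noteq> {}"
  shows "\<exists>\<phi>. extension_model \<gamma> L r (\<Union>\<C>) \<phi>"
proof -
  define U where "U = \<Union>\<C>"
  define M where "M = evaluation_hull U"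
  have "\<forall>E\<in>\<C>. \<exists>\<phi>. extension_model \<gamma> L r E \<phi>" using ch by (auto simp: subset_chain_def)
  then obtain \<Phi> where "\<And>E. E \<in> \<C> \<Longrightarrow> extension_model \<gamma> L r E (\<Phi> E)" by metis
  then have inv: "shift_invariant E"
    and pe: "prox_irreducible_extension translate (evaluation_hull E) \<gamma> L (\<Phi> E)"
    and pt: "evaluation E (0, y) \<in> ext_closure (evaluation_hull E)"
    and \<Phi>: "\<Phi> E (evaluation E (0, y)) = r y" if "E \<in> \<C>" for E y
    using that by (auto simp: extension_model_def)
  have EU: "E \<subseteq> U" if "E \<in> \<C>" for E using that by (auto simp: U_def)
  note fl = prox_irreducible_extensionD(2)[OF pe]
  have flM: "affine_flow translate M"
    unfolding M_def U_def by (rule affine_flow_evaluation_hull_Union[OF ne inv fl])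
  note cM = affine_flowD(2)[OF flM]
  have invU: "shift_invariant U" using inv unfolding shift_invariant_def U_def by blast
  have ext_restr: "affine_extension translate M translate (evaluation_hull E) (restrict_coords E)"
    if "E \<in> \<C>" for E
    using that flM fl restrict_evaluation_hull[OF EU] cM
    by (auto simp: affine_extension_def continuous_restrict_coords linear_imp_affine_map_on
        linear_restrict_coords restrict_translate inv M_def)
  \<comment> \<open>The map to \<open>L\<close> may be defined through any member of the chain, because all of them agree on the evaluations.\<close>
  obtain E0 where E0: "E0 \<in> \<C>" using ne by blast
  define \<phi> where "\<phi> = (\<lambda>x. \<Phi> E0 (restrict_coords E0 x))"
  have ext_E: "affine_extension translate M \<gamma> L (\<lambda>x. \<Phi> E (restrict_coords E x))" if "E \<in> \<C>" for E
    using affine_extension_compose[OF ext_restr prox_irreducible_extensionD(1)[OF pe]] that by blast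
  have ext_M: "affine_extension translate M \<gamma> L \<phi>" unfolding \<phi>_def by (rule ext_E[OF E0])
  have gen: "M = closure (convex hull (range (evaluation U)))" by (simp add: M_def evaluation_hull_def)
  have \<phi>_eq: "\<Phi> E (restrict_coords E x) = \<phi> x" if "E \<in> \<C>" "x \<in> M" for E x
  proof (rule affine_map_eq_on_closed_convex_hull[OF gen _ _ _ _ _ \<open>x \<in> M\<close>])
    have \<Phi>_ev: "\<Phi> E (restrict_coords E (evaluation U (g, y))) = \<gamma> g (r y)" if "E \<in> \<C>" for E g y
    proof -
      have "restrict_coords E (evaluation U (g, y)) = translate g (evaluation E (0, y))"
        using restrict_evaluation[OF EU[OF that]] translate_evaluation[OF inv[OF that], of g 0] by simp
      then show ?thesis
        using prox_irreducible_extensionD(7)[OF pe[OF that] evaluation_in_hull] \<Phi>[OF that] by simp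
    qed
    show "\<Phi> E (restrict_coords E z) = \<phi> z" if "z \<in> range (evaluation U)" for z
      using that \<Phi>_ev[OF \<open>E \<in> \<C>\<close>] \<Phi>_ev[OF E0] by (auto simp: \<phi>_def)
  qed (use ext_E[OF that(1)] ext_M in \<open>auto simp: affine_extension_def\<close>)
  have outM: "coord x h = 0" if "x \<in> M" "h \<notin> \<Union>\<C>" for x h
    using coord_evaluation_hull_outside[of x "\<Union>\<C>" h] that by (simp add: M_def U_def)
  have subM: "ext_closure M \<subseteq> M" by (rule ext_closure_subset[OF cM])
  have evM: "evaluation U p \<in> M" for p by (simp add: M_def evaluation_in_hull)
  have section_U: "evaluation U (0, y) \<in> ext_closure M" for y
  proof (rule mem_closed_if_restrictions[OF ch ne])
    show "closed (ext_closure M)" by (simp add: ext_closure_def)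
    show "restrict_coords E (evaluation U (0, y)) \<in> restrict_coords E ` ext_closure M" if "E \<in> \<C>" for E
      using affine_extension_lift_ext_closure[OF ext_restr[OF that] pt[OF that, of y]]
        restrict_evaluation[OF EU[OF that], of "(0, y)"] by (metis imageI)
  qed (use outM subM evM in blast)+
  \<comment> \<open>The closed set \<open>D\<close> contains the generating evaluations, so by Milman's theorem it contains the extreme
    points.\<close>
  define D where "D = M \<inter> (\<Inter>E\<in>\<C>. restrict_coords E -` ext_closure (evaluation_hull E))"
  have "closed D"
    unfolding D_def
    by (intro closed_Int closed_INT ballI closed_vimage continuous_restrict_coords)
       (auto simp: ext_closure_def M_def closed_evaluation_hull)
  have DM: "D \<subseteq> M" by (auto simp: D_def)
  have "evaluation U (g, y) \<in> D" for g y
  proof -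
    have "restrict_coords E (evaluation U (g, y)) \<in> ext_closure (evaluation_hull E)" if "E \<in> \<C>" for E
      using affine_flow_ext_closure[OF fl[OF that] pt[OF that], of g y]
        restrict_evaluation[OF EU[OF that]] translate_evaluation[OF inv[OF that], of g 0] by simp
    then show ?thesis using evM by (simp add: D_def)
  qed
  then have "range (evaluation U) \<subseteq> D" by auto
  then have "M \<subseteq> closure (convex hull D)" unfolding gen by (intro closure_mono hull_mono)
  moreover have "closure (convex hull D) \<subseteq> M"
    using DM unfolding M_def by (intro closure_minimal hull_minimal convex_evaluation_hull closed_evaluation_hull)
  ultimately have genD: "M = closure (convex hull D)" by blast
  have "{x. x extreme_point_of M} \<subseteq> D"
    using Milman_locally_convex[OF compact_closed_subset[OF cM \<open>closed D\<close> DM] cM genD] by blast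
  then have extD: "ext_closure M \<subseteq> D"
    unfolding ext_closure_def[of M] using \<open>closed D\<close> by (rule closure_minimal)
  have "prox_irreducible_extension translate M \<gamma> L \<phi>"
    unfolding prox_irreducible_extension_def
  proof (intro conjI allI impI)
    fix C assume "affine_subflow translate M C \<and>
      (\<forall>y\<in>ext_closure L. C \<inter> convex hull (ext_closure M \<inter> \<phi> -` {y}) \<noteq> {})"
    then have C: "C \<subseteq> M" "C \<noteq> {}" "closed C" "convex C" "\<And>g x. x \<in> C \<Longrightarrow> translate g x \<in> C"
      and meet: "\<And>y. y \<in> ext_closure L \<Longrightarrow> C \<inter> convex hull (ext_closure M \<inter> \<phi> -` {y}) \<noteq> {}"
      by (auto simp: affine_subflow_def)
    have cC: "compact C" by (rule compact_closed_subset[OF cM C(3,1)])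
    have proj: "restrict_coords E ` C = evaluation_hull E" if E: "E \<in> \<C>" for E
    proof (rule prox_irreducible_extensionD(8)[OF pe[OF E]])
      have "restrict_coords E ` M = evaluation_hull E"
        unfolding M_def using cM by (intro restrict_evaluation_hull EU E) (simp add: M_def)
      moreover have "translate g (restrict_coords E x) \<in> restrict_coords E ` C" if "x \<in> C" for g x
        using C(5)[OF that] restrict_translate[OF inv[OF E]] by (metis imageI)
      moreover have "restrict_coords E ` C \<subseteq> restrict_coords E ` M" using C(1) by (rule image_mono)
      ultimately show "affine_subflow translate (evaluation_hull E) (restrict_coords E ` C)"
        using C(2-4) cC
        by (auto simp: affine_subflow_def intro!: convex_linear_image linear_restrict_coords
            compact_imp_closed compact_continuous_image continuous_restrict_coords)
      fix y assume "y \<in> ext_closure L"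
      then obtain z where z: "z \<in> C" "z \<in> convex hull (ext_closure M \<inter> \<phi> -` {y})" using meet by blast
      have "restrict_coords E z \<in> convex hull (restrict_coords E ` (ext_closure M \<inter> \<phi> -` {y}))"
        using z(2) convex_hull_linear_image[OF linear_restrict_coords, of E] by blast
      moreover have "restrict_coords E ` (ext_closure M \<inter> \<phi> -` {y}) \<subseteq>
          ext_closure (evaluation_hull E) \<inter> \<Phi> E -` {y}"
        using extD subM \<phi>_eq[OF E] E by (auto simp: D_def)
      ultimately have "restrict_coords E z \<in> convex hull (ext_closure (evaluation_hull E) \<inter> \<Phi> E -` {y})"
        using hull_mono by blast
      with z(1) show "restrict_coords E ` C \<inter>
          convex hull (ext_closure (evaluation_hull E) \<inter> \<Phi> E -` {y}) \<noteq> {}" by blast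
    qed
    have "x \<in> C" if x: "x \<in> M" for x
    proof (rule mem_closed_if_restrictions[OF ch ne C(3)])
      show "restrict_coords E x \<in> restrict_coords E ` C" if "E \<in> \<C>" for E
        unfolding proj[OF that] using ext_restr[OF that] x by (auto simp: affine_extension_def)
    qed (use outM C(1) x in blast)+
    with C(1) show "C = M" by blast
  qed (rule ext_M)
  moreover have "\<phi> (evaluation U (0, y)) = r y" for y
    using \<Phi>[OF E0] restrict_evaluation[OF EU[OF E0]] by (simp add: \<phi>_def)
  ultimately have "extension_model \<gamma> L r U \<phi>"
    using invU section_U by (simp add: extension_model_def M_def)
  then show ?thesis by (auto simp: U_def)
qed

section \<open>A maximal proximally irreducible extension\<close>

text \<open>The section of \<open>Q\<close> is chosen above the section of \<open>M\<close>. Then every \<open>h \<in> E\<close> is the table of the affine function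
  \<open>x \<mapsto> coord (\<psi> x) h\<close> on \<open>Q\<close>, so the tables of \<open>Q\<close> contain \<open>E\<close>, and by maximality they are no more.\<close>

theorem ex_prox_irreducible_above:
  fixes \<gamma> :: "'g::{group_add, topological_space} \<Rightarrow> 'l::locally_convex_space \<Rightarrow> 'l"
  assumes L: "affine_flow \<gamma> L"
    and comp: "\<And>\<alpha> (K :: ('g, 'l) extension_space set) \<phi>
          \<beta> (Q :: ('g, ('g, 'l) extension_space) extension_space set) \<psi>.
          prox_irreducible_extension \<alpha> K \<gamma> L \<phi> \<Longrightarrow>
          prox_irreducible_extension \<beta> Q \<alpha> K \<psi> \<Longrightarrow>
          prox_irreducible_extension \<beta> Q \<gamma> L (\<phi> \<circ> \<psi>)"
  shows "\<exists>(M :: ('g, 'l) extension_space set) \<phi>.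
    prox_irreducible translate M \<and> prox_irreducible_extension translate M \<gamma> L \<phi>"
proof -
  obtain y0 where y0: "y0 \<in> ext_closure L" using ext_closure_nonempty[OF L] by blast
  define r where "r = (\<lambda>y. if y \<in> ext_closure L then y else y0)"
  have r: "r y \<in> ext_closure L" "y \<in> ext_closure L \<Longrightarrow> r y = y" for y using y0 by (auto simp: r_def)
  define \<A> where "\<A> = {E. \<exists>\<phi>. extension_model \<gamma> L r E \<phi>}"
  obtain \<phi>0 where "extension_model \<gamma> L r (observables \<gamma> L r) \<phi>0"
    using observables_extension_model[OF prox_irreducible_extension_id[OF L] r(1) refl r(2)] by blast
  then have "\<A> \<noteq> {}" by (auto simp: \<A>_def)
  moreover have "\<Union>\<C> \<in> \<A>" if "\<C> \<noteq> {}" "subset.chain \<A> \<C>" for \<C>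
    using extension_model_Union[of \<gamma> L r \<C>] that by (simp add: \<A>_def)
  ultimately obtain E where E: "E \<in> \<A>" and max: "\<And>E'. E' \<in> \<A> \<Longrightarrow> E \<subseteq> E' \<Longrightarrow> E' = E"
    using subset_Zorn_nonempty[of \<A>] by metis
  define M where "M = evaluation_hull E"
  obtain \<phi> where "extension_model \<gamma> L r E \<phi>" using E by (auto simp: \<A>_def)
  then have inv: "shift_invariant E" and pe: "prox_irreducible_extension translate M \<gamma> L \<phi>"
    and pt: "\<And>y. evaluation E (0, y) \<in> ext_closure M" and \<phi>: "\<And>y. \<phi> (evaluation E (0, y)) = r y"
    by (auto simp: extension_model_def M_def)
  note flM = prox_irreducible_extensionD(2)[OF pe]
  have ev: "evaluation E (g, y) = translate g (evaluation E (0, y))" for g y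
    using translate_evaluation[OF inv, of g 0] by simp
  have "prox_irreducible translate M"
    unfolding prox_irreducible_def
  proof (intro conjI allI impI flM)
    fix \<beta> and Q :: "('g, ('g, 'l) extension_space) extension_space set" and \<psi>
    assume pe': "prox_irreducible_extension \<beta> Q translate M \<psi>"
    note Q = prox_irreducible_extensionD(2)[OF pe']
    have pe'': "prox_irreducible_extension \<beta> Q \<gamma> L (\<phi> \<circ> \<psi>)" by (rule comp[OF pe pe'])
    have "\<exists>x. x \<in> ext_closure Q \<and> \<psi> x = evaluation E (0, y)" for y
      using affine_extension_lift_ext_closure[OF prox_irreducible_extensionD(1)[OF pe'] pt] by blast
    then obtain q where q: "\<And>y. q y \<in> ext_closure Q" "\<And>y. \<psi> (q y) = evaluation E (0, y)" by metis
    then have qr: "\<And>y. (\<phi> \<circ> \<psi>) (q y) = r y" by (simp add: \<phi>)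
    obtain \<theta> \<phi>' where \<theta>: "affine_isomorphism \<beta> Q translate (evaluation_hull (observables \<beta> Q q)) \<theta>"
      "\<And>g y. \<theta> (\<beta> g (q y)) = evaluation (observables \<beta> Q q) (g, y)"
      and extension_model: "extension_model \<gamma> L r (observables \<beta> Q q) \<phi>'"
      using observables_extension_model[OF pe'' q(1) qr r(2)] by blast
    have qQ: "q y \<in> Q" for y using q(1) ext_closure_subset[OF affine_flowD(2)[OF Q]] by blast
    have \<psi>_ev: "\<psi> (\<beta> g (q y)) = evaluation E (g, y)" for g y
      using prox_irreducible_extensionD(7)[OF pe' qQ] by (simp add: q(2) flip: ev)
    have "E \<subseteq> observables \<beta> Q q"
    proof
      fix h assume h: "h \<in> E"
      define f where "f = (\<lambda>x. coord (\<psi> x) h)"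
      have "continuous_on Q f"
        using prox_irreducible_extensionD(4)[OF pe'] by (simp add: f_def continuous_on_real_product_iff)
      moreover have "affine_map_on Q f"
        using prox_irreducible_extensionD(6)[OF pe'] by (auto simp: f_def affine_map_on_def)
      moreover have "h = (\<lambda>(g, y). f (\<beta> g (q y)))" using h by (auto simp: f_def \<psi>_ev)
      ultimately show "h \<in> observables \<beta> Q q" by (auto simp: observables_def)
    qed
    then have obs: "observables \<beta> Q q = E" using max extension_model by (auto simp: \<A>_def)
    obtain \<xi> where h: "homeomorphism Q M \<theta> \<xi>"
      using \<theta>(1) by (auto simp: affine_isomorphism_def obs M_def)
    have iso': "affine_isomorphism translate M \<beta> Q \<xi>"
      using affine_isomorphism_inverse[OF \<theta>(1)] h by (simp add: obs M_def)
    have "affine_extension translate M translate M (\<lambda>x. \<psi> (\<xi> x))"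
      using affine_extension_compose[OF _ prox_irreducible_extensionD(1)[OF pe']] iso'
      by (auto simp: affine_isomorphism_def)
    then have *: "continuous_on M (\<lambda>x. \<psi> (\<xi> x))" "affine_map_on M (\<lambda>x. \<psi> (\<xi> x))"
      by (auto simp: affine_extension_def)
    \<comment> \<open>Both \<open>\<psi>\<close> and the canonical isomorphism \<open>\<theta>\<close> send \<open>\<beta> g (q y)\<close> to the evaluation at \<open>(g, y)\<close>.\<close>
    have id: "\<psi> (\<xi> x) = x" if "x \<in> M" for x
    proof (rule affine_map_eq_on_closed_convex_hull[OF _ * _ _ _ that])
      show "M = closure (convex hull (range (evaluation E)))" by (simp add: M_def evaluation_hull_def)
      show "continuous_on M (\<lambda>x. x)" "affine_map_on M (\<lambda>x. x)"
        by (simp_all add: continuous_on_id affine_map_on_def)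
      fix z assume "z \<in> range (evaluation E)"
      then obtain g y where z: "z = evaluation E (g, y)" by auto
      have "\<xi> (\<theta> (\<beta> g (q y))) = \<beta> g (q y)"
        using h affine_flowD(5)[OF Q qQ] by (simp add: homeomorphism_def)
      then have "\<xi> z = \<beta> g (q y)" using \<theta>(2)[of g y] by (simp add: obs z)
      then show "\<psi> (\<xi> z) = z" by (simp add: \<psi>_ev z)
    qed
    have "\<psi> x = \<theta> x" if "x \<in> Q" for x
      using id[of "\<theta> x"] h that by (auto simp: homeomorphism_def)
    then have "homeomorphism Q M \<psi> \<xi>" by (metis (no_types, lifting) h homeomorphism_cong)
    then show "affine_isomorphism \<beta> Q translate M \<psi>"
      using prox_irreducible_extensionD(1)[OF pe'] by (auto simp: affine_isomorphism_def)
  qed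
  with pe show ?thesis by blast
qed

theorem theorem5p22:
  fixes \<gamma> :: "'g::{polish_space, topological_group_add} \<Rightarrow> 'l::locally_convex_space \<Rightarrow> 'l"
    and L :: "'l set"
  assumes "affine_flow \<gamma> L"
    and "\<And>\<alpha> (K :: ('g, 'l) extension_space set) \<phi>
          \<beta> (Q :: ('g, ('g, 'l) extension_space) extension_space set) \<psi>.
          prox_irreducible_extension \<alpha> K \<gamma> L \<phi> \<Longrightarrow>
          prox_irreducible_extension \<beta> Q \<alpha> K \<psi> \<Longrightarrow>
          prox_irreducible_extension \<beta> Q \<gamma> L (\<phi> \<circ> \<psi>)"
  shows "\<exists>(X :: ('g, 'l) extension_space topology) \<delta> \<phi>.
           flow \<delta> X \<and>
           prox_irreducible (pushforward_action \<delta>) (prob_measures X) \<and>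
           prox_irreducible_extension (pushforward_action \<delta>) (prob_measures X) \<gamma> L \<phi>"
proof -
  have "\<exists>(M :: ('g, 'l) extension_space set) \<phi>.
      prox_irreducible translate M \<and> prox_irreducible_extension translate M \<gamma> L \<phi>"
    by (rule ex_prox_irreducible_above[OF assms(1)]) (erule (1) assms(2))
  then obtain M :: "('g, 'l) extension_space set" and \<phi> where M: "prox_irreducible translate M"
    and \<phi>: "prox_irreducible_extension translate M \<gamma> L \<phi>" by blast
  have fl: "affine_flow translate M" using M by (simp add: prox_irreducible_def)
  define X where "X = top_of_set (ext_closure M)"
  let ?P = "prob_measures X" and ?t = "pushforward_action translate :: 'g \<Rightarrow> _"
  have "prox_irreducible_extension ?t ?P translate M barycenter"
    unfolding X_def by (rule prox_irreducible_extension_barycenter[OF fl])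
  then have iso: "affine_isomorphism ?t ?P translate M barycenter"
    by (rule prox_irreducible_imp_isomorphism[OF M])
  then obtain \<delta> where h: "homeomorphism ?P M barycenter \<delta>"
    by (auto simp: affine_isomorphism_def)
  have "prox_irreducible ?t ?P" by (rule prox_irreducible_isomorphic[OF M iso])
  moreover have "prox_irreducible_extension ?t ?P \<gamma> L (\<lambda>x. \<phi> (barycenter x))"
    by (rule prox_irreducible_extension_transfer[OF \<phi> affine_isomorphism_inverse[OF iso h]
          homeomorphism_symD[OF h]])
  moreover have "flow translate X" unfolding X_def by (rule flow_ext_closure[OF fl])
  ultimately show ?thesis by blast
qed

end
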